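(* Let $\Omega\subset\mathbb{R}^N$ be a bounded open connected set, $h\in C(\Omega)$ with $h\ge0$, $m\in C(\Omega)$, $M\in C(\Omega;\mathcal{S}(N))$, and $g\in C(\mathbb{R})$ increasing with $g(r_0)=0$ and $g>0$ on $(r_0,\infty)$ for some $r_0\in\mathbb{R}$. Let $\Phi(x):=\{(r,A)\in\mathbb{R}\times\mathcal{S}(N): m(x)-r\ge r_0\text{ and }A+M(x)\ge0\}$ and $\Theta(x):=\{(r,A)\in\Phi(x):g(m(x)-r)\det(A+M(x))\ge h(x)\}$. Then $\Theta$ is a Hausdorff continuous proper elliptic map and $\partial\Theta(x)\subset\{(r,A):g(m(x)-r)\det(A+M(x))=h(x)\}$ for every $x\in\Omega$. Moreover, if $u\in\mathrm{USC}(\overline\Omega)$ restricts to a $\Phi$-admissible viscosity subsolution and $v\in\mathrm{LSC}(\overline\Omega)$ restricts to a $\Phi$-admissible viscosity supersolution of $g(m(x)-u(x))\det(D^2u(x)+M(x))=h(x)$ in $\Omega$, then $u\le v$ on $\partial\Omega$ implies $u\le v$ in $\Omega$.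
   Context: $\mathcal{S}(N)$: real symmetric $N\times N$ matrices with usual partial order, eigenvalues $\lambda_i(A)$. $\mathcal{Q}:=\{(s,P): s\le0,\ P\ge0\}$. A proper elliptic map assigns to each $x\in\Omega$ a closed, nonempty set $\subsetneq\mathbb{R}\times\mathcal{S}(N)$ invariant under adding elements of $\mathcal Q$. Hausdorff continuity: with norm $\|(r,A)\|=\max\{|r|,\max_i|\lambda_i(A)|\}$ and the Hausdorff distance $d_{\mathcal H}$ (possibly $+\infty$), for all $x\in\Omega,\eta>0$ there is $\delta>0$ with $d_{\mathcal H}(\Theta(x),\Theta(y))<\eta$ for $y\in\Omega$, $|x-y|<\delta$. Let $F(x,r,A):=g(m(x)-r)\det(A+M(x))-h(x)$. $J^+_{x_0}u:=\{(\varphi(x_0),D^2\varphi(x_0)):\varphi$ is $C^2$ near $x_0$, $u\le\varphi$ near $x_0$, $u(x_0)=\varphi(x_0)\}$, $J^-_{x_0}u$ likewise with $u\ge\varphi$. $u\in\mathrm{USC}(\Omega)$ is a $\Phi$-admissible viscosity subsolution if for all $x_0$, $(r,A)\in J^+_{x_0}u$: $F(x_0,r,A)\ge0$ and $(r,A)\in\Phi(x_0)$. $v\in\mathrm{LSC}(\Omega)$ is a $\Phi$-admissible viscosity supersolution if for all $x_0$, $(r,A)\in J^-_{x_0}v$: $F(x_0,r,A)\le0$ or $(r,A)\notin(\Phi(x_0))^\circ$. *)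

theory Defs
  imports "HOL-Analysis.Analysis"
begin

definition Sym :: "(real^'n^'n) set" where
  "Sym = {A. transpose A = A}"

definition psd :: "real^'n^'n \<Rightarrow> bool" where
  "psd P \<longleftrightarrow> P \<in> Sym \<and> (\<forall>v. v \<bullet> (P *v v) \<ge> 0)"

definition eigenvals :: "real^'n^'n \<Rightarrow> real set" where
  "eigenvals A = {c. \<exists>v. v \<noteq> 0 \<and> A *v v = c *\<^sub>R v}"

definition eignorm :: "real^'n^'n \<Rightarrow> real" where
  "eignorm A = Max (abs ` eigenvals A)"

definition pnorm :: "real \<times> (real^'n^'n) \<Rightarrow> real" where
  "pnorm p = max \<bar>fst p\<bar> (eignorm (snd p))"

definition hdist :: "(real \<times> (real^'n^'n)) set \<Rightarrow> (real \<times> (real^'n^'n)) set \<Rightarrow> ereal" where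
  "hdist X Y = max (SUP p\<in>X. INF q\<in>Y. ereal (pnorm (p - q)))
                   (SUP q\<in>Y. INF p\<in>X. ereal (pnorm (p - q)))"

definition SymSp :: "(real \<times> (real^'n^'n)) set" where
  "SymSp = UNIV \<times> Sym"

abbreviation symtop :: "(real \<times> (real^'n^'n)) topology" where
  "symtop \<equiv> subtopology euclidean SymSp"

definition proper_elliptic_map :: "(real^'n) set \<Rightarrow> (real^'n \<Rightarrow> (real \<times> (real^'n^'n)) set) \<Rightarrow> bool" where
  "proper_elliptic_map \<Omega> \<Theta> \<longleftrightarrow>
     (\<forall>x\<in>\<Omega>. \<Theta> x \<subseteq> SymSp \<and> closedin symtop (\<Theta> x) \<and> \<Theta> x \<noteq> {} \<and> \<Theta> x \<noteq> SymSp \<and>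
        (\<forall>r A s P. (r, A) \<in> \<Theta> x \<longrightarrow> s \<le> 0 \<longrightarrow> psd P \<longrightarrow> (r + s, A + P) \<in> \<Theta> x))"

definition hausdorff_continuous :: "(real^'n) set \<Rightarrow> (real^'n \<Rightarrow> (real \<times> (real^'n^'n)) set) \<Rightarrow> bool" where
  "hausdorff_continuous \<Omega> \<Theta> \<longleftrightarrow>
     (\<forall>x\<in>\<Omega>. \<forall>\<eta>>0. \<exists>\<delta>>0. \<forall>y\<in>\<Omega>. norm (x - y) < \<delta> \<longrightarrow> hdist (\<Theta> x) (\<Theta> y) < ereal \<eta>)"

definition C2_hess :: "(real^'n \<Rightarrow> real) \<Rightarrow> (real^'n) set \<Rightarrow> (real^'n \<Rightarrow> real^'n^'n) \<Rightarrow> bool" where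
  "C2_hess \<phi> U H \<longleftrightarrow> open U \<and> continuous_on U H \<and>
     (\<exists>D. \<forall>y\<in>U. (\<phi> has_derivative (\<lambda>k. D y \<bullet> k)) (at y) \<and>
                 (D has_derivative (\<lambda>k. H y *v k)) (at y))"

definition Jplus :: "(real^'n) set \<Rightarrow> (real^'n \<Rightarrow> real) \<Rightarrow> real^'n \<Rightarrow> (real \<times> (real^'n^'n)) set" where
  "Jplus \<Omega> u x0 = {(\<phi> x0, H x0) | \<phi> U H. x0 \<in> U \<and> U \<subseteq> \<Omega> \<and> C2_hess \<phi> U H \<and>
                     (\<forall>y\<in>U. u y \<le> \<phi> y) \<and> u x0 = \<phi> x0}"

definition Jminus :: "(real^'n) set \<Rightarrow> (real^'n \<Rightarrow> real) \<Rightarrow> real^'n \<Rightarrow> (real \<times> (real^'n^'n)) set" where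
  "Jminus \<Omega> u x0 = {(\<phi> x0, H x0) | \<phi> U H. x0 \<in> U \<and> U \<subseteq> \<Omega> \<and> C2_hess \<phi> U H \<and>
                     (\<forall>y\<in>U. u y \<ge> \<phi> y) \<and> u x0 = \<phi> x0}"

definition usc_on :: "(real^'n) set \<Rightarrow> (real^'n \<Rightarrow> real) \<Rightarrow> bool" where
  "usc_on S u \<longleftrightarrow> (\<forall>x\<in>S. \<forall>t. u x < t \<longrightarrow> (\<exists>e>0. \<forall>y\<in>S. dist y x < e \<longrightarrow> u y < t))"

definition lsc_on :: "(real^'n) set \<Rightarrow> (real^'n \<Rightarrow> real) \<Rightarrow> bool" where
  "lsc_on S u \<longleftrightarrow> (\<forall>x\<in>S. \<forall>t. t < u x \<longrightarrow> (\<exists>e>0. \<forall>y\<in>S. dist y x < e \<longrightarrow> t < u y))"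

definition Fop :: "(real \<Rightarrow> real) \<Rightarrow> (real^'n \<Rightarrow> real) \<Rightarrow> (real^'n \<Rightarrow> real^'n^'n) \<Rightarrow> (real^'n \<Rightarrow> real)
                   \<Rightarrow> real^'n \<Rightarrow> real \<Rightarrow> real^'n^'n \<Rightarrow> real" where
  "Fop g m M h x r A = g (m x - r) * det (A + M x) - h x"

definition visc_sub :: "(real^'n) set \<Rightarrow> (real^'n \<Rightarrow> real \<Rightarrow> real^'n^'n \<Rightarrow> real)
     \<Rightarrow> (real^'n \<Rightarrow> (real \<times> (real^'n^'n)) set) \<Rightarrow> (real^'n \<Rightarrow> real) \<Rightarrow> bool" where
  "visc_sub \<Omega> F \<Phi> u \<longleftrightarrow> usc_on \<Omega> u \<and>
     (\<forall>x0\<in>\<Omega>. \<forall>r A. (r, A) \<in> Jplus \<Omega> u x0 \<longrightarrow> F x0 r A \<ge> 0 \<and> (r, A) \<in> \<Phi> x0)"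

definition visc_super :: "(real^'n) set \<Rightarrow> (real^'n \<Rightarrow> real \<Rightarrow> real^'n^'n \<Rightarrow> real)
     \<Rightarrow> (real^'n \<Rightarrow> (real \<times> (real^'n^'n)) set) \<Rightarrow> (real^'n \<Rightarrow> real) \<Rightarrow> bool" where
  "visc_super \<Omega> F \<Phi> v \<longleftrightarrow> lsc_on \<Omega> v \<and>
     (\<forall>x0\<in>\<Omega>. \<forall>r A. (r, A) \<in> Jminus \<Omega> v x0 \<longrightarrow> F x0 r A \<le> 0 \<or> (r, A) \<notin> symtop interior_of (\<Phi> x0))"

end

theory Submission
  imports Defs
begin

text \<open>
  The nonnegative matrices with \<open>det \<ge> c\<close> form an intersection of half-spaces
  \<open>tr (T\<^sup>T A T) \<ge> N (det T\<^sup>2 c)\<^bsup>1/N\<^esup>\<close> (the arithmetic-geometric mean inequality). This gives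
  monotonicity of the determinant, and \<open>det (B + \<eta> I) \<ge> det B + \<eta>\<^sup>N\<close> for \<open>B \<ge> 0\<close> makes
  \<open>(r, A) \<mapsto> (r - \<eta>, A + \<eta> I)\<close> map \<open>\<Theta> x\<close> into \<open>\<Theta> y\<close> for \<open>y\<close> near \<open>x\<close>, which is Hausdorff continuity.

  The comparison principle avoids Alexandrov's theorem. A subsolution \<open>u\<close> is locally semiconvex, hence
  continuous, and with coefficients frozen at \<open>x0\<close> its jets satisfy all the linear inequalities above. A linear
  inequality for the jets passes to mollifications: comparison with finitely many steps of a random walk
  yields a discrete form of \<open>e\<^bsup>tL\<^esup> u \<ge> u + t b\<close>, which commutes with convolution. So \<open>u\<close> is locally a
  uniform limit of smooth subsolutions, and at a positive maximum of \<open>u + \<epsilon> |x|\<^sup>2 - v\<close> these become strict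
  and touch \<open>v\<close> from below, contradicting the supersolution property.
\<close>

section \<open>Symmetric and positive semidefinite matrices\<close>

text \<open>Two obstacles shape the argument. Jets carry no information at points where nothing
  smooth touches, and mollification, being linear, preserves only convex conditions on the Hessian,
  whereas \<open>g (m x - r) * det (A + M x) \<ge> h x\<close> couples \<open>x\<close>,
  \<open>r\<close> and \<open>A\<close>. Freezing removes the coupling: close to \<open>x0\<close>
  all jets of \<open>u\<close> are moved into \<open>\<Theta> x0\<close> at the price of
  \<open>\<eta>\<close>, and the zeroth-order argument of \<open>g\<close> is replaced by one
  constant, so that \<open>g\<close> becomes a positive number. What remains,
  \<open>det \<ge> c\<close> on nonnegative matrices, is convex in \<open>A\<close> alone. The price
  is bounded because the shift by \<open>\<eta>\<close> raises \<open>g * det\<close> by an amount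
  independent of the point of \<open>\<Theta> x\<close>, even where the equation degenerates. It is
  paid back at the maximum of \<open>u + \<epsilon> |x|\<^sup>2 - v\<close>: the gap
  \<open>u - v\<close> is spent in the variable \<open>r\<close>, the extra Hessian
  \<open>2 \<epsilon> I\<close> in the variable \<open>A\<close>. Regularization is one-sided:
  \<open>v\<close> stays merely lower semicontinuous, since a smooth function touching it from below
  is all that its definition asks for.\<close>

lemma mat_vector_mult [simp]: "mat c *v x = c *\<^sub>R (x::real^'n)"
  by (simp add: vec_eq_iff matrix_vector_mult_def mat_def if_distrib[of "\<lambda>y. y * _"] cong: if_cong)

lemma norm_matrix_vector_le: "norm (A *v x) \<le> norm A * norm x"
  for A :: "real^'n^'m"
proof -
  have "norm (A *v x) \<le> L2_set (\<lambda>i. norm (A$i) * norm x) UNIV"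
    unfolding norm_vec_def[of "A *v x"]
  proof (rule L2_set_mono)
    fix i
    have "(A *v x) $ i = A$i \<bullet> x"
      by (simp add: matrix_vector_mult_def inner_vec_def)
    then show "norm ((A *v x) $ i) \<le> norm (A$i) * norm x"
      by (simp add: Cauchy_Schwarz_ineq2)
  qed simp
  also have "\<dots> = norm A * norm x"
    by (simp add: L2_set_left_distrib norm_vec_def)
  finally show ?thesis .
qed

lemma abs_quadratic_form_le: "\<bar>x \<bullet> (A *v x)\<bar> \<le> norm A * (x \<bullet> x)"
  for A :: "real^'n^'n"
proof -
  have "\<bar>x \<bullet> (A *v x)\<bar> \<le> norm x * norm (A *v x)"
    by (rule Cauchy_Schwarz_ineq2)
  also have "\<dots> \<le> norm x * (norm A * norm x)"
    by (intro mult_left_mono norm_matrix_vector_le) auto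
  finally show ?thesis
    by (simp add: dot_square_norm power2_eq_square algebra_simps)
qed

lemma Sym_add: "A \<in> Sym \<Longrightarrow> B \<in> Sym \<Longrightarrow> A + B \<in> Sym"
  and Sym_diff: "A \<in> Sym \<Longrightarrow> B \<in> Sym \<Longrightarrow> A - B \<in> Sym"
  and Sym_mat: "mat c \<in> Sym"
  and Sym_scaleR: "A \<in> Sym \<Longrightarrow> c *\<^sub>R A \<in> Sym"
  by (auto simp: Sym_def transpose_def vec_eq_iff mat_def)

lemma Sym_inner: "A \<in> Sym \<Longrightarrow> x \<bullet> (A *v y) = y \<bullet> (A *v x)"
  by (metis (mono_tags) Sym_def dot_lmul_matrix inner_commute mem_Collect_eq vector_transpose_matrix)

lemma psd_add: "psd A \<Longrightarrow> psd B \<Longrightarrow> psd (A + B)"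
  by (auto simp: psd_def Sym_add matrix_vector_mult_add_rdistrib inner_add_right)

lemma psd_mat: "0 \<le> c \<Longrightarrow> psd (mat c)"
  by (auto simp: psd_def Sym_mat)

lemma psd_add_mat_norm:
  assumes "A \<in> Sym" "norm A \<le> c" shows "psd (A + mat c)"
proof -
  have "0 \<le> x \<bullet> (A *v x) + c * (x \<bullet> x)" for x
    using abs_quadratic_form_le[of x A] mult_right_mono[OF assms(2), of "x \<bullet> x"] by simp
  then show ?thesis
    using assms by (simp add: psd_def Sym_add Sym_mat matrix_vector_mult_add_rdistrib inner_add_right)
qed

section \<open>The spectral theorem, by maximizing the quadratic form on invariant subspaces\<close>

lemma symmetric_eigenvector_in_subspace:
  fixes A :: "real^'n^'n"
  assumes A: "A \<in> Sym" and W: "subspace W" "W \<noteq> {0}" and inv: "\<And>w. w \<in> W \<Longrightarrow> A *v w \<in> W"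
  shows "\<exists>v\<in>W. norm v = 1 \<and> (\<exists>c. A *v v = c *\<^sub>R v)"
proof -
  define q where "q x = x \<bullet> (A *v x)" for x
  have "0 \<in> W" using W(1) subspace_0 by blast
  then obtain w0 where w0: "w0 \<in> W" "w0 \<noteq> 0" using W(2) by blast
  have "compact (W \<inter> sphere 0 1)"
    by (simp add: closed_subspace[OF W(1)] closed_Int_compact)
  moreover have "w0 /\<^sub>R norm w0 \<in> W \<inter> sphere 0 1"
    using w0 W(1) by (simp add: subspace_scale)
  moreover have "continuous_on (W \<inter> sphere 0 1) q"
    unfolding q_def by (intro continuous_intros matrix_vector_mult_linear_continuous_on)
  ultimately have "\<exists>x\<in>W \<inter> sphere 0 1. \<forall>y\<in>W \<inter> sphere 0 1. q y \<le> q x"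
    by (intro continuous_attains_sup) blast+
  then obtain v where v: "v \<in> W" "norm v = 1"
    and vmax: "\<And>y. y \<in> W \<Longrightarrow> norm y = 1 \<Longrightarrow> q y \<le> q v"
    by auto
  have le: "q w \<le> q v * (w \<bullet> w)" if "w \<in> W" for w
  proof (cases "w = 0")
    case False
    have "q (w /\<^sub>R norm w) \<le> q v"
      using that False W(1) by (intro vmax) (auto simp: subspace_scale)
    then show ?thesis
      using False by (simp add: q_def matrix_vector_mult_scaleR dot_square_norm power2_eq_square field_simps)
  qed (simp add: q_def)
  \<comment> \<open>The residual of the eigenvalue equation at the maximizer \<open>v\<close>.
    Moving from \<open>v\<close> in just this direction gains \<open>2 * t * (w \<bullet> w)\<close>
    to first order, so maximality forces the residual to vanish.\<close>
  define w where "w = A *v v - q v *\<^sub>R v"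
  have wW: "w \<in> W"
    unfolding w_def using v W(1) inv by (auto intro: subspace_diff subspace_scale)
  define K where "K = q v * (w \<bullet> w) - q w"
  have K: "K \<ge> 0" using le[OF wW] by (simp add: K_def)
  have lin: "2 * t * (w \<bullet> w) \<le> t\<^sup>2 * K" for t :: real
  proof -
    have "q (v + t *\<^sub>R w) \<le> q v * ((v + t *\<^sub>R w) \<bullet> (v + t *\<^sub>R w))"
      using v wW W(1) by (intro le) (auto intro: subspace_add subspace_scale)
    moreover have "q (v + t *\<^sub>R w) = q v + 2 * t * (w \<bullet> (A *v v)) + t\<^sup>2 * q w"
      using Sym_inner[OF A, of v w]
      by (simp add: q_def matrix_vector_right_distrib matrix_vector_mult_scaleR inner_add_left inner_add_right
          power2_eq_square algebra_simps)
    moreover have "(v + t *\<^sub>R w) \<bullet> (v + t *\<^sub>R w) = 1 + 2 * t * (w \<bullet> v) + t\<^sup>2 * (w \<bullet> w)"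
      using v(2) by (simp add: inner_add_left inner_add_right norm_eq_1 inner_commute power2_eq_square algebra_simps)
    moreover have "w \<bullet> (A *v v) = w \<bullet> w + q v * (w \<bullet> v)"
      by (simp add: w_def algebra_simps inner_diff_left inner_diff_right inner_commute)
    ultimately have "q v + 2 * t * (w \<bullet> w + q v * (w \<bullet> v)) + t\<^sup>2 * q w
        \<le> q v * (1 + 2 * t * (w \<bullet> v) + t\<^sup>2 * (w \<bullet> w))"
      by simp
    then show ?thesis
      by (simp add: K_def algebra_simps)
  qed
  have "w = 0"
  proof (rule ccontr)
    assume "w \<noteq> 0"
    then have p: "w \<bullet> w > 0" by simp
    \<comment> \<open>Short enough for the first-order gain to beat the quadratic loss;
      \<open>K + 1\<close> keeps the denominator positive when \<open>K = 0\<close>.\<close>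
    let ?t = "(w \<bullet> w) / (K + 1)"
    have t: "?t > 0" using p K by simp
    have "?t * (2 * (w \<bullet> w)) \<le> ?t * (?t * K)"
      using lin[of ?t] by (simp only: power2_eq_square ac_simps)
    then have "2 * (w \<bullet> w) \<le> ?t * K"
      using t by (simp only: mult_le_cancel_left_pos)
    also have "\<dots> \<le> w \<bullet> w"
      using K p by (simp add: field_simps)
    finally show False using p by simp
  qed
  then show ?thesis
    using v by (auto simp: w_def)
qed

text \<open>A largest orthonormal set of eigenvectors must span: otherwise its orthogonal complement
  is a nonzero subspace, invariant because \<open>A\<close> is symmetric, and contributes one more
  unit eigenvector.\<close>

lemma symmetric_matrix_orthonormal_eigenbasis:
  fixes A :: "real^'n^'n"
  assumes A: "A \<in> Sym"
  obtains S where "pairwise orthogonal S" "finite S" "card S = CARD('n)"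
    "\<And>x. x \<in> S \<Longrightarrow> norm x = 1" "\<And>x. x \<in> S \<Longrightarrow> \<exists>c. A *v x = c *\<^sub>R x"
proof -
  define good where "good S \<longleftrightarrow> pairwise orthogonal S \<and> (\<forall>x\<in>S. norm x = 1 \<and> (\<exists>c. A *v x = c *\<^sub>R x))" for S
  have ind: "independent S" if "good S" for S
    using that by (intro pairwise_orthogonal_independent) (auto simp: good_def)
  have fin: "finite S" if "good S" for S
    using finiteI_independent[OF ind[OF that]] .
  have bound: "card S \<le> CARD('n)" if "good S" for S
    using independent_bound[OF ind[OF that]] by simp
  have "\<exists>S. good S \<and> (\<forall>S'. good S' \<longrightarrow> card S' \<le> card S)"
  proof (rule Lattices_Big.ex_has_greatest_nat)
    show "good {}" by (simp add: good_def)
    show "\<forall>S. good S \<longrightarrow> card S < Suc CARD('n)" using bound by (simp add: less_Suc_eq_le)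
  qed
  then obtain S where S: "good S" and mx: "\<And>S'. good S' \<Longrightarrow> card S' \<le> card S"
    by blast
  have "card S = CARD('n)"
  proof (rule ccontr)
    assume "card S \<noteq> CARD('n)"
    then have lt: "card S < CARD('n)" using bound[OF S] by simp
    define W where "W = {y. \<forall>x\<in>S. orthogonal x y}"
    have sub: "subspace W"
      unfolding W_def by (rule subspace_orthogonal_to_vectors)
    have "dim (span S) < CARD('n)"
      using lt dim_eq_card[OF refl ind[OF S]] by simp
    then have "span S \<noteq> UNIV"
      by (metis dim_UNIV DIM_cart DIM_real mult.right_neutral nat_neq_iff)
    then have "span S \<subset> span UNIV" by auto
    from orthogonal_to_subspace_exists_gen[OF this]
    obtain y where y: "y \<noteq> 0" "\<And>x. x \<in> span S \<Longrightarrow> orthogonal y x" by blast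
    have "W \<noteq> {0}"
      using y by (auto simp: W_def orthogonal_commute span_base)
    moreover have "A *v w \<in> W" if "w \<in> W" for w
    proof -
      have "orthogonal x (A *v w)" if "x \<in> S" for x
      proof -
        obtain c where "A *v x = c *\<^sub>R x" using S \<open>x \<in> S\<close> by (auto simp: good_def)
        then show ?thesis
          using Sym_inner[OF A, of x w] \<open>w \<in> W\<close> \<open>x \<in> S\<close>
          by (auto simp: orthogonal_def W_def inner_commute)
      qed
      then show ?thesis by (simp add: W_def)
    qed
    ultimately obtain v c where v: "v \<in> W" "norm v = 1" "A *v v = c *\<^sub>R v"
      using symmetric_eigenvector_in_subspace[OF A sub] by blast
    have "v \<notin> S"
      using v by (auto simp: W_def orthogonal_def norm_eq_1)
    have "good (insert v S)"
      using S v by (auto simp: good_def pairwise_insert W_def orthogonal_commute)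
    from mx[OF this] show False
      using \<open>v \<notin> S\<close> fin[OF S] by simp
  qed
  with that[of S] S fin[OF S] show thesis
    by (auto simp: good_def)
qed

definition diag :: "('n \<Rightarrow> real) \<Rightarrow> real^'n^'n" where
  "diag d = (\<chi> i j. if i = j then d i else 0)"

lemma det_diag: "det (diag d) = (\<Prod>i\<in>UNIV. d i)"
  by (simp add: det_diagonal diag_def)

lemma trace_diag: "trace (diag d) = (\<Sum>i\<in>UNIV. d i)"
  by (simp add: trace_def diag_def)

lemma diag_mult: "diag d ** diag e = diag (\<lambda>i. d i * e i)"
  by (simp add: diag_def matrix_matrix_mult_def vec_eq_iff if_distrib[of "\<lambda>y. y * _"] cong: if_cong)

lemma transpose_diag: "transpose (diag d) = diag d"
  by (auto simp: diag_def transpose_def vec_eq_iff)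

lemma symmetric_matrix_diagonalizable:
  fixes A :: "real^'n^'n"
  assumes A: "A \<in> Sym"
  obtains P d where "orthogonal_matrix P" "transpose P ** A ** P = diag d"
proof -
  obtain S where S: "pairwise orthogonal S" "finite S" "card S = CARD('n)"
    "\<And>x. x \<in> S \<Longrightarrow> norm x = 1" "\<And>x. x \<in> S \<Longrightarrow> \<exists>c. A *v x = c *\<^sub>R x"
    using symmetric_matrix_orthonormal_eigenbasis[OF A] by blast
  obtain f where f: "bij_betw f (UNIV::'n set) S"
    by (metis S(2,3) finite_class.finite_UNIV finite_same_card_bij)
  then have fS: "f i \<in> S" for i by (auto simp: bij_betw_def)
  have nrm: "norm (f i) = 1" for i using S(4) fS by blast
  have orth: "orthogonal (f i) (f j)" if "i \<noteq> j" for i j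
    using pairwiseD[OF S(1) fS fS] bij_betw_imp_inj_on[OF f] that by (simp add: inj_eq)
  obtain d where d: "\<And>i. A *v f i = d i *\<^sub>R f i"
    using choice[of "\<lambda>i c. A *v f i = c *\<^sub>R f i"] S(5)[OF fS] by blast
  define P :: "real^'n^'n" where "P = (\<chi> i j. f j $ i)"
  have colP: "column i P = f i" for i
    by (simp add: P_def column_def vec_eq_iff)
  have "orthogonal_matrix P"
    using orth by (simp add: orthogonal_matrix_orthonormal_columns colP nrm)
  moreover have "transpose P ** A ** P = diag d"
  proof -
    have AP: "A ** P = (\<chi> i j. d j * P$i$j)"
    proof -
      have "(A ** P) $ i $ j = (A *v f j) $ i" for i j
        by (simp add: matrix_matrix_mult_def matrix_vector_mult_def P_def)
      then show ?thesis
        by (simp add: vec_eq_iff d P_def)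
    qed
    have "(transpose P ** (A ** P)) $ i $ j = d j * (f i \<bullet> f j)" for i j
      unfolding AP
      by (simp add: matrix_matrix_mult_def transpose_def P_def inner_vec_def sum_distrib_left algebra_simps)
    then show ?thesis
      using orth nrm by (auto simp: vec_eq_iff diag_def matrix_mul_assoc[symmetric] orthogonal_def norm_eq_1)
  qed
  ultimately show thesis by (rule that)
qed

lemma orthogonal_conj_eq:
  assumes P: "orthogonal_matrix P" and D: "transpose P ** A ** P = D"
  shows "A = P ** D ** transpose P"
proof -
  have "P ** (transpose P ** A ** P) ** transpose P = (P ** transpose P) ** A ** (P ** transpose P)"
    by (simp add: matrix_mul_assoc)
  then show ?thesis using P D by (simp add: orthogonal_matrix_def)
qed

lemma det_orthogonal_conj:
  fixes A :: "real^'n^'n"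
  assumes "orthogonal_matrix P" shows "det (transpose P ** A ** P) = det A"
  using det_orthogonal_matrix[OF assms] by (auto simp: det_mul)

lemma psd_conj:
  fixes A :: "real^'n^'n"
  assumes "psd A" shows "psd (transpose T ** A ** T)"
proof -
  have "transpose T ** A ** T \<in> Sym"
    using assms by (simp add: psd_def Sym_def matrix_transpose_mul matrix_mul_assoc)
  moreover have "v \<bullet> ((transpose T ** A ** T) *v v) = (T *v v) \<bullet> (A *v (T *v v))" for v
    by (simp add: matrix_vector_mul_assoc[symmetric]) (metis dot_lmul_matrix inner_commute)
  ultimately show ?thesis
    using assms by (simp add: psd_def)
qed

lemma psd_diag_nonneg:
  assumes "psd (diag d)" shows "0 \<le> d i"
proof -
  have "diag d *v axis i 1 = d i *\<^sub>R axis i 1"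
    by (auto simp: diag_def matrix_vector_mult_def vec_eq_iff axis_def if_distrib[of "\<lambda>x. _ * x"] cong: if_cong)
  then have "axis i 1 \<bullet> (diag d *v axis i 1) = d i"
    by (simp add: inner_axis_axis)
  then show ?thesis using assms by (metis psd_def)
qed

lemma psd_diagonalizable:
  fixes A :: "real^'n^'n"
  assumes "psd A"
  obtains P d where "orthogonal_matrix P" "transpose P ** A ** P = diag d" "\<And>i. 0 \<le> d i"
    "det A = (\<Prod>i\<in>UNIV. d i)"
proof -
  obtain P d where P: "orthogonal_matrix P" "transpose P ** A ** P = diag d"
    using symmetric_matrix_diagonalizable assms psd_def by blast
  have "psd (diag d)" using psd_conj[OF assms, of P] P by simp
  then have "0 \<le> d i" for i by (rule psd_diag_nonneg)
  moreover have "det A = (\<Prod>i\<in>UNIV. d i)"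
    using det_orthogonal_conj[OF P(1), of A] P(2) det_diag by metis
  ultimately show thesis using P that by blast
qed

section \<open>Determinant inequalities for nonnegative matrices\<close>

lemma psd_det_nonneg: assumes "psd A" shows "0 \<le> det A"
proof -
  obtain P d where "orthogonal_matrix P" "transpose P ** A ** P = diag d" "\<And>i. 0 \<le> d i"
    "det A = (\<Prod>i\<in>UNIV. d i)"
    using psd_diagonalizable[OF assms] by metis
  then show ?thesis by (simp add: prod_nonneg)
qed

text \<open>All mixed terms in the expansion of the right-hand product are nonnegative, and only the
  two pure ones are kept. For empty \<open>S\<close> both pure terms are the same 1, and the bound
  would read \<open>2 \<le> 1\<close>.\<close>

lemma prod_add_ge:
  fixes d :: "'a \<Rightarrow> real"
  assumes "finite S" "S \<noteq> {}" "\<And>i. 0 \<le> d i" "0 \<le> c"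
  shows "(\<Prod>i\<in>S. d i) + c ^ card S \<le> (\<Prod>i\<in>S. d i + c)"
  using assms(1,2)
proof (induction S rule: finite_ne_induct)
  case (insert x F)
  have "(\<Prod>i\<in>insert x F. d i) + c ^ card (insert x F) = d x * (\<Prod>i\<in>F. d i) + c * c ^ card F"
    using insert by simp
  also have "\<dots> \<le> (d x + c) * ((\<Prod>i\<in>F. d i) + c ^ card F)"
    using assms by (simp add: algebra_simps prod_nonneg)
  also have "\<dots> \<le> (d x + c) * (\<Prod>i\<in>F. d i + c)"
    using assms insert by (intro mult_left_mono) auto
  finally show ?case using insert by simp
qed simp

lemma matrix_add_rdistrib: "(A + B) ** C = A ** C + B ** C"
  for A B :: "real^'n^'m"
  by (simp add: matrix_matrix_mult_def vec_eq_iff sum.distrib algebra_simps)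

lemma orthogonal_conj_mat:
  fixes P :: "real^'n^'n"
  assumes "orthogonal_matrix P" shows "transpose P ** mat c ** P = mat c"
proof -
  have "(transpose P ** mat c ** P) *v x = mat c *v x" for x
    using assms
    by (simp only: matrix_vector_mul_assoc[symmetric] matrix_vector_mult_scaleR mat_vector_mult)
      (simp only: matrix_vector_mul_assoc orthogonal_matrix_def matrix_vector_mul_lid)
  then show ?thesis by (simp add: matrix_eq)
qed

text \<open>Multiples of the identity are unchanged by orthogonal conjugation, so \<open>c\<close>
  is added to each eigenvalue. The gain is additive and hence still positive where
  \<open>det B = 0\<close>.\<close>

lemma det_add_mat_ge:
  fixes B :: "real^'n^'n"
  assumes "psd B" "0 \<le> c" shows "det B + c ^ CARD('n) \<le> det (B + mat c)"
proof -
  obtain P d where P: "orthogonal_matrix P" "transpose P ** B ** P = diag d" "\<And>i. 0 \<le> d i"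
    "det B = (\<Prod>i\<in>UNIV. d i)"
    using psd_diagonalizable[OF assms(1)] by metis
  have "transpose P ** mat c ** P = mat c" by (rule orthogonal_conj_mat[OF P(1)])
  then have "transpose P ** (B + mat c) ** P = diag d + mat c"
    using P(2) by (simp add: matrix_add_ldistrib matrix_add_rdistrib)
  also have "\<dots> = diag (\<lambda>i. d i + c)"
    by (simp add: diag_def mat_def vec_eq_iff)
  finally have "transpose P ** (B + mat c) ** P = diag (\<lambda>i. d i + c)" .
  then have "det (B + mat c) = (\<Prod>i\<in>UNIV. d i + c)"
    using det_orthogonal_conj[OF P(1), of "B + mat c"] det_diag by metis
  then show ?thesis
    using prod_add_ge[of UNIV d c] P assms(2) by simp
qed

lemma continuous_on_det [continuous_intros]:
  "continuous_on S f \<Longrightarrow> continuous_on S (\<lambda>x. det (f x :: real^'n^'n))"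
  unfolding det_def by (intro continuous_intros)

text \<open>The linear functional \<open>trace (A ** (T ** transpose T))\<close>, written through
  the columns of \<open>T\<close>: for a Hessian \<open>A\<close> it is a sum of second derivatives
  along these columns, which later become the jumps of the random walk.\<close>

definition qtr :: "real^'n^'n \<Rightarrow> real^'n^'n \<Rightarrow> real" where
  "qtr T A = (\<Sum>i\<in>UNIV. column i T \<bullet> (A *v column i T))"

lemma qtr_eq_trace: "qtr T A = trace (transpose T ** A ** T)"
proof -
  have "(transpose T ** A ** T) $ i $ i = column i T \<bullet> (A *v column i T)" for i
    by (simp add: matrix_mul_assoc[symmetric])
      (simp add: matrix_matrix_mult_def transpose_def column_def inner_vec_def matrix_vector_mult_def)
  then show ?thesis by (simp add: qtr_def trace_def)
qed

lemma qtr_add: "qtr T (A + B) = qtr T A + qtr T B"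
  by (simp add: qtr_def matrix_vector_mult_add_rdistrib inner_add_right sum.distrib)

lemma qtr_diff: "qtr T (A - B) = qtr T A - qtr T B"
  by (simp add: qtr_def matrix_vector_mult_diff_rdistrib inner_diff_right sum_subtractf)

lemma qtr_nonneg: "psd A \<Longrightarrow> 0 \<le> qtr T A"
  unfolding qtr_def by (intro sum_nonneg) (auto simp: psd_def)

text \<open>\<open>qtr_ge_det\<close> and \<open>psd_det_geI\<close> together express \<open>{A \<ge> 0. det A \<ge> c}\<close> as an intersection of
  half-spaces, that is, \<open>(det A)\<^bsup>1/N\<^esup>\<close> as an infimum of linear functionals of \<open>A\<close>.\<close>

lemma qtr_ge_det:
  fixes A :: "real^'n^'n"
  assumes A: "psd A" and c: "0 \<le> c" "c \<le> det A"
  shows "CARD('n) * ((det T)\<^sup>2 * c) powr (1 / CARD('n)) \<le> qtr T A"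
proof -
  have "psd (transpose T ** A ** T)" by (rule psd_conj[OF A])
  then obtain P d where P: "orthogonal_matrix P" "transpose P ** (transpose T ** A ** T) ** P = diag d"
    and d: "\<And>i. 0 \<le> d i" "det (transpose T ** A ** T) = (\<Prod>i\<in>UNIV. d i)"
    using psd_diagonalizable by metis
  have "qtr T A = trace ((transpose T ** A ** T) ** (P ** transpose P))"
    using P(1) by (simp add: qtr_eq_trace orthogonal_matrix_def)
  also have "\<dots> = trace (transpose P ** (transpose T ** A ** T) ** P)"
    by (metis matrix_mul_assoc trace_mul_sym)
  finally have tr: "qtr T A = (\<Sum>i\<in>UNIV. d i)"
    by (simp add: P(2) trace_diag)
  have "((det T)\<^sup>2 * c) powr (1 / CARD('n)) \<le> ((det T)\<^sup>2 * det A) powr (1 / CARD('n))"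
    using c by (intro powr_mono2) (auto intro: mult_left_mono)
  also have "(det T)\<^sup>2 * det A = (\<Prod>i\<in>UNIV. d i)"
    using d(2) by (simp add: det_mul power2_eq_square mult_ac)
  also have "(\<Prod>i\<in>UNIV. d i) powr (1 / CARD('n)) \<le> (\<Sum>i\<in>UNIV. d i / CARD('n))"
    using d(1) by (intro arith_geom_mean) auto
  also have "\<dots> = qtr T A / CARD('n)"
    by (simp add: tr sum_divide_distrib)
  finally show ?thesis
    by (simp add: field_simps)
qed

lemma psd_det_geI:
  fixes D :: "real^'n^'n"
  assumes D: "D \<in> Sym" and c: "0 \<le> c"
    and q: "\<And>T. CARD('n) * ((det T)\<^sup>2 * c) powr (1 / CARD('n)) \<le> qtr T D"
  shows "psd D" "c \<le> det D"
proof -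
  have "0 \<le> v \<bullet> (D *v v)" for v
  proof -
    fix i0 :: 'n
    \<comment> \<open>With \<open>v\<close> as the only nonzero column, \<open>qtr T D\<close> is
      the quadratic form at \<open>v\<close>; its assumed lower bound is nonnegative whatever
      \<open>det T\<close> is.\<close>
    define T :: "real^'n^'n" where "T = (\<chi> i j. if j = i0 then v$i else 0)"
    have "column j T = (if j = i0 then v else 0)" for j
      by (simp add: T_def column_def vec_eq_iff)
    then have "qtr T D = v \<bullet> (D *v v)"
      by (simp add: qtr_def if_distrib[of "\<lambda>x. x \<bullet> _"] if_distrib[of "\<lambda>x. _ \<bullet> x"] cong: if_cong)
    moreover have "0 \<le> CARD('n) * ((det T)\<^sup>2 * c) powr (1 / CARD('n))"
      by simp
    ultimately show ?thesis using q[of T] by linarith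
  qed
  then show psd: "psd D" using D by (simp add: psd_def)
  obtain P d where P: "orthogonal_matrix P" "transpose P ** D ** P = diag d" "\<And>i. 0 \<le> d i"
    "det D = (\<Prod>i\<in>UNIV. d i)"
    using psd_diagonalizable[OF psd] by metis
  \<comment> \<open>Equality in the arithmetic-geometric mean inequality would need a
    \<open>T\<close> that turns \<open>D\<close> into the identity, hence an invertible
    \<open>D\<close>. The shift by \<open>s\<close> makes such a \<open>T\<close> available up to an
    error that vanishes in the limit.\<close>
  have ge: "c \<le> (\<Prod>i\<in>UNIV. d i + s)" if s: "0 < s" for s
  proof -
    define T where "T = P ** diag (\<lambda>i. 1 / sqrt (d i + s))"
    have pos: "0 < d i + s" for i using P(3)[of i] s by linarith
    have "transpose T ** D ** T = diag (\<lambda>i. 1 / sqrt (d i + s)) ** (transpose P ** D ** P) ** diag (\<lambda>i. 1 / sqrt (d i + s))"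
      by (simp add: T_def matrix_transpose_mul transpose_diag matrix_mul_assoc)
    also have "\<dots> = diag (\<lambda>i. d i / (d i + s))"
      using pos by (simp add: P(2) diag_mult) (simp add: real_sqrt_mult_self less_imp_le)
    finally have qtr: "qtr T D = (\<Sum>i\<in>UNIV. d i / (d i + s))"
      by (simp add: qtr_eq_trace trace_diag)
    have "qtr T D \<le> (\<Sum>i\<in>(UNIV::'n set). 1)"
      unfolding qtr using s pos by (intro sum_mono) (simp add: less_imp_le)
    also have "\<dots> = CARD('n)" by simp
    finally have "CARD('n) * ((det T)\<^sup>2 * c) powr (1 / CARD('n)) \<le> CARD('n)"
      using q[of T] by (rule order_trans[rotated])
    then have le1: "((det T)\<^sup>2 * c) powr (1 / CARD('n)) \<le> 1"
      by (metis mult_le_cancel_left_pos mult.right_neutral of_nat_0_less_iff zero_less_card_finite)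
    have "(det T)\<^sup>2 * c \<le> 1"
    proof (rule ccontr)
      assume "\<not> (det T)\<^sup>2 * c \<le> 1"
      then have "1 < ((det T)\<^sup>2 * c) powr (1 / CARD('n))"
        by (intro gr_one_powr) auto
      with le1 show False by simp
    qed
    moreover have "(det T)\<^sup>2 = 1 / (\<Prod>i\<in>UNIV. d i + s)"
    proof -
      have "(det P)\<^sup>2 = 1" using det_orthogonal_matrix[OF P(1)] by auto
      then have "(det T)\<^sup>2 = (\<Prod>i\<in>UNIV. (1 / sqrt (d i + s))\<^sup>2)"
        by (simp only: T_def det_mul power_mult_distrib det_diag prod_power_distrib)
      also have "\<dots> = (\<Prod>i\<in>UNIV. 1 / (d i + s))"
        using pos by (intro prod.cong) (simp_all add: power_divide less_imp_le)
      finally show ?thesis by (simp add: prod_dividef)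
    qed
    moreover have "0 < (\<Prod>i\<in>UNIV. d i + s)" using pos by (intro prod_pos) auto
    ultimately show ?thesis by (simp add: field_simps)
  qed
  have "((\<lambda>s. \<Prod>i\<in>UNIV. d i + s) \<longlongrightarrow> (\<Prod>i\<in>UNIV. d i + 0)) (at_right 0)"
    by (intro tendsto_intros)
  moreover have "eventually (\<lambda>s. c \<le> (\<Prod>i\<in>UNIV. d i + s)) (at_right 0)"
    using ge by (auto simp: eventually_at_right_field intro!: exI[of _ 1])
  ultimately have "c \<le> (\<Prod>i\<in>UNIV. d i + 0)"
    by (intro tendsto_lowerbound) auto
  then show "c \<le> det D" using P(4) by simp
qed

text \<open>Each half-space inequality satisfied by \<open>B\<close> passes to \<open>B'\<close>,
  because \<open>qtr T\<close> is nonnegative on \<open>B' - B\<close>. In this way the two matrices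
  never have to be diagonalized together.\<close>

lemma det_mono_psd:
  assumes "psd B" "psd (B' - B)" shows "psd B'" "det B \<le> det B'"
proof -
  have "B' \<in> Sym" using assms Sym_add[of B "B' - B"] by (simp add: psd_def)
  moreover have "CARD('a) * ((det T)\<^sup>2 * det B) powr (1 / CARD('a)) \<le> qtr T B'" for T
    using qtr_ge_det[OF assms(1) psd_det_nonneg[OF assms(1)] order_refl, of T]
      qtr_nonneg[OF assms(2), of T] by (simp add: qtr_diff)
  ultimately show "psd B'" "det B \<le> det B'"
    using psd_det_geI psd_det_nonneg[OF assms(1)] by blast+
qed

lemma psd_diag: assumes "\<And>i. 0 \<le> d i" shows "psd (diag d)"
proof -
  have "diag d *v v = (\<chi> i. d i * v$i)" for v
    by (simp add: diag_def matrix_vector_mult_def vec_eq_iff if_distrib[of "\<lambda>y. y * _"] cong: if_cong)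
  then have "v \<bullet> (diag d *v v) = (\<Sum>i\<in>UNIV. d i * (v$i * v$i))" for v
    by (simp add: inner_vec_def algebra_simps)
  then show ?thesis
    using assms by (auto simp: psd_def Sym_def transpose_diag intro!: sum_nonneg)
qed

lemma psd_diff_mat:
  fixes B :: "real^'n^'n"
  assumes B: "psd B" and det: "0 < det B"
  shows "\<exists>t>0. psd (B - mat t)"
proof -
  obtain P d where P: "orthogonal_matrix P" "transpose P ** B ** P = diag d" "\<And>i. 0 \<le> d i"
    "det B = (\<Prod>i\<in>UNIV. d i)"
    using psd_diagonalizable[OF B] by metis
  have "prod d UNIV \<noteq> 0" using det P(4) by linarith
  then have "d i \<noteq> 0" for i by simp
  then have dpos: "0 < d i" for i using P(3)[of i] by (simp add: less_le)
  define t where "t = Min (range d)"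
  have t: "0 < t" "t \<le> d i" for i using dpos by (auto simp: t_def)
  have "transpose P ** (B - mat t) ** P = diag (\<lambda>i. d i - t)"
  proof -
    have "diag d = transpose P ** (B - mat t) ** P + transpose P ** mat t ** P"
      by (simp add: P(2)[symmetric] matrix_add_ldistrib[symmetric] matrix_add_rdistrib[symmetric])
    also have "transpose P ** mat t ** P = mat t" by (rule orthogonal_conj_mat[OF P(1)])
    finally have "transpose P ** (B - mat t) ** P = diag d - mat t"
      by (simp add: algebra_simps)
    also have "\<dots> = diag (\<lambda>i. d i - t)"
      by (simp add: diag_def mat_def vec_eq_iff)
    finally show ?thesis .
  qed
  then have "B - mat t = transpose (transpose P) ** diag (\<lambda>i. d i - t) ** transpose P"
    using orthogonal_conj_eq[OF P(1), of "B - mat t"] by (simp only: transpose_transpose)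
  moreover have "psd (diag (\<lambda>i. d i - t))" using t by (intro psd_diag) simp
  ultimately have "psd (B - mat t)"
    using psd_conj[of "diag (\<lambda>i. d i - t)" "transpose P"] by simp
  then show ?thesis using t by blast
qed

text \<open>The Hausdorff estimates compare only points that differ by a multiple of
  \<open>(-1, I)\<close>, so no other eigenvalue norm has to be computed. The axis vector is there
  to show that the set under \<open>Max\<close> is nonempty.\<close>

lemma pnorm_mat:
  assumes "\<bar>a\<bar> = \<bar>b\<bar>" shows "pnorm (a, mat b :: real^'n^'n) = \<bar>b\<bar>"
proof -
  have "axis undefined 1 \<noteq> (0 :: real^'n)" by (simp add: axis_eq_0_iff)
  then have "eigenvals (mat b :: real^'n^'n) = {b}"
    by (auto simp: eigenvals_def intro!: exI[of _ "axis undefined 1"])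
  then show ?thesis using assms by (simp add: pnorm_def eignorm_def)
qed

lemma closed_Sym: "closed (Sym :: (real^'n^'n) set)"
proof -
  have "Sym = (\<Inter>i j. {A :: real^'n^'n. A$j$i = A$i$j})"
    by (auto simp: Sym_def transpose_def vec_eq_iff)
  also have "closed \<dots>"
    by (intro closed_INT ballI closed_Collect_eq continuous_intros)
  finally show ?thesis .
qed

lemma closed_psd: "closed {A :: real^'n^'n. psd A}"
proof -
  have "{A :: real^'n^'n. psd A} = Sym \<inter> (\<Inter>v. {A. 0 \<le> v \<bullet> (A *v v)})"
    by (auto simp: psd_def)
  also have "closed \<dots>"
    by (intro closed_Int closed_Sym closed_INT ballI closed_Collect_le continuous_intros
        linear_continuous_on linear_conv_bounded_linear[THEN iffD1] linearI)
      (auto simp: matrix_vector_mult_add_rdistrib scaleR_matrix_vector_assoc)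
  finally show ?thesis .
qed

section \<open>The elliptic map\<close>

locale monge_ampere =
  fixes \<Omega> :: "(real^'n) set"
    and h m :: "real^'n \<Rightarrow> real"
    and M :: "real^'n \<Rightarrow> real^'n^'n"
    and g :: "real \<Rightarrow> real"
    and r0 :: real
    and \<Phi> \<Theta> :: "real^'n \<Rightarrow> (real \<times> (real^'n^'n)) set"
  assumes bounded_domain: "bounded \<Omega>" and open_domain: "open \<Omega>"
    and cont_h: "continuous_on \<Omega> h" and h_nonneg: "\<And>x. x \<in> \<Omega> \<Longrightarrow> 0 \<le> h x"
    and cont_m: "continuous_on \<Omega> m"
    and cont_M: "continuous_on \<Omega> M" and M_Sym: "\<And>x. x \<in> \<Omega> \<Longrightarrow> M x \<in> Sym"
    and cont_g: "continuous_on UNIV g" and mono_g: "mono g" and g_r0: "g r0 = 0"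
    and g_pos: "\<And>r. r0 < r \<Longrightarrow> 0 < g r"
    and \<Phi>_def: "\<And>x. \<Phi> x = {(r, A). A \<in> Sym \<and> m x - r \<ge> r0 \<and> psd (A + M x)}"
    and \<Theta>_def: "\<And>x. \<Theta> x = {(r, A). (r, A) \<in> \<Phi> x \<and> g (m x - r) * det (A + M x) \<ge> h x}"
begin

lemma \<Theta>_iff: "(r, A) \<in> \<Theta> x \<longleftrightarrow>
    A \<in> Sym \<and> r0 \<le> m x - r \<and> psd (A + M x) \<and> h x \<le> g (m x - r) * det (A + M x)"
  unfolding \<Theta>_def \<Phi>_def by simp

lemma g_nonneg: "r0 \<le> s \<Longrightarrow> 0 \<le> g s"
  using g_r0 monoD[OF mono_g, of r0 s] by simp

text \<open>Both factors are raised at once, so the gain survives where one of them vanishes: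
  \<open>g s'\<close> multiplies the additive gain \<open>\<theta> ^ CARD('n)\<close> of the
  determinant, and \<open>g s' \<ge> g (r0 + \<theta>)\<close> because \<open>s \<ge> r0\<close>.
  The bound depends on neither \<open>s\<close> nor \<open>B\<close>.\<close>

lemma product_gain:
  fixes B B' :: "real^'n^'n"
  assumes "r0 \<le> s" "psd B" "0 \<le> \<theta>" "s + \<theta> \<le> s'" "psd (B' - (B + mat \<theta>))"
  shows "g s * det B + g (r0 + \<theta>) * \<theta> ^ CARD('n) \<le> g s' * det B'" "psd B'"
proof -
  have psd: "psd (B + mat \<theta>)" using assms by (intro psd_add psd_mat)
  show "psd B'" by (rule det_mono_psd(1)[OF psd assms(5)])
  have "det B + \<theta> ^ CARD('n) \<le> det (B + mat \<theta>)"
    by (rule det_add_mat_ge[OF assms(2,3)])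
  also have "\<dots> \<le> det B'" by (rule det_mono_psd(2)[OF psd assms(5)])
  finally have det: "det B + \<theta> ^ CARD('n) \<le> det B'" .
  have "g s * det B + g (r0 + \<theta>) * \<theta> ^ CARD('n) \<le> g s' * det B + g s' * \<theta> ^ CARD('n)"
    using assms psd_det_nonneg[OF assms(2)]
    by (intro add_mono mult_right_mono monoD[OF mono_g]) auto
  also have "\<dots> \<le> g s' * det B'"
    using det g_nonneg[of s'] assms by (simp add: distrib_left[symmetric] mult_left_mono)
  finally show "g s * det B + g (r0 + \<theta>) * \<theta> ^ CARD('n) \<le> g s' * det B'" .
qed

lemma \<Theta>_add:
  assumes "(r, A) \<in> \<Theta> x" "s \<le> 0" "psd P"
  shows "(r + s, A + P) \<in> \<Theta> x"
proof -
  have *: "A \<in> Sym" "r0 \<le> m x - r" "psd (A + M x)" "h x \<le> g (m x - r) * det (A + M x)"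
    using assms(1) by (auto simp: \<Theta>_iff)
  have "psd (A + P + M x - (A + M x + mat 0))"
    using assms(3) by (simp add: mat_0)
  \<comment> \<open>The case \<open>\<theta> = 0\<close>, in which the gain is zero and plain
    monotonicity is left.\<close>
  from product_gain[OF *(2,3) order_refl _ this, of "m x - (r + s)"] * assms show ?thesis
    using psd_def[of P] by (auto simp: \<Theta>_iff Sym_add power_0_left)
qed

text \<open>The shift is spent in two halves: one absorbs the variation of \<open>m\<close> and
  \<open>M\<close> between \<open>x\<close> and \<open>y\<close>, the other produces the gain in the
  product that absorbs the variation of \<open>h\<close>.\<close>

lemma \<Theta>_shift_aux:
  assumes "x \<in> \<Omega>" "y \<in> \<Omega>" "0 < \<eta>"
    and "\<bar>m x - m y\<bar> \<le> \<eta> / 2" "norm (M x - M y) \<le> \<eta> / 2"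
    and "\<bar>h x - h y\<bar> \<le> g (r0 + \<eta> / 2) * (\<eta> / 2) ^ CARD('n)"
    and "(r, A) \<in> \<Theta> x"
  shows "(r - \<eta>, A + mat \<eta>) \<in> \<Theta> y"
proof -
  have *: "A \<in> Sym" "r0 \<le> m x - r" "psd (A + M x)" "h x \<le> g (m x - r) * det (A + M x)"
    using assms(7) by (auto simp: \<Theta>_iff)
  have half: "mat \<eta> = mat (\<eta>/2) + (mat (\<eta>/2) :: real^'n^'n)"
    by (simp add: mat_def vec_eq_iff)
  have "psd (M y - M x + mat (\<eta> / 2))"
    using assms by (intro psd_add_mat_norm Sym_diff M_Sym) (auto simp: norm_minus_commute)
  moreover have "M y - M x + mat (\<eta> / 2) = A + mat \<eta> + M y - (A + M x + mat (\<eta>/2))"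
    by (simp add: half)
  ultimately have pos: "psd (A + mat \<eta> + M y - (A + M x + mat (\<eta>/2)))" by simp
  have le: "m x - r + \<eta>/2 \<le> m y - (r - \<eta>)" using assms(4) by linarith
  have "psd (A + mat \<eta> + M y)"
    and "g (m x - r) * det (A + M x) + g (r0 + \<eta>/2) * (\<eta>/2) ^ CARD('n)
      \<le> g (m y - (r - \<eta>)) * det (A + mat \<eta> + M y)"
    using product_gain[OF *(2,3) _ le pos] assms(3) by simp_all
  moreover have "r0 \<le> m y - (r - \<eta>)" using assms(3,4) *(2) by linarith
  ultimately show ?thesis
    using *(1,4) assms(6) by (simp add: \<Theta>_iff Sym_add Sym_mat abs_le_iff)
qed

text \<open>One \<open>\<delta>\<close> serves all points of the unbounded set
  \<open>\<Theta> x\<close>, since the available gain depends on \<open>\<eta>\<close> only; the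
  estimate is symmetric in \<open>x\<close> and \<open>y\<close>, which gives both
  inclusions.\<close>

lemma \<Theta>_shift:
  assumes x: "x \<in> \<Omega>" and \<eta>: "0 < \<eta>"
  obtains \<delta> where "0 < \<delta>"
    "\<And>y r A. y \<in> \<Omega> \<Longrightarrow> dist x y < \<delta> \<Longrightarrow> (r, A) \<in> \<Theta> x \<Longrightarrow> (r - \<eta>, A + mat \<eta>) \<in> \<Theta> y"
    "\<And>y r A. y \<in> \<Omega> \<Longrightarrow> dist x y < \<delta> \<Longrightarrow> (r, A) \<in> \<Theta> y \<Longrightarrow> (r - \<eta>, A + mat \<eta>) \<in> \<Theta> x"
proof -
  let ?g = "g (r0 + \<eta> / 2) * (\<eta> / 2) ^ CARD('n)"
  have gp: "0 < ?g" using g_pos[of "r0 + \<eta>/2"] \<eta> by simp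
  obtain d1 where d1: "d1 > 0" "\<And>y. y \<in> \<Omega> \<Longrightarrow> dist y x < d1 \<Longrightarrow> dist (m y) (m x) < \<eta>/2"
    using cont_m x \<eta> unfolding continuous_on_iff by (meson half_gt_zero)
  obtain d2 where d2: "d2 > 0" "\<And>y. y \<in> \<Omega> \<Longrightarrow> dist y x < d2 \<Longrightarrow> dist (M y) (M x) < \<eta>/2"
    using cont_M x \<eta> unfolding continuous_on_iff by (meson half_gt_zero)
  obtain d3 where d3: "d3 > 0" "\<And>y. y \<in> \<Omega> \<Longrightarrow> dist y x < d3 \<Longrightarrow> dist (h y) (h x) < ?g"
    using cont_h x gp unfolding continuous_on_iff by meson
  show thesis
  proof (rule that[of "min d1 (min d2 d3)"])
    show "0 < min d1 (min d2 d3)" using d1(1) d2(1) d3(1) by simp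
    fix y r A assume y: "y \<in> \<Omega>" "dist x y < min d1 (min d2 d3)"
    then have "dist y x < d1" "dist y x < d2" "dist y x < d3" by (simp_all add: dist_commute)
    then have **: "\<bar>m y - m x\<bar> \<le> \<eta>/2" "norm (M y - M x) \<le> \<eta>/2" "\<bar>h y - h x\<bar> \<le> ?g"
      using d1(2)[OF y(1)] d2(2)[OF y(1)] d3(2)[OF y(1)] less_imp_le by (metis dist_norm dist_real_def)+
    show "(r - \<eta>, A + mat \<eta>) \<in> \<Theta> y" if "(r, A) \<in> \<Theta> x"
      using ** by (intro \<Theta>_shift_aux[OF x y(1) \<eta> _ _ _ that]) (auto simp: norm_minus_commute abs_minus_commute)
    show "(r - \<eta>, A + mat \<eta>) \<in> \<Theta> x" if "(r, A) \<in> \<Theta> y"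
      using ** by (intro \<Theta>_shift_aux[OF y(1) x \<eta> _ _ _ that]) auto
  qed
qed

lemma hausdorff_continuous_\<Theta>: "hausdorff_continuous \<Omega> \<Theta>"
  unfolding hausdorff_continuous_def
proof (intro ballI allI impI)
  fix x \<eta> assume x: "x \<in> \<Omega>" and "0 < (\<eta>::real)"
  \<comment> \<open>Half of \<open>\<eta>\<close>, because suprema of infima yield only a weak
    inequality while the definition wants a strict one.\<close>
  then have \<eta>: "0 < \<eta> / 2" by simp
  obtain \<delta> where \<delta>: "0 < \<delta>"
    and to: "\<And>y r A. y \<in> \<Omega> \<Longrightarrow> dist x y < \<delta> \<Longrightarrow> (r, A) \<in> \<Theta> x \<Longrightarrow> (r - \<eta>/2, A + mat (\<eta>/2)) \<in> \<Theta> y"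
    and from': "\<And>y r A. y \<in> \<Omega> \<Longrightarrow> dist x y < \<delta> \<Longrightarrow> (r, A) \<in> \<Theta> y \<Longrightarrow> (r - \<eta>/2, A + mat (\<eta>/2)) \<in> \<Theta> x"
    using \<Theta>_shift[OF x \<eta>] by metis
  have "hdist (\<Theta> x) (\<Theta> y) < ereal \<eta>" if y: "y \<in> \<Omega>" "norm (x - y) < \<delta>" for y
  proof -
    have xy: "dist x y < \<delta>" using y by (simp add: dist_norm)
    have e: "- mat (\<eta>/2) = (mat (-(\<eta>/2)) :: real^'n^'n)"
      by (simp add: mat_def vec_eq_iff)
    have "(INF q\<in>\<Theta> y. ereal (pnorm (p - q))) \<le> ereal (\<eta>/2)" if "p \<in> \<Theta> x" for p
    proof -
      obtain r A where p: "p = (r, A)" by (cases p)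
      have "pnorm (p - (r - \<eta>/2, A + mat (\<eta>/2))) = \<eta>/2"
        using \<eta> pnorm_mat[of "\<eta>/2" "-(\<eta>/2)"] by (simp add: p e)
      then show ?thesis
        using to[OF y(1) xy, of r A] that p by (metis INF_lower)
    qed
    moreover have "(INF p\<in>\<Theta> x. ereal (pnorm (p - q))) \<le> ereal (\<eta>/2)" if "q \<in> \<Theta> y" for q
    proof -
      obtain r A where q: "q = (r, A)" by (cases q)
      have "pnorm ((r - \<eta>/2, A + mat (\<eta>/2)) - q) = \<eta>/2"
        using \<eta> pnorm_mat[of "-(\<eta>/2)" "\<eta>/2"] by (simp add: q)
      then show ?thesis
        using from'[OF y(1) xy, of r A] that q by (metis INF_lower)
    qed
    ultimately have "hdist (\<Theta> x) (\<Theta> y) \<le> ereal (\<eta>/2)"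
      unfolding hdist_def by (intro max.boundedI SUP_least) auto
    also have "\<dots> < ereal \<eta>" using \<eta> by simp
    finally show ?thesis .
  qed
  with \<delta> show "\<exists>\<delta>>0. \<forall>y\<in>\<Omega>. norm (x - y) < \<delta> \<longrightarrow> hdist (\<Theta> x) (\<Theta> y) < ereal \<eta>"
    by blast
qed

lemma closed_\<Theta>: "closed (\<Theta> x)"
proof -
  have *: "continuous_on UNIV (\<lambda>p. g (m x - fst p))"
    by (intro continuous_on_compose2[OF cont_g] continuous_intros) auto
  have "closed ((\<lambda>p :: real \<times> (real^'n^'n). snd p + M x) -` {A. psd A})"
    by (intro closed_vimage closed_psd continuous_intros)
  moreover have "closed (snd -` (Sym :: (real^'n^'n) set) :: (real \<times> (real^'n^'n)) set)"
    by (intro closed_vimage_snd closed_Sym)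
  moreover have "closed {p :: real \<times> (real^'n^'n). r0 \<le> m x - fst p}"
    by (intro closed_Collect_le continuous_intros)
  moreover have "closed {p. h x \<le> g (m x - fst p) * det (snd p + M x)}"
    by (intro closed_Collect_le continuous_intros *)
  moreover have "\<Theta> x = snd -` Sym \<inter> {p. r0 \<le> m x - fst p} \<inter> (\<lambda>p. snd p + M x) -` {A. psd A}
      \<inter> {p. h x \<le> g (m x - fst p) * det (snd p + M x)}"
    by (auto simp: \<Theta>_iff)
  ultimately show ?thesis by (simp add: closed_Int)
qed

lemma \<Theta>_nonempty:
  assumes "x \<in> \<Omega>" shows "\<Theta> x \<noteq> {}"
proof -
  \<comment> \<open>The summand 1 makes \<open>?c \<ge> 1\<close>, so that
    \<open>?c ^ CARD('n) \<ge> ?c\<close> bounds the determinant without taking a root.\<close>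
  let ?c = "1 + h x / g (r0 + 1)"
  let ?B = "mat ?c :: real^'n^'n"
  have g: "0 < g (r0 + 1)" by (rule g_pos) simp
  have c: "1 \<le> ?c" "h x / g (r0 + 1) \<le> ?c" using g h_nonneg[OF assms] by auto
  have "?c \<le> ?c ^ CARD('n)"
    using c(1) by (intro self_le_power) auto
  also have "?c ^ CARD('n) \<le> det ?B"
    using det_add_mat_ge[of "mat 0 :: real^'n^'n" ?c] psd_mat[of 0, where 'a='n] c(1) det_0[where 'n='n and 'a=real]
    by (simp add: mat_0)
  finally have "h x / g (r0 + 1) \<le> det ?B" using c(2) by linarith
  then have "h x \<le> g (r0 + 1) * det ?B" using g by (simp add: field_simps)
  then have "(m x - (r0 + 1), ?B - M x) \<in> \<Theta> x"
    using c(1) by (simp add: \<Theta>_iff Sym_diff Sym_mat M_Sym[OF assms] psd_mat)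
  then show ?thesis by blast
qed

lemma proper_elliptic_\<Theta>: "proper_elliptic_map \<Omega> \<Theta>"
  unfolding proper_elliptic_map_def
proof (intro ballI conjI allI impI)
  fix x assume x: "x \<in> \<Omega>"
  show sub: "\<Theta> x \<subseteq> SymSp" by (auto simp: \<Theta>_iff SymSp_def)
  show "closedin symtop (\<Theta> x)"
    using closed_\<Theta>[of x] sub by (rule closed_subset[rotated])
  show "\<Theta> x \<noteq> {}" by (rule \<Theta>_nonempty[OF x])
  \<comment> \<open>Here \<open>m x - r = r0 - 1\<close>, which violates the constraint on
    \<open>r\<close> whatever the matrix is.\<close>
  have "(m x - r0 + 1, mat 0) \<notin> \<Theta> x" by (simp add: \<Theta>_iff)
  moreover have "(m x - r0 + 1, mat 0) \<in> SymSp" by (simp only: SymSp_def Sym_mat mem_Times_iff UNIV_I fst_conv snd_conv simp_thms)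
  ultimately show "\<Theta> x \<noteq> SymSp" by blast
  show "(r + s, A + P) \<in> \<Theta> x" if "(r, A) \<in> \<Theta> x" "s \<le> 0" "psd P" for r A s P
    using that by (rule \<Theta>_add)
qed

text \<open>Every symmetric point within \<open>\<eta>\<close> of \<open>(r, A)\<close> arises from
  \<open>(r + \<eta>, A - \<eta> I)\<close> by lowering the first entry and adding a nonnegative
  matrix, so ellipticity alone puts a whole relative ball into \<open>\<Theta> x\<close>.\<close>

lemma \<Theta>_interior:
  assumes \<eta>: "0 < \<eta>" and mem: "(r + \<eta>, A - mat \<eta>) \<in> \<Theta> x"
  shows "(r, A) \<in> symtop interior_of \<Theta> x"
proof -
  have "A - mat \<eta> \<in> Sym" using mem by (simp add: \<Theta>_iff)
  then have A: "A \<in> Sym" using Sym_add[OF _ Sym_mat[of \<eta>]] by fastforce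
  have "openin symtop (SymSp \<inter> ball (r, A) \<eta>)"
    by (simp add: openin_open_Int)
  moreover have "SymSp \<inter> ball (r, A) \<eta> \<subseteq> \<Theta> x"
  proof
    fix p assume p: "p \<in> SymSp \<inter> ball (r, A) \<eta>"
    obtain r' A' where p': "p = (r', A')" by (cases p)
    have A': "A' \<in> Sym" using p by (simp add: p' SymSp_def)
    have "dist r r' < \<eta>" "dist A A' < \<eta>"
      using p dist_fst_le[of "(r, A)" p] dist_snd_le[of "(r, A)" p] by (auto simp: p')
    then have d: "r' - r - \<eta> \<le> 0" "norm (A' - A) \<le> \<eta>"
      by (auto simp: dist_norm norm_minus_commute)
    have "psd (A' - A + mat \<eta>)"
      using d A A' by (intro psd_add_mat_norm Sym_diff)
    from \<Theta>_add[OF mem d(1) this] show "p \<in> \<Theta> x" by (simp add: p')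
  qed
  moreover have "(r, A) \<in> SymSp \<inter> ball (r, A) \<eta>" using A \<eta> by (simp add: SymSp_def)
  ultimately show "(r, A) \<in> symtop interior_of \<Theta> x"
    by (auto simp: interior_of_def)
qed

lemma \<Theta>_gain:
  assumes \<eta>: "0 < \<eta>" and mem: "(r + \<eta>, A - mat \<eta>) \<in> \<Theta> x"
  shows "h x < g (m x - r) * det (A + M x)"
proof -
  have *: "A - mat \<eta> \<in> Sym" "r0 \<le> m x - (r + \<eta>)" "psd (A - mat \<eta> + M x)"
    "h x \<le> g (m x - (r + \<eta>)) * det (A - mat \<eta> + M x)"
    using mem by (auto simp: \<Theta>_iff)
  have "psd (A + M x - (A - mat \<eta> + M x + mat \<eta>))"
    using psd_mat[of 0] by (simp add: mat_0)
  from product_gain(1)[OF *(2,3) _ _ this, of "m x - r"] *(4) \<eta>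
  have "h x + g (r0 + \<eta>) * \<eta> ^ CARD('n) \<le> g (m x - r) * det (A + M x)" by simp
  moreover have "0 < g (r0 + \<eta>) * \<eta> ^ CARD('n)" using g_pos[of "r0 + \<eta>"] \<eta> by simp
  ultimately show "h x < g (m x - r) * det (A + M x)" by linarith
qed

text \<open>If the inequality were strict at a frontier point, \<open>h x \<ge> 0\<close> would make
  both factors positive. This leaves room to move by \<open>(t, - t I)\<close> inside
  \<open>\<Theta> x\<close>, and a point with such room is interior.\<close>

lemma frontier_\<Theta>:
  assumes x: "x \<in> \<Omega>"
  shows "symtop frontier_of \<Theta> x \<subseteq> {(r, A). g (m x - r) * det (A + M x) = h x}"
proof
  fix p assume p: "p \<in> symtop frontier_of \<Theta> x"
  obtain r A where pr: "p = (r, A)" by (cases p)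
  have sub: "\<Theta> x \<subseteq> SymSp" by (auto simp: \<Theta>_iff SymSp_def)
  have "closedin symtop (\<Theta> x)"
    using closed_\<Theta>[of x] sub by (rule closed_subset[rotated])
  then have mem: "(r, A) \<in> \<Theta> x" and notint: "(r, A) \<notin> symtop interior_of \<Theta> x"
    using p by (auto simp: pr frontier_of_def closure_of_closedin)
  have "\<not> h x < g (m x - r) * det (A + M x)"
  proof
    assume gt: "h x < g (m x - r) * det (A + M x)"
    have *: "A \<in> Sym" "r0 \<le> m x - r" "psd (A + M x)"
      using mem by (auto simp: \<Theta>_iff)
    have pos: "0 < g (m x - r) * det (A + M x)" using gt h_nonneg[OF x] by linarith
    then have "m x - r \<noteq> r0" using g_r0 by auto
    then have r: "r0 < m x - r" using *(2) by simp
    have "det (A + M x) \<noteq> 0" using pos by auto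
    then have "0 < det (A + M x)" using psd_det_nonneg[OF *(3)] by linarith
    then obtain t0 where t0: "0 < t0" "psd (A + M x - mat t0)"
      using psd_diff_mat[OF *(3)] by blast
    define f where "f t = g (m x - (r + t)) * det (A - t *\<^sub>R mat 1 + M x)" for t
    have "continuous_on UNIV f"
      unfolding f_def by (intro continuous_intros continuous_on_compose2[OF cont_g]) auto
    moreover have "h x < f 0" using gt by (simp add: f_def)
    ultimately obtain e where e: "0 < e" "\<And>t. dist t 0 < e \<Longrightarrow> dist (f t) (f 0) < f 0 - h x"
      unfolding continuous_on_iff by (metis UNIV_I diff_gt_0_iff_gt)
    \<comment> \<open>The three bounds preserve, in this order, nonnegativity of the matrix, the
      inequality for the product, and the constraint on \<open>r\<close>.\<close>
    define t where "t = min t0 (min (e/2) (m x - r - r0))"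
    have t: "0 < t" "t \<le> t0" "t < e" "t \<le> m x - r - r0"
      using t0 e r by (auto simp: t_def)
    have mt: "t *\<^sub>R mat 1 = (mat t :: real^'n^'n)" for t :: real
      by (simp add: mat_def vec_eq_iff)
    have "h x \<le> f t"
      using e(2)[of t] t by (auto simp: dist_real_def abs_if split: if_splits)
    moreover have "psd (A - mat t + M x)"
    proof -
      have "mat t0 = mat t + (mat (t0 - t) :: real^'n^'n)" by (simp add: mat_def vec_eq_iff)
      then have "A - mat t + M x = (A + M x - mat t0) + mat (t0 - t)" by simp
      moreover have "psd ((A + M x - mat t0) + mat (t0 - t))" using t by (intro psd_add t0 psd_mat) simp
      ultimately show ?thesis by (simp only:)
    qed
    ultimately have "(r + t, A - mat t) \<in> \<Theta> x"
      using t * by (simp add: \<Theta>_iff f_def mt Sym_diff Sym_mat)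
    from \<Theta>_interior[OF t(1) this] notint show False by simp
  qed
  then show "p \<in> {(r, A). g (m x - r) * det (A + M x) = h x}"
    using mem by (auto simp: pr \<Theta>_iff)
qed

end

section \<open>Linear inequalities for jets and the random walk\<close>

text \<open>\<open>C2_hess\<close> with the gradient as a parameter, so that sums, averages and
  convolutions can name the new gradient explicitly.\<close>

definition is_C2 :: "(real^'n \<Rightarrow> real) \<Rightarrow> (real^'n \<Rightarrow> real^'n) \<Rightarrow> (real^'n \<Rightarrow> real^'n^'n) \<Rightarrow> (real^'n) set \<Rightarrow> bool" where
  "is_C2 f D H U \<longleftrightarrow> open U \<and> continuous_on U H \<and>
    (\<forall>y\<in>U. (f has_derivative (\<lambda>k. D y \<bullet> k)) (at y) \<and> (D has_derivative (\<lambda>k. H y *v k)) (at y))"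

lemma C2_hess_iff: "C2_hess f U H \<longleftrightarrow> (\<exists>D. is_C2 f D H U)"
  by (auto simp: C2_hess_def is_C2_def)

text \<open>The symmetric difference minus its quadratic term, as a function \<open>G\<close> of the
  step, has \<open>G 0 = G1 0 = 0\<close>, and its second derivative is at most \<open>2 * e\<close>
  in absolute value. A Taylor formula of order two then gives the bound.\<close>

lemma second_difference_bound:
  assumes C2: "is_C2 f D H U" and s: "0 < s"
    and seg: "\<And>r. \<bar>r\<bar> \<le> s \<Longrightarrow> x + r *\<^sub>R t \<in> U"
    and osc: "\<And>r. \<bar>r\<bar> \<le> s \<Longrightarrow> \<bar>t \<bullet> (H (x + r *\<^sub>R t) *v t) - t \<bullet> (H x *v t)\<bar> \<le> e"
  shows "\<bar>f (x + s *\<^sub>R t) + f (x - s *\<^sub>R t) - 2 * f x - s\<^sup>2 * (t \<bullet> (H x *v t))\<bar> \<le> s\<^sup>2 * e"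
proof -
  define q where "q = t \<bullet> (H x *v t)"
  define G where "G r = f (x + r *\<^sub>R t) + f (x + (-r) *\<^sub>R t) - 2 * f x - r\<^sup>2 * q" for r
  define G1 where "G1 r = D (x + r *\<^sub>R t) \<bullet> t - D (x + (-r) *\<^sub>R t) \<bullet> t - 2 * r * q" for r
  define G2 where "G2 r = t \<bullet> (H (x + r *\<^sub>R t) *v t) + t \<bullet> (H (x + (-r) *\<^sub>R t) *v t) - 2 * q" for r
  have df: "(f has_derivative (\<lambda>k. D y \<bullet> k)) (at y)" "(D has_derivative (\<lambda>k. H y *v k)) (at y)" if "y \<in> U" for y
    using C2 that by (auto simp: is_C2_def)
  have f_line: "((\<lambda>r. f (x + (c * r) *\<^sub>R t)) has_real_derivative c * (D (x + (c * r) *\<^sub>R t) \<bullet> t)) (at r)"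
    and D_line: "((\<lambda>r. D (x + (c * r) *\<^sub>R t) \<bullet> t) has_real_derivative c * (t \<bullet> (H (x + (c * r) *\<^sub>R t) *v t))) (at r)"
    if "x + (c * r) *\<^sub>R t \<in> U" for c r
  proof -
    have line: "((\<lambda>r. x + (c * r) *\<^sub>R t) has_derivative (\<lambda>k. (c * k) *\<^sub>R t)) (at r)"
      by (auto intro!: derivative_eq_intros)
    show "((\<lambda>r. f (x + (c * r) *\<^sub>R t)) has_real_derivative c * (D (x + (c * r) *\<^sub>R t) \<bullet> t)) (at r)"
      by (rule has_derivative_imp_has_field_derivative[OF has_derivative_compose[OF line df(1)[OF that]]])
        (simp add: mult_ac)
    have "((\<lambda>r. D (x + (c * r) *\<^sub>R t)) has_derivative (\<lambda>k. H (x + (c * r) *\<^sub>R t) *v ((c * k) *\<^sub>R t))) (at r)"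
      by (rule has_derivative_compose[OF line df(2)[OF that]])
    from has_derivative_inner_left[OF this, of t] show "((\<lambda>r. D (x + (c * r) *\<^sub>R t) \<bullet> t) has_real_derivative c * (t \<bullet> (H (x + (c * r) *\<^sub>R t) *v t))) (at r)"
      by (rule has_derivative_imp_has_field_derivative)
        (simp add: matrix_vector_mult_scaleR inner_commute mult_ac)
  qed
  have inU: "x + r *\<^sub>R t \<in> U" "x + (-r) *\<^sub>R t \<in> U" if "0 \<le> r" "r \<le> s" for r
    using seg[of r] seg[of "-r"] that by auto
  have dG: "(G has_real_derivative G1 r) (at r)" "(G1 has_real_derivative G2 r) (at r)" if "0 \<le> r" "r \<le> s" for r
  proof -
    have 1: "x + (1 * r) *\<^sub>R t \<in> U" and 2: "x + ((-1) * r) *\<^sub>R t \<in> U" using inU[OF that] by auto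
    show "(G has_real_derivative G1 r) (at r)"
      unfolding G_def G1_def using f_line[OF 1] f_line[OF 2]
      by (auto intro!: derivative_eq_intros)
    show "(G1 has_real_derivative G2 r) (at r)"
      unfolding G1_def G2_def using D_line[OF 1] D_line[OF 2]
      by (auto intro!: derivative_eq_intros)
  qed
  define diff where "diff k = (if k = 0 then G else if k = 1 then G1 else G2)" for k :: nat
  have "\<exists>r>0. r < s \<and> G s = (\<Sum>k<2. diff k 0 / fact k * s ^ k) + diff 2 r / fact 2 * s ^ 2"
    by (rule Maclaurin[OF s]) (auto simp: diff_def dG less_2_cases_iff)
  then obtain r where r: "0 < r" "r < s"
    and G: "G s = (\<Sum>k<2. diff k 0 / fact k * s ^ k) + diff 2 r / fact 2 * s ^ 2"
    by blast
  have "G 0 = 0" "G1 0 = 0" by (simp_all add: G_def G1_def)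
  then have Gs: "G s = G2 r / 2 * s\<^sup>2"
    using G by (simp add: diff_def numeral_2_eq_2)
  have "\<bar>G2 r\<bar> \<le> 2 * e"
    using osc[of r] osc[of "-r"] r unfolding G2_def q_def by (simp add: abs_le_iff)
  then have "\<bar>G2 r\<bar> / 2 * s\<^sup>2 \<le> e * s\<^sup>2" by (intro mult_right_mono) auto
  moreover have "\<bar>G s\<bar> = \<bar>G2 r\<bar> / 2 * s\<^sup>2" by (simp add: Gs abs_mult)
  ultimately have "\<bar>G s\<bar> \<le> s\<^sup>2 * e" by (simp add: mult.commute)
  then show ?thesis by (simp add: G_def q_def)
qed

text \<open>The expectation after one step of a symmetric random walk that jumps by
  \<open>\<plusminus> s\<close> times a uniformly chosen column of \<open>T\<close>; it approximates
  the flow of \<open>qtr T\<close> for time \<open>s\<^sup>2 / (2 * CARD('n))\<close>. Vector values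
  are allowed so that it also acts on gradients and Hessians.\<close>

definition walk :: "real^'n^'n \<Rightarrow> real \<Rightarrow> (real^'n \<Rightarrow> 'b::real_vector) \<Rightarrow> real^'n \<Rightarrow> 'b" where
  "walk T s f x = (1 / (2 * CARD('n))) *\<^sub>R
     (\<Sum>i\<in>UNIV. f (x + s *\<^sub>R column i T) + f (x - s *\<^sub>R column i T))"

lemma walk_const [simp]: "walk T s (\<lambda>_. c) x = c"
  for x :: "real^'n" and c :: "'b::real_vector"
proof -
  have "(\<Sum>i\<in>(UNIV::'n set). c + c) = (2 * real CARD('n)) *\<^sub>R c"
    by (simp add: sum_constant_scaleR scaleR_2[symmetric] mult.commute)
  then show ?thesis by (simp add: walk_def)
qed

lemma walk_add: "walk T s (\<lambda>y. f y + f' y) x = walk T s f x + walk T s f' x"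
  by (simp add: walk_def sum.distrib[symmetric] scaleR_add_right[symmetric] add_ac)

lemma walk_linear: "linear L \<Longrightarrow> L (walk T s f x) = walk T s (\<lambda>y. L (f y)) x"
  by (simp add: walk_def linear_scale linear_sum linear_add)

lemma walk_scale: "walk T s (\<lambda>y. c *\<^sub>R f y) x = c *\<^sub>R walk T s f x"
  by (rule walk_linear[symmetric]) (simp add: linear_scaleR)

lemma walk_mult: "walk T s (\<lambda>y. c * f y) x = c * walk T s f x" for f :: "_ \<Rightarrow> real"
  using walk_scale[of T s c f x] by simp

lemma walk_diff: "walk T s (\<lambda>y. f y - f' y) x = walk T s f x - walk T s f' x"
  using walk_add[of T s f "\<lambda>y. -1 *\<^sub>R f' y" x] by (simp only: walk_scale) simp

lemma walk_translate: "walk T s (\<lambda>y. f (y + z)) x = walk T s f (x + z)"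
  by (simp add: walk_def algebra_simps)

lemma walk_mono: "(\<And>y. f y \<le> f' y) \<Longrightarrow> walk T s f x \<le> walk T s f' x" for f :: "_ \<Rightarrow> real"
  by (auto simp: walk_def intro!: divide_right_mono sum_mono add_mono)

lemma norm_walk_le:
  fixes f :: "real^'n \<Rightarrow> 'b::real_normed_vector"
  assumes "\<And>y. norm (f y) \<le> e" shows "norm (walk T s f x) \<le> e"
proof -
  have "norm (walk T s f x) \<le> walk T s (\<lambda>y. norm (f y)) x"
    by (auto simp: walk_def intro!: divide_right_mono sum_norm_le norm_triangle_ineq)
  also have "\<dots> \<le> walk T s (\<lambda>y. e) x" using assms by (rule walk_mono)
  finally show ?thesis by simp
qed

lemma walk_local:
  assumes "s \<ge> 0" "\<And>i. norm (column i T) \<le> B"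
    and "\<And>z. norm z \<le> s * B \<Longrightarrow> f (x + z) = f' (x + z)"
  shows "walk T s f x = walk T s f' x"
proof -
  have "norm (s *\<^sub>R column i T) \<le> s * B" for i using assms by (simp add: mult_left_mono)
  then show ?thesis
    using assms(3)[of "s *\<^sub>R column i T" for i] assms(3)[of "- (s *\<^sub>R column i T)" for i]
    by (simp add: walk_def)
qed

lemma has_derivative_walk:
  assumes "\<And>y. (f has_derivative F y) (at y)"
  shows "(walk T s f has_derivative (\<lambda>k. walk T s (\<lambda>y. F y k) x)) (at x)"
proof -
  have tr: "((\<lambda>x. f (x + a)) has_derivative F (x + a)) (at x)" for a
  proof -
    have "((\<lambda>x. x + a) has_derivative (\<lambda>k. k)) (at x)" by (auto intro!: derivative_eq_intros)
    from has_derivative_compose[OF this assms] show ?thesis .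
  qed
  have tr': "((\<lambda>x. f (x - a)) has_derivative F (x - a)) (at x)" for a
    using tr[of "-a"] by simp
  show ?thesis
    unfolding walk_def[abs_def]
    by (intro has_derivative_scaleR_right has_derivative_sum has_derivative_add tr tr')
qed

lemma is_C2_walk:
  assumes "is_C2 f D H UNIV" shows "is_C2 (walk T s f) (walk T s D) (walk T s H) UNIV"
proof -
  have cont: "continuous_on UNIV H"
    and d: "\<And>y. (f has_derivative (\<lambda>k. D y \<bullet> k)) (at y)" "\<And>y. (D has_derivative (\<lambda>k. H y *v k)) (at y)"
    using assms by (auto simp: is_C2_def)
  have "walk T s D y \<bullet> k = walk T s (\<lambda>y. D y \<bullet> k) y" for y k
    by (rule walk_linear) (simp add: bounded_linear.linear bounded_linear_inner_left)
  moreover have "walk T s H y *v k = walk T s (\<lambda>y. H y *v k) y" for y k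
    by (rule walk_linear[where L = "\<lambda>A. A *v k"], rule linearI)
      (simp_all add: matrix_vector_mult_add_rdistrib scaleR_matrix_vector_assoc)
  moreover have "continuous_on UNIV (walk T s H)"
    unfolding walk_def[abs_def] by (intro continuous_intros continuous_on_compose2[OF cont]) auto
  ultimately show ?thesis
    using has_derivative_walk[OF d(1), of T s] has_derivative_walk[OF d(2), of T s]
    by (auto simp: is_C2_def)
qed

definition sqcols :: "real^'n^'n \<Rightarrow> real" where
  "sqcols T = (\<Sum>i\<in>UNIV. column i T \<bullet> column i T)"

lemma sqcols_nonneg: "0 \<le> sqcols T"
  by (simp add: sqcols_def sum_nonneg)

lemma abs_qtr_le: "\<bar>qtr T A\<bar> \<le> norm A * sqcols T"
  unfolding qtr_def sqcols_def sum_distrib_left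
  by (rule order_trans[OF sum_abs]) (intro sum_mono abs_quadratic_form_le)

text \<open>A second-order Taylor expansion along each column, with the oscillation \<open>e\<close>
  of the Hessian at the scale of one jump as the only error. The factor \<open>sqcols T\<close> is
  the trace of \<open>transpose T ** T\<close>.\<close>

lemma walk_C2_expansion:
  fixes f :: "real^'n \<Rightarrow> real"
  assumes C2: "is_C2 f D H UNIV" and s: "0 < s" and B: "\<And>i. norm (column i T) \<le> B"
    and osc: "\<And>x z. norm z \<le> s * B \<Longrightarrow> norm (H (x + z) - H x) \<le> e"
  shows "\<bar>walk T s f x - f x - s\<^sup>2 / (2 * CARD('n)) * qtr T (H x)\<bar> \<le> s\<^sup>2 / (2 * CARD('n)) * (e * sqcols T)"
proof -
  let ?t = "\<lambda>i. column i T"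
  let ?d = "\<lambda>i. f (x + s *\<^sub>R ?t i) + f (x - s *\<^sub>R ?t i) - 2 * f x - s\<^sup>2 * (?t i \<bullet> (H x *v ?t i))"
  have each: "\<bar>?d i\<bar> \<le> s\<^sup>2 * (e * (?t i \<bullet> ?t i))" for i
  proof (rule second_difference_bound[OF C2 s])
    fix r :: real assume r: "\<bar>r\<bar> \<le> s"
    have "norm (r *\<^sub>R ?t i) \<le> s * B" using r B[of i] s by (auto intro: mult_mono)
    then have "norm (H (x + r *\<^sub>R ?t i) - H x) \<le> e" by (rule osc)
    then have "\<bar>?t i \<bullet> ((H (x + r *\<^sub>R ?t i) - H x) *v ?t i)\<bar> \<le> e * (?t i \<bullet> ?t i)"
      using abs_quadratic_form_le[of "?t i" "H (x + r *\<^sub>R ?t i) - H x"]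
      by (meson inner_ge_zero mult_right_mono order_trans)
    then show "\<bar>?t i \<bullet> (H (x + r *\<^sub>R ?t i) *v ?t i) - ?t i \<bullet> (H x *v ?t i)\<bar> \<le> e * (?t i \<bullet> ?t i)"
      by (simp add: matrix_vector_mult_diff_rdistrib inner_diff_right)
  qed simp
  have "walk T s f x - f x = walk T s (\<lambda>y. f y - f x) x"
    by (simp add: walk_diff)
  also have "\<dots> = 1 / (2 * CARD('n)) * (\<Sum>i\<in>UNIV. f (x + s *\<^sub>R ?t i) + f (x - s *\<^sub>R ?t i) - 2 * f x)"
    by (simp add: walk_def algebra_simps)
  also have "\<dots> - s\<^sup>2 / (2 * CARD('n)) * qtr T (H x) = 1 / (2 * CARD('n)) * (\<Sum>i\<in>UNIV. ?d i)"
    by (simp add: qtr_def sum_subtractf sum_distrib_left right_diff_distrib mult.assoc)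
  finally have "walk T s f x - f x - s\<^sup>2 / (2 * CARD('n)) * qtr T (H x) = 1 / (2 * CARD('n)) * (\<Sum>i\<in>UNIV. ?d i)" .
  moreover have "\<bar>\<Sum>i\<in>UNIV. ?d i\<bar> \<le> (\<Sum>i\<in>UNIV. s\<^sup>2 * (e * (?t i \<bullet> ?t i)))"
    by (rule order_trans[OF sum_abs]) (intro sum_mono each)
  moreover have "(\<Sum>i\<in>UNIV. s\<^sup>2 * (e * (?t i \<bullet> ?t i))) = s\<^sup>2 * (e * sqcols T)"
    by (simp add: sqcols_def sum_distrib_left)
  ultimately show ?thesis
    by (simp add: abs_mult divide_right_mono)
qed

definition bounded_support :: "(real^'n \<Rightarrow> 'b::real_normed_vector) \<Rightarrow> bool" where
  "bounded_support f \<longleftrightarrow> (\<exists>R. \<forall>x. norm x > R \<longrightarrow> f x = 0)"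

lemma bounded_support_walk:
  assumes "bounded_support f" "0 \<le> s" shows "bounded_support (walk T s f)"
proof -
  obtain R where R: "\<And>x. norm x > R \<Longrightarrow> f x = 0" using assms by (auto simp: bounded_support_def)
  define B where "B = (\<Sum>i\<in>UNIV. norm (column i T))"
  have B: "norm (column i T) \<le> B" for i
    unfolding B_def by (rule member_le_sum) auto
  have "walk T s f x = 0" if "norm x > R + s * B" for x
  proof -
    have "walk T s f x = walk T s (\<lambda>_. 0) x"
    proof (rule walk_local[OF assms(2) B])
      fix z :: "real^'a" assume "norm z \<le> s * B"
      then have "norm (x + z) > R" using that norm_diff_ineq[of x z] by linarith
      then show "f (x + z) = 0" by (rule R)
    qed
    then show ?thesis by simp
  qed
  then show ?thesis by (auto simp: bounded_support_def)
qed

lemma bounded_support_attains_sup: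
  fixes f :: "real^'n \<Rightarrow> real"
  assumes "bounded_support f" "continuous_on UNIV f"
  obtains x where "\<And>y. f y \<le> f x"
proof -
  obtain R where R: "\<And>x. norm x > R \<Longrightarrow> f x = 0" using assms by (auto simp: bounded_support_def)
  let ?R = "\<bar>R\<bar> + 1"
  \<comment> \<open>This point stands for all of the far region: it lies in the compact ball and
    already outside the support.\<close>
  obtain z :: "real^'n" where z: "norm z = ?R" using vector_choose_size[of ?R] by auto
  have "\<exists>x\<in>cball 0 ?R. \<forall>y\<in>cball 0 ?R. f y \<le> f x"
    by (rule continuous_attains_sup) (auto intro: continuous_on_subset[OF assms(2)])
  then obtain x where "\<forall>y\<in>cball 0 ?R. f y \<le> f x" by blast
  then have x: "\<And>y. norm y \<le> ?R \<Longrightarrow> f y \<le> f x" by simp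
  have "f y \<le> f x" for y
  proof (cases "norm y \<le> ?R")
    case False
    then have "f y = f z" using R[of y] R[of z] z by simp
    then show ?thesis using x[of z] z by simp
  qed (rule x)
  then show thesis by (rule that)
qed

text \<open>One explicit Euler step of the heat flow: at a maximum point of \<open>\<kappa> - walk T s f\<close> the function
  \<open>walk T s f\<close> is, up to a constant, an admissible test function for \<open>\<kappa>\<close>.\<close>

lemma walk_comparison_step:
  fixes \<kappa> f :: "real^'n \<Rightarrow> real"
  assumes \<kappa>: "continuous_on UNIV \<kappa>" "bounded_support \<kappa>"
    and jets: "\<And>x r A. (r, A) \<in> Jplus UNIV \<kappa> x \<Longrightarrow> b \<le> qtr T A"
    and C2: "is_C2 f D H UNIV" and supp: "bounded_support f"
    and s: "0 < s" and B: "\<And>i. norm (column i T) \<le> B"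
    and osc: "\<And>x z. norm z \<le> s * B \<Longrightarrow> norm (H (x + z) - H x) \<le> e"
    and le: "\<And>x. \<kappa> x \<le> f x + a"
  shows "\<kappa> x \<le> walk T s f x + a + s\<^sup>2 / (2 * CARD('n)) * (2 * (e * sqcols T) - b)"
proof -
  define h where "h = s\<^sup>2 / (2 * CARD('n))"
  have C2w: "is_C2 (walk T s f) (walk T s D) (walk T s H) UNIV" by (rule is_C2_walk[OF C2])
  have "continuous_on UNIV (walk T s f)"
    using C2w by (intro has_derivative_continuous_on[where f' = "\<lambda>y k. walk T s D y \<bullet> k"])
      (simp add: is_C2_def)
  then have "continuous_on UNIV (\<lambda>x. \<kappa> x - walk T s f x)"
    using \<kappa>(1) by (intro continuous_intros)
  moreover have "bounded_support (\<lambda>x. \<kappa> x - walk T s f x)"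
  proof -
    obtain R1 R2 where "\<And>x. norm x > R1 \<Longrightarrow> \<kappa> x = 0" "\<And>x. norm x > R2 \<Longrightarrow> walk T s f x = 0"
      using \<kappa>(2) bounded_support_walk[OF supp, of s T] s by (auto simp: bounded_support_def)
    then show ?thesis by (auto simp: bounded_support_def intro!: exI[of _ "max R1 R2"])
  qed
  ultimately obtain x1 where x1: "\<And>y. \<kappa> y - walk T s f y \<le> \<kappa> x1 - walk T s f x1"
    using bounded_support_attains_sup by blast
  have "is_C2 (\<lambda>y. walk T s f y + (\<kappa> x1 - walk T s f x1)) (walk T s D) (walk T s H) UNIV"
    using C2w by (auto simp: is_C2_def intro!: derivative_eq_intros)
  then have "(\<kappa> x1, walk T s H x1) \<in> Jplus UNIV \<kappa> x1"
    using x1 unfolding Jplus_def C2_hess_iff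
    by (force simp: algebra_simps intro!: exI[of _ "\<lambda>y. walk T s f y + (\<kappa> x1 - walk T s f x1)"])
  then have b: "b \<le> qtr T (walk T s H x1)" by (rule jets)
  have "norm (walk T s H x1 - H x1) \<le> e"
  proof -
    define k where "k y = (if norm (y - x1) \<le> s * B then H y - H x1 else 0)" for y
    have "walk T s H x1 - H x1 = walk T s (\<lambda>y. H y - H x1) x1"
      by (simp add: walk_diff)
    also have "\<dots> = walk T s k x1"
      using s by (intro walk_local[OF _ B]) (auto simp: k_def)
    finally have "walk T s H x1 - H x1 = walk T s k x1" .
    moreover have "norm (k y) \<le> e" for y
    proof -
      have "0 \<le> B" using B norm_ge_zero order_trans by blast
      then have "norm (0::real^'n) \<le> s * B" using s by simp
      then have "0 \<le> e" using osc[of 0 x1] by simp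
      moreover have "norm (H y - H x1) \<le> e" if "norm (y - x1) \<le> s * B"
        using osc[OF that, of x1] by simp
      ultimately show ?thesis by (simp add: k_def)
    qed
    ultimately show ?thesis by (simp add: norm_walk_le)
  qed
  then have "\<bar>qtr T (walk T s H x1 - H x1)\<bar> \<le> e * sqcols T"
    using abs_qtr_le[of T "walk T s H x1 - H x1"] sqcols_nonneg[of T] by (meson mult_right_mono order_trans)
  then have "b - e * sqcols T \<le> qtr T (H x1)" using b by (simp add: qtr_diff)
  then have "h * (b - e * sqcols T) \<le> h * qtr T (H x1)" by (intro mult_left_mono) (auto simp: h_def)
  \<comment> \<open>The Hessian oscillation is charged a second time here, for the Taylor expansion;
    the earlier charge replaced the averaged Hessian by \<open>H x1\<close>. Hence the factor 2 in
    the conclusion.\<close>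
  moreover have "f x1 + h * qtr T (H x1) - h * (e * sqcols T) \<le> walk T s f x1"
    using walk_C2_expansion[OF C2 s B osc, where x = x1, folded h_def] by linarith
  ultimately have "\<kappa> x1 - walk T s f x1 \<le> a + h * (2 * (e * sqcols T) - b)"
    using le[of x1] by (simp add: algebra_simps)
  then show ?thesis unfolding h_def[symmetric] using x1[of x] by linarith
qed

text \<open>Averaging preserves the bound \<open>e\<close> on the oscillation of the Hessian, so
  each step costs the same and the errors merely add up. The induction splits off the step applied
  earliest, which turns \<open>f\<close> into \<open>walk T s f\<close>.\<close>

lemma walk_comparison:
  fixes \<kappa> f :: "real^'n \<Rightarrow> real"
  assumes \<kappa>: "continuous_on UNIV \<kappa>" "bounded_support \<kappa>"
    and jets: "\<And>x r A. (r, A) \<in> Jplus UNIV \<kappa> x \<Longrightarrow> b \<le> qtr T A"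
    and s: "0 < s" and B: "\<And>i. norm (column i T) \<le> B"
    and "is_C2 f D H UNIV" "bounded_support f"
    and "\<And>x z. norm z \<le> s * B \<Longrightarrow> norm (H (x + z) - H x) \<le> e"
    and "\<And>x. \<kappa> x \<le> f x + a"
  shows "\<kappa> x \<le> (walk T s ^^ n) f x + a + n * (s\<^sup>2 / (2 * CARD('n)) * (2 * (e * sqcols T) - b))"
  using assms(6-)
proof (induction n arbitrary: f D H a)
  case (Suc n)
  define c where "c = s\<^sup>2 / (2 * CARD('n)) * (2 * (e * sqcols T) - b)"
  have "norm (walk T s H (x + z) - walk T s H x) \<le> e" if "norm z \<le> s * B" for x z
    unfolding walk_translate[symmetric] walk_diff[symmetric]
    using Suc.prems(3)[OF that] by (rule norm_walk_le)
  moreover have "\<kappa> x \<le> walk T s f x + (a + c)" for x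
    unfolding c_def add.assoc[symmetric]
    by (rule walk_comparison_step[OF \<kappa> _ Suc.prems(1,2) s B Suc.prems(3,4)]) (rule jets)
  moreover have "bounded_support (walk T s f)"
    using Suc.prems(2) s by (intro bounded_support_walk) auto
  ultimately have "\<kappa> x \<le> (walk T s ^^ n) (walk T s f) x + (a + c) + n * c"
    unfolding c_def by (intro Suc.IH[OF is_C2_walk[OF Suc.prems(1)]])
  then show ?case
    unfolding c_def[symmetric] by (simp add: funpow_swap1 algebra_simps)
qed simp

section \<open>Iterates of the walk: order, linearity and mean square displacement\<close>

lemma walk_iter_mono:
  fixes f f' :: "real^'n \<Rightarrow> real"
  shows "(\<And>y. f y \<le> f' y) \<Longrightarrow> (walk T s ^^ n) f x \<le> (walk T s ^^ n) f' x"
proof (induction n arbitrary: x)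
  case (Suc n)
  then show ?case by (auto intro: walk_mono)
qed simp

lemma walk_iter_add: "(walk T s ^^ n) (\<lambda>y. f y + f' y) x = (walk T s ^^ n) f x + (walk T s ^^ n) f' x"
proof (induction n arbitrary: x)
  case (Suc n)
  have "(walk T s ^^ n) (\<lambda>y. f y + f' y) = (\<lambda>x. (walk T s ^^ n) f x + (walk T s ^^ n) f' x)"
    using Suc.IH by blast
  then show ?case by (simp add: walk_add)
qed simp

lemma walk_iter_const: "(walk T s ^^ n) (\<lambda>y. c) x = c"
proof (induction n arbitrary: x)
  case (Suc n)
  have "(walk T s ^^ n) (\<lambda>y. c) = (\<lambda>x. c)" using Suc.IH by blast
  then show ?case by simp
qed simp

lemma walk_iter_mult: "(walk T s ^^ n) (\<lambda>y. c * f y) x = c * (walk T s ^^ n) f x" for f :: "_ \<Rightarrow> real"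
proof (induction n arbitrary: x)
  case (Suc n)
  have "(walk T s ^^ n) (\<lambda>y. c * f y) = (\<lambda>x. c * (walk T s ^^ n) f x)" using Suc.IH by blast
  then show ?case by (simp add: walk_mult)
qed simp

text \<open>The parallelogram law: the mean squared distance grows by the same amount from every
  starting point, hence linearly in the number of steps.\<close>

lemma walk_sqdist:
  fixes x :: "real^'n"
  shows "walk T s (\<lambda>y. (norm (y - x))\<^sup>2) z = (norm (z - x))\<^sup>2 + s\<^sup>2 / CARD('n) * sqcols T"
proof -
  have "(norm (z + s *\<^sub>R c - x))\<^sup>2 + (norm (z - s *\<^sub>R c - x))\<^sup>2 = 2 * (norm (z - x))\<^sup>2 + 2 * s\<^sup>2 * (c \<bullet> c)" for c
    unfolding power2_norm_eq_inner
    by (simp add: inner_diff_left inner_diff_right inner_add_left inner_add_right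
        inner_commute power2_eq_square algebra_simps)
  then show ?thesis
    by (simp add: walk_def sqcols_def sum.distrib sum_distrib_left[symmetric] field_simps)
qed

lemma walk_iter_sqdist:
  fixes x :: "real^'n"
  shows "(walk T s ^^ n) (\<lambda>y. (norm (y - x))\<^sup>2) z = (norm (z - x))\<^sup>2 + n * (s\<^sup>2 / CARD('n) * sqcols T)"
proof (induction n arbitrary: z)
  case (Suc n)
  have "(walk T s ^^ n) (\<lambda>y. (norm (y - x))\<^sup>2) = (\<lambda>z. (norm (z - x))\<^sup>2 + n * (s\<^sup>2 / CARD('n) * sqcols T))"
    using Suc.IH by blast
  then show ?case by (simp add: walk_add walk_sqdist algebra_simps add_divide_distrib)
qed simp

text \<open>The walk leaves every neighbourhood of \<open>x\<close>, so the value of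
  \<open>qtr T (H x)\<close> at \<open>x\<close> has to control the average from outside. The
  quadratic growth allowed by \<open>C\<close> is integrated against the mean square displacement,
  which is linear in time; the resulting error is quadratic in \<open>n * h\<close>.\<close>

lemma walk_iter_upper:
  fixes w :: "real^'n \<Rightarrow> real"
  assumes C2: "is_C2 w D H UNIV" and s: "0 < s" and B: "\<And>i. norm (column i T) \<le> B"
    and osc: "\<And>x z. norm z \<le> s * B \<Longrightarrow> norm (H (x + z) - H x) \<le> e"
    and up: "\<And>y. qtr T (H y) \<le> \<beta> + C * (norm (y - x))\<^sup>2" and C: "0 \<le> C"
    and h: "h = s\<^sup>2 / (2 * CARD('n))"
  shows "(walk T s ^^ n) w x \<le> w x + n * h * (\<beta> + e * sqcols T) + 2 * C * sqcols T * (n * h)\<^sup>2"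
proof (induction n)
  case (Suc n)
  have h0: "0 \<le> h" by (simp add: h)
  have sh: "s\<^sup>2 / CARD('n) = 2 * h" by (simp add: h)
  have "walk T s w y \<le> w y + (h * (\<beta> + e * sqcols T) + (h * C) * (norm (y - x))\<^sup>2)" for y
  proof -
    have "walk T s w y \<le> w y + h * qtr T (H y) + h * (e * sqcols T)"
      using walk_C2_expansion[OF C2 s B osc, where x = y] by (simp add: abs_le_iff h)
    moreover have "h * qtr T (H y) \<le> h * (\<beta> + C * (norm (y - x))\<^sup>2)"
      using up h0 by (rule mult_left_mono)
    ultimately show ?thesis by (simp add: algebra_simps)
  qed
  then have "(walk T s ^^ n) (walk T s w) x
      \<le> (walk T s ^^ n) (\<lambda>y. w y + (h * (\<beta> + e * sqcols T) + (h * C) * (norm (y - x))\<^sup>2)) x"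
    by (rule walk_iter_mono)
  also have "\<dots> = (walk T s ^^ n) w x + h * (\<beta> + e * sqcols T) + (h * C) * (n * (2 * h * sqcols T))"
    by (simp add: walk_iter_add walk_iter_const walk_iter_mult walk_iter_sqdist sh)
  also have "\<dots> \<le> w x + n * h * (\<beta> + e * sqcols T) + 2 * C * sqcols T * (n * h)\<^sup>2
      + h * (\<beta> + e * sqcols T) + (h * C) * (n * (2 * h * sqcols T))"
    using Suc.IH by simp
  also have "\<dots> = w x + (n + 1) * h * (\<beta> + e * sqcols T) + 2 * C * sqcols T * h\<^sup>2 * (n\<^sup>2 + n)"
    by (simp add: algebra_simps power2_eq_square)
  also have "\<dots> \<le> w x + (n + 1) * h * (\<beta> + e * sqcols T) + 2 * C * sqcols T * h\<^sup>2 * (real (n + 1))\<^sup>2"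
    using C h0 sqcols_nonneg[of T] by (intro add_left_mono mult_left_mono) (auto simp: power2_eq_square algebra_simps)
  also have "\<dots> = w x + real (Suc n) * h * (\<beta> + e * sqcols T) + 2 * C * sqcols T * (real (Suc n) * h)\<^sup>2"
    by (simp add: power_mult_distrib)
  finally show ?case
    by (simp only: funpow_Suc_right comp_apply)
qed simp

text \<open>The running time \<open>t = n h\<close> of the walk is kept fixed while the step size tends to zero, so that the
  initial error \<open>\<epsilon>\<close> is only paid once.\<close>

lemma qtr_ge_of_jets:
  fixes \<kappa> w :: "real^'n \<Rightarrow> real"
  assumes \<kappa>: "continuous_on UNIV \<kappa>" "bounded_support \<kappa>"
    and jets: "\<And>x r A. (r, A) \<in> Jplus UNIV \<kappa> x \<Longrightarrow> b \<le> qtr T A"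
    and approx: "\<And>\<epsilon>. 0 < \<epsilon> \<Longrightarrow> \<exists>f D H. is_C2 f D H UNIV \<and> bounded_support f \<and>
        uniformly_continuous_on UNIV H \<and> (\<forall>x. \<bar>f x - \<kappa> x\<bar> \<le> \<epsilon>)"
    and w: "is_C2 w D H UNIV" "uniformly_continuous_on UNIV H" "\<And>y. norm (H y) \<le> K"
    and comm: "\<And>s n c. (\<And>x. \<kappa> x \<le> (walk T s ^^ n) \<kappa> x + c) \<Longrightarrow> w x \<le> (walk T s ^^ n) w x + c"
  shows "b \<le> qtr T (H x)"
proof (rule ccontr)
  assume "\<not> b \<le> qtr T (H x)"
  define \<gamma> where "\<gamma> = b - qtr T (H x)"
  have \<gamma>: "0 < \<gamma>" using \<open>\<not> b \<le> qtr T (H x)\<close> by (simp add: \<gamma>_def)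
  define \<tau> where "\<tau> = sqcols T"
  have \<tau>: "0 \<le> \<tau>" by (simp add: \<tau>_def sqcols_nonneg)
  have K: "0 \<le> K" using w(3) norm_ge_zero order_trans by blast
  \<comment> \<open>Budget of the contradiction, in units of the deficit \<open>\<gamma>\<close>:
    1/8 for the local variation of \<open>qtr T (H y)\<close>, three times 1/32 for
    \<open>e * \<tau>\<close> (two from the comparison, one from the expansion of \<open>w\<close>),
    1/8 for the spreading of the walk and 1/8 for the initial error. The sum is less than 1.\<close>
  define e where "e = \<gamma> / (32 * (\<tau> + 1))"
  have e: "0 < e" using \<gamma> \<tau> by (simp add: e_def)
  have e\<tau>: "e * \<tau> \<le> \<gamma> / 32" using \<gamma> \<tau> by (simp add: e_def field_simps)
  obtain d where d: "0 < d" "\<And>y z. norm (z - y) < d \<Longrightarrow> norm (H z - H y) < e"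
    using w(2) e unfolding uniformly_continuous_on_def dist_norm by (metis UNIV_I)
  \<comment> \<open>At distance at least \<open>d\<close> the quadratic term already exceeds the
    crude bound \<open>2 * K * \<tau>\<close> on the variation of
    \<open>qtr T (H y)\<close>.\<close>
  define C where "C = 2 * K * \<tau> / d\<^sup>2"
  have C: "0 \<le> C" using K \<tau> by (simp add: C_def)
  have up: "qtr T (H y) \<le> (qtr T (H x) + \<gamma>/8) + C * (norm (y - x))\<^sup>2" for y
  proof -
    have q: "qtr T (H y) \<le> qtr T (H x) + norm (H y - H x) * \<tau>"
      using abs_qtr_le[of T "H y - H x"] by (simp add: qtr_diff \<tau>_def)
    show ?thesis
    proof (cases "norm (y - x) < d")
      case True
      then have "norm (H y - H x) * \<tau> \<le> e * \<tau>" using d(2) \<tau> by (intro mult_right_mono) (auto simp: less_imp_le)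
      moreover have "0 \<le> C * (norm (y - x))\<^sup>2" using C by simp
      ultimately show ?thesis using q e\<tau> \<gamma> by linarith
    next
      case False
      have "norm (H y - H x) \<le> 2 * K"
        using norm_triangle_ineq4[of "H y" "H x"] w(3)[of y] w(3)[of x] by linarith
      then have "norm (H y - H x) * \<tau> \<le> 2 * K * \<tau>" using \<tau> by (intro mult_right_mono)
      also have "\<dots> = C * d\<^sup>2" using d(1) by (simp add: C_def)
      also have "\<dots> \<le> C * (norm (y - x))\<^sup>2"
        using False d(1) C by (intro mult_left_mono power_mono) auto
      finally show ?thesis using q \<gamma> by linarith
    qed
  qed
  define t where "t = \<gamma> / (16 * (C * \<tau> + 1))"
  have "0 \<le> C * \<tau>" using C \<tau> by simp
  then have t: "0 < t" and Ct: "2 * C * \<tau> * t \<le> \<gamma>/8"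
    using \<gamma> by (simp_all add: t_def field_simps)
  \<comment> \<open>The initial error enters twice, from \<open>\<kappa>\<close> to \<open>f\<close>
    and back, so its share per unit of time is
    \<open>2 * \<epsilon> / t = \<gamma> / 8\<close>.\<close>
  define \<epsilon> where "\<epsilon> = t * \<gamma> / 16"
  have \<epsilon>: "0 < \<epsilon>" using t \<gamma> by (simp add: \<epsilon>_def)
  obtain f D' H' where f: "is_C2 f D' H' UNIV" "bounded_support f"
    and H': "uniformly_continuous_on UNIV H'" and f\<kappa>: "\<And>x. \<bar>f x - \<kappa> x\<bar> \<le> \<epsilon>"
    using approx[OF \<epsilon>] by blast
  obtain d' where d': "0 < d'" "\<And>y z. norm (z - y) < d' \<Longrightarrow> norm (H' z - H' y) < e"
    using H' e unfolding uniformly_continuous_on_def dist_norm by (metis UNIV_I)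
  define B where "B = 1 + (\<Sum>i\<in>UNIV. norm (column i T))"
  have B: "norm (column i T) \<le> B" for i
    using member_le_sum[of i UNIV "\<lambda>i. norm (column i T)"] by (simp add: B_def)
  have B0: "0 < B" by (simp add: B_def add_pos_nonneg sum_nonneg)
  \<comment> \<open>Steps up to this size stay below the continuity scales of both Hessians, that of
    \<open>w\<close> and that of \<open>f\<close>. The modulus \<open>d'\<close> may be much worse
    than \<open>d\<close>, but it only influences the number of steps.\<close>
  define \<rho> where "\<rho> = min d d' / (2 * B)"
  have \<rho>: "0 < \<rho>" using d d' B0 by (simp add: \<rho>_def)
  obtain n :: nat where n: "2 * CARD('n) * t / \<rho>\<^sup>2 < n" using reals_Archimedean2 by blast
  moreover have "0 < 2 * CARD('n) * t / \<rho>\<^sup>2" using t \<rho> by simp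
  ultimately have n0: "0 < real n" by linarith
  define s where "s = sqrt (2 * CARD('n) * t / n)"
  have s2: "s\<^sup>2 = 2 * CARD('n) * t / n" using t n0 by (simp add: s_def)
  have s: "0 < s" using t n0 by (simp add: s_def)
  define h where "h = s\<^sup>2 / (2 * CARD('n))"
  have nh: "n * h = t" using n0 by (simp add: h_def s2)
  have "2 * CARD('n) * t < n * \<rho>\<^sup>2" using n \<rho> by (simp add: pos_divide_less_eq)
  then have "s\<^sup>2 \<le> \<rho>\<^sup>2" using n0 unfolding s2 by (simp add: pos_divide_le_eq mult.commute)
  then have "s \<le> \<rho>" by (rule power2_le_imp_le[OF _ less_imp_le[OF \<rho>]])
  then have "s * B \<le> \<rho> * B" using B0 by simp
  also have "\<dots> = min d d' / 2" using B0 by (simp add: \<rho>_def)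
  also have "\<dots> < min d d'" using d(1) d'(1) by (simp add: min_def)
  finally have sB: "s * B < d" "s * B < d'" by auto
  have osc: "norm (H (y + z) - H y) \<le> e" and osc': "norm (H' (y + z) - H' y) \<le> e" if "norm z \<le> s * B" for y z
    using d(2)[of "y + z" y] d'(2)[of "y + z" y] that sB by (auto simp: less_imp_le)
  have f_up: "\<kappa> y \<le> f y + \<epsilon>" for y using f\<kappa>[of y] by (simp add: abs_le_iff)
  have "\<kappa> y \<le> (walk T s ^^ n) f y + \<epsilon> + n * (h * (2 * (e * \<tau>) - b))" for y
    unfolding h_def \<tau>_def
    by (rule walk_comparison[OF \<kappa> _ s B f osc' f_up]) (rule jets)
  moreover have "(walk T s ^^ n) f y \<le> (walk T s ^^ n) (\<lambda>y. \<kappa> y + \<epsilon>) y" for y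
    using f\<kappa> by (intro walk_iter_mono) (simp add: abs_le_iff algebra_simps)
  moreover have "n * (h * (2 * (e * \<tau>) - b)) = t * (2 * (e * \<tau>) - b)" by (simp add: nh[symmetric])
  ultimately have "\<kappa> y \<le> (walk T s ^^ n) \<kappa> y + (2 * \<epsilon> + t * (2 * (e * \<tau>) - b))" for y
    unfolding walk_iter_add walk_iter_const by (smt (verit))
  \<comment> \<open>The auxiliary function \<open>f\<close> has been eliminated, and the discrete
    inequality for \<open>\<kappa>\<close> alone is what passes to its average
    \<open>w\<close>.\<close>
  then have "w x \<le> (walk T s ^^ n) w x + (2 * \<epsilon> + t * (2 * (e * \<tau>) - b))" by (rule comm)
  also have "(walk T s ^^ n) w x \<le> w x + n * h * (qtr T (H x) + \<gamma>/8 + e * \<tau>) + 2 * C * \<tau> * (n * h)\<^sup>2"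
    unfolding \<tau>_def by (rule walk_iter_upper[OF w(1) s B osc up C h_def])
  finally have "0 \<le> t * (qtr T (H x) + \<gamma>/8 + e * \<tau>) + (2 * C * \<tau> * t) * t + (t * \<gamma> / 8 + t * (2 * (e * \<tau>) - b))"
    unfolding nh by (simp add: \<epsilon>_def power2_eq_square mult_ac)
  also have "\<dots> = t * (- \<gamma> + \<gamma>/8 + 3 * (e * \<tau>) + 2 * C * \<tau> * t + \<gamma>/8)"
  proof -
    have b: "b = qtr T (H x) + \<gamma>" by (simp add: \<gamma>_def)
    show ?thesis unfolding b by (simp add: algebra_simps)
  qed
  also have "\<dots> < 0"
  proof -
    have "- \<gamma> + \<gamma>/8 + 3 * (e * \<tau>) + 2 * C * \<tau> * t + \<gamma>/8 < 0" using e\<tau> Ct \<gamma> by linarith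
    then show ?thesis using t by (simp add: mult_pos_neg)
  qed
  finally show False by simp
qed

section \<open>Mollification\<close>

lemma bounded_support_integrable:
  fixes f :: "real^'n \<Rightarrow> 'b::euclidean_space"
  assumes "continuous_on UNIV f" "bounded_support f" shows "integrable lborel f"
proof -
  obtain R where R: "\<And>x. norm x > R \<Longrightarrow> f x = 0" using assms(2) by (auto simp: bounded_support_def)
  have "integrable lborel (\<lambda>x. indicator (cball 0 R) x *\<^sub>R f x)"
    by (rule borel_integrable_compact) (auto intro: continuous_on_subset[OF assms(1)])
  moreover have "(\<lambda>x. indicator (cball 0 R) x *\<^sub>R f x) = f"
    using R by (auto simp: fun_eq_iff indicator_def)
  ultimately show ?thesis by simp
qed

lemma bounded_support_uniformly_continuous:
  fixes f :: "real^'n \<Rightarrow> 'b::real_normed_vector"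
  assumes "continuous_on UNIV f" "bounded_support f" shows "uniformly_continuous_on UNIV f"
  unfolding uniformly_continuous_on_def
proof (intro allI impI)
  fix e :: real assume e: "0 < e"
  obtain R where R: "\<And>x. norm x > R \<Longrightarrow> f x = 0" using assms(2) by (auto simp: bounded_support_def)
  have "uniformly_continuous_on (cball 0 (R + 1)) f"
    by (intro compact_uniformly_continuous continuous_on_subset[OF assms(1)]) auto
  then obtain d where d: "0 < d" "\<And>x y. norm x \<le> R + 1 \<Longrightarrow> norm y \<le> R + 1 \<Longrightarrow> dist y x < d \<Longrightarrow> dist (f y) (f x) < e"
    using e unfolding uniformly_continuous_on_def by (meson mem_cball_0)
  \<comment> \<open>With distance less than 1, if one of the points leaves the ball of radius
    \<open>R + 1\<close>, both lie outside the ball of radius \<open>R\<close>.\<close>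
  have "dist (f y) (f x) < e" if "dist y x < min d 1" for x y
  proof (cases "norm x \<le> R + 1 \<and> norm y \<le> R + 1")
    case False
    have "norm x > R" "norm y > R"
      using False that norm_triangle_ineq2[of x y] norm_triangle_ineq2[of y x]
      by (auto simp: dist_norm norm_minus_commute)
    then show ?thesis using R e by simp
  qed (use d that in auto)
  then show "\<exists>d>0. \<forall>x\<in>UNIV. \<forall>x'\<in>UNIV. dist x' x < d \<longrightarrow> dist (f x') (f x) < e"
    using d(1) by (intro exI[of _ "min d 1"]) auto
qed

lemma bounded_support_bounded:
  fixes f :: "real^'n \<Rightarrow> 'b::real_normed_vector"
  assumes "continuous_on UNIV f" "bounded_support f" obtains K where "\<And>x. norm (f x) \<le> K"
proof -
  have "bounded_support (\<lambda>x. norm (f x))" using assms(2) by (auto simp: bounded_support_def)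
  moreover have "continuous_on UNIV (\<lambda>x. norm (f x))" using assms(1) by (intro continuous_intros)
  ultimately show thesis using bounded_support_attains_sup that by blast
qed

lemma integral_reflect_translate:
  fixes f :: "real^'n \<Rightarrow> 'b::euclidean_space"
  assumes "continuous_on UNIV f"
  shows "(\<integral>y. f (x - y) \<partial>lborel) = (\<integral>y. f y \<partial>lborel)"
proof -
  have "lborel = distr lborel borel (\<lambda>y::real^'n. x - y)"
    using lborel_affine[of "-1" x] by (simp add: density_1)
  then have "(\<integral>y. f y \<partial>lborel) = (\<integral>y. f y \<partial>(distr lborel borel (\<lambda>y. x - y)))" by simp
  also have "\<dots> = (\<integral>y. f (x - y) \<partial>lborel)"
    using assms by (intro integral_distr borel_measurable_continuous_onI) measurable
  finally show ?thesis by simp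
qed

text \<open>The shift sits on \<open>G\<close>, so derivatives fall on the kernel and continuity of
  \<open>\<kappa>\<close> suffices; vector values let \<open>G\<close> be the gradient or the
  Hessian of a kernel.\<close>

definition conv :: "(real^'n \<Rightarrow> real) \<Rightarrow> (real^'n \<Rightarrow> 'b::euclidean_space) \<Rightarrow> real^'n \<Rightarrow> 'b" where
  "conv \<kappa> G x = (\<integral>y. \<kappa> y *\<^sub>R G (x - y) \<partial>lborel)"

lemma conv_integrable:
  fixes G :: "real^'n \<Rightarrow> 'b::euclidean_space"
  assumes "continuous_on UNIV \<kappa>" "bounded_support \<kappa>" "continuous_on UNIV G"
  shows "integrable lborel (\<lambda>y. \<kappa> y *\<^sub>R G (x - y))"
proof (rule bounded_support_integrable)
  show "continuous_on UNIV (\<lambda>y. \<kappa> y *\<^sub>R G (x - y))"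
    using assms by (intro continuous_intros continuous_on_compose2[OF assms(3)]) auto
  show "bounded_support (\<lambda>y. \<kappa> y *\<^sub>R G (x - y))"
    using assms(2) by (auto simp: bounded_support_def)
qed

lemma conv_norm_le:
  fixes G :: "real^'n \<Rightarrow> 'b::euclidean_space"
  assumes \<kappa>: "continuous_on UNIV \<kappa>" "bounded_support \<kappa>" and G: "continuous_on UNIV G"
    and le: "\<And>y. norm (G y) \<le> e"
  shows "norm (conv \<kappa> G x) \<le> e * (\<integral>y. \<bar>\<kappa> y\<bar> \<partial>lborel)"
proof -
  have abs: "integrable lborel (\<lambda>y. \<bar>\<kappa> y\<bar>)"
    using bounded_support_integrable[OF \<kappa>] by (rule integrable_abs)
  have "norm (conv \<kappa> G x) \<le> (\<integral>y. e * \<bar>\<kappa> y\<bar> \<partial>lborel)"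
    unfolding conv_def
  proof (rule Bochner_Integration.integral_norm_bound_integral)
    show "integrable lborel (\<lambda>y. e * \<bar>\<kappa> y\<bar>)" using abs by simp
    show "norm (\<kappa> y *\<^sub>R G (x - y)) \<le> e * \<bar>\<kappa> y\<bar>" for y
      using mult_left_mono[OF le[of "x - y"], of "\<bar>\<kappa> y\<bar>"] by (simp add: mult.commute)
  qed (rule conv_integrable[OF \<kappa> G])
  then show ?thesis by simp
qed

lemma conv_diff:
  fixes G :: "real^'n \<Rightarrow> 'b::euclidean_space"
  assumes "continuous_on UNIV \<kappa>" "bounded_support \<kappa>" "continuous_on UNIV G" "continuous_on UNIV G'"
  shows "conv \<kappa> (\<lambda>y. G y - G' y) x = conv \<kappa> G x - conv \<kappa> G' x"
  unfolding conv_def scaleR_diff_right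
  by (intro Bochner_Integration.integral_diff conv_integrable assms)

lemma conv_translate: "conv \<kappa> (\<lambda>y. G (y + z)) x = conv \<kappa> G (x + z)"
  by (simp add: conv_def algebra_simps)

lemma conv_bounded_linear:
  fixes G :: "real^'n \<Rightarrow> 'b::euclidean_space" and L :: "'b \<Rightarrow> 'c::euclidean_space"
  assumes "continuous_on UNIV \<kappa>" "bounded_support \<kappa>" "continuous_on UNIV G" "bounded_linear L"
  shows "conv \<kappa> (\<lambda>y. L (G y)) x = L (conv \<kappa> G x)"
proof -
  have "(\<integral>y. L (\<kappa> y *\<^sub>R G (x - y)) \<partial>lborel) = L (conv \<kappa> G x)"
    unfolding conv_def by (rule integral_bounded_linear[OF assms(4) conv_integrable[OF assms(1-3)]])
  then show ?thesis
    unfolding conv_def by (simp add: linear_scale[OF bounded_linear.linear[OF assms(4)]])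
qed

lemma conv_continuous:
  fixes G :: "real^'n \<Rightarrow> 'b::euclidean_space"
  assumes \<kappa>: "continuous_on UNIV \<kappa>" "bounded_support \<kappa>" and G: "uniformly_continuous_on UNIV G"
  shows "continuous_on UNIV (conv \<kappa> G)"
  unfolding continuous_on_iff
proof (intro ballI allI impI)
  fix x :: "real^'n" and e :: real assume e: "0 < e"
  have cG: "continuous_on UNIV G" by (rule uniformly_continuous_imp_continuous[OF G])
  define I where "I = (\<integral>y. \<bar>\<kappa> y\<bar> \<partial>lborel)"
  have I: "0 \<le> I" by (simp add: I_def)
  have "0 < e / (I + 1)" using e I by simp
  then obtain d where d: "0 < d" "\<And>y z. dist z y < d \<Longrightarrow> dist (G z) (G y) < e / (I + 1)"
    using G unfolding uniformly_continuous_on_def by (metis UNIV_I)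
  have "dist (conv \<kappa> G x') (conv \<kappa> G x) < e" if "dist x' x < d" for x'
  proof -
    have cG': "continuous_on UNIV (\<lambda>y. G (y + (x' - x)))"
      by (intro continuous_on_compose2[OF cG] continuous_intros) auto
    have "conv \<kappa> G x' - conv \<kappa> G x = conv \<kappa> (\<lambda>y. G (y + (x' - x)) - G y) x"
      by (simp add: conv_diff[OF \<kappa> cG' cG] conv_translate)
    also have "norm \<dots> \<le> (e / (I + 1)) * I"
      unfolding I_def
    proof (rule conv_norm_le[OF \<kappa>])
      show "continuous_on UNIV (\<lambda>y. G (y + (x' - x)) - G y)" by (intro continuous_intros cG cG')
      show "norm (G (y + (x' - x)) - G y) \<le> e / ((\<integral>y. \<bar>\<kappa> y\<bar> \<partial>lborel) + 1)" for y
        using d(2)[of "y + (x' - x)" y] that by (simp add: dist_norm I_def less_imp_le)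
    qed
    also have "\<dots> < e" using e I by (simp add: field_simps)
    finally show ?thesis by (simp add: dist_norm)
  qed
  then show "\<exists>d>0. \<forall>x'\<in>UNIV. dist x' x < d \<longrightarrow> dist (conv \<kappa> G x') (conv \<kappa> G x) < e"
    using d(1) by blast
qed

lemma conv_bounded_support:
  fixes G :: "real^'n \<Rightarrow> 'b::euclidean_space"
  assumes "bounded_support \<kappa>" "bounded_support G" shows "bounded_support (conv \<kappa> G)"
proof -
  obtain R R' where R: "\<And>x. norm x > R \<Longrightarrow> \<kappa> x = 0" "\<And>x. norm x > R' \<Longrightarrow> G x = 0"
    using assms by (auto simp: bounded_support_def)
  have "conv \<kappa> G x = 0" if "norm x > R + R'" for x
  proof -
    have "\<kappa> y *\<^sub>R G (x - y) = 0" for y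
    proof (cases "norm y > R")
      case False
      then have "norm (x - y) > R'" using that norm_triangle_ineq2[of x y] by linarith
      then show ?thesis using R by simp
    qed (simp add: R)
    then show ?thesis by (simp only: conv_def Bochner_Integration.integral_zero)
  qed
  then show ?thesis by (auto simp: bounded_support_def)
qed

text \<open>Uniform continuity of the derivative makes the linearization error of \<open>G\<close>
  small uniformly in the base point. It therefore stays small relative to the increment after
  integration against \<open>\<bar>\<kappa>\<bar>\<close>.\<close>

lemma conv_has_derivative:
  fixes G :: "real^'n \<Rightarrow> 'b::euclidean_space"
  assumes \<kappa>: "continuous_on UNIV \<kappa>" "bounded_support \<kappa>" and G: "continuous_on UNIV G"
    and dG: "\<And>y. (G has_derivative G' y) (at y)"
    and cG': "\<And>k. continuous_on UNIV (\<lambda>y. G' y k)"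
    and unif: "\<And>e. 0 < e \<Longrightarrow> \<exists>d>0. \<forall>y z. norm (z - y) < d \<longrightarrow> onorm (\<lambda>k. G' z k - G' y k) \<le> e"
  shows "(conv \<kappa> G has_derivative (\<lambda>k. conv \<kappa> (\<lambda>y. G' y k) x)) (at x)"
  unfolding has_derivative_at_alt
proof (intro conjI allI impI)
  have bl: "bounded_linear (G' y)" for y using dG has_derivative_bounded_linear by blast
  have lin: "linear (G' y)" for y by (rule bounded_linear.linear[OF bl])
  show "bounded_linear (\<lambda>k. conv \<kappa> (\<lambda>y. G' y k) x)"
  proof (rule linear_conv_bounded_linear[THEN iffD1], rule linearI)
    fix k k' :: "real^'n" and c :: real
    show "conv \<kappa> (\<lambda>y. G' y (k + k')) x = conv \<kappa> (\<lambda>y. G' y k) x + conv \<kappa> (\<lambda>y. G' y k') x"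
      unfolding conv_def linear_add[OF lin] scaleR_add_right
      by (intro Bochner_Integration.integral_add conv_integrable[OF \<kappa>] cG')
    show "conv \<kappa> (\<lambda>y. G' y (c *\<^sub>R k)) x = c *\<^sub>R conv \<kappa> (\<lambda>y. G' y k) x"
      unfolding linear_scale[OF lin] by (rule conv_bounded_linear[OF \<kappa> cG' bounded_linear_scaleR_right])
  qed
  fix e :: real assume e: "0 < e"
  define I where "I = (\<integral>y. \<bar>\<kappa> y\<bar> \<partial>lborel)"
  have I: "0 \<le> I" by (simp add: I_def)
  define e' where "e' = e / (I + 1)"
  have e': "0 < e'" using e I by (simp add: e'_def)
  then obtain d where d: "0 < d" "\<And>y z. norm (z - y) < d \<Longrightarrow> onorm (\<lambda>k. G' z k - G' y k) \<le> e'"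
    using unif by blast
  have lin_bound: "norm (G (y + k) - G y - G' y k) \<le> norm k * e'" if k: "norm k < d" for y k
  proof -
    have "norm (G (y + k) - G y - G' y (y + k - y)) \<le> norm (y + k - y) * e'"
    proof (rule differentiable_bound_linearization[where S = "ball y d"])
      fix t :: real assume "t \<in> {0..1}"
      then have "norm (t *\<^sub>R k) \<le> norm k" by (simp add: mult_left_le_one_le)
      then show "y + t *\<^sub>R (y + k - y) \<in> ball y d" using k by (simp add: dist_norm)
    next
      fix z assume "z \<in> ball y d"
      then have "norm (z - y) < d" by (simp add: dist_norm norm_minus_commute)
      then show "onorm (G' z - G' y) \<le> e'" using d(2) by (simp add: fun_diff_def)
      show "(G has_derivative G' z) (at z within ball y d)"
        using dG by (rule has_derivative_at_withinI)
    qed (use d in auto)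
    then show ?thesis by simp
  qed
  have "norm (conv \<kappa> G x' - conv \<kappa> G x - conv \<kappa> (\<lambda>y. G' y (x' - x)) x) \<le> e * norm (x' - x)"
    if x': "norm (x' - x) < d" for x'
  proof -
    have cGt: "continuous_on UNIV (\<lambda>y. G (y + (x' - x)))"
      by (intro continuous_on_compose2[OF G] continuous_intros) auto
    have "conv \<kappa> G x' - conv \<kappa> G x - conv \<kappa> (\<lambda>y. G' y (x' - x)) x
        = conv \<kappa> (\<lambda>y. G (y + (x' - x)) - G y - G' y (x' - x)) x"
      using conv_diff[OF \<kappa> continuous_on_diff[OF cGt G] cG', of "x' - x" x] conv_diff[OF \<kappa> cGt G, of x]
      by (simp add: conv_translate)
    also have "norm \<dots> \<le> (norm (x' - x) * e') * I"
      unfolding I_def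
      by (rule conv_norm_le[OF \<kappa> _ lin_bound[OF x']])
        (intro continuous_on_diff cGt G cG')
    also have "\<dots> \<le> e * norm (x' - x)"
    proof -
      have "e' * I \<le> e" using e I by (simp add: e'_def field_simps)
      then have "norm (x' - x) * (e' * I) \<le> norm (x' - x) * e" by (intro mult_left_mono) auto
      then show ?thesis by (simp add: mult_ac)
    qed
    finally show ?thesis .
  qed
  then show "\<exists>d>0. \<forall>y. norm (y - x) < d \<longrightarrow>
      norm (conv \<kappa> G y - conv \<kappa> G x - conv \<kappa> (\<lambda>z. G' z (y - x)) x) \<le> e * norm (y - x)"
    using d(1) by blast
qed

text \<open>Only the point 0 is delicate; there the exponent is at least 2, so the difference
  quotient tends to 0 from both sides.\<close>

lemma has_real_derivative_max0_power:
  fixes s :: real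
  shows "((\<lambda>s. max 0 s ^ Suc (Suc n)) has_real_derivative real (Suc (Suc n)) * max 0 s ^ Suc n) (at s)"
proof -
  consider "s < 0" | "s = 0" | "s > 0" by linarith
  then show ?thesis
  proof cases
    case 1
    have "((\<lambda>s::real. 0) has_real_derivative 0) (at s)" by simp
    then have "((\<lambda>s::real. max 0 s ^ Suc (Suc n)) has_real_derivative 0) (at s)"
      by (rule has_field_derivative_transform_within_open[where S = "{..<0}"]) (use 1 in auto)
    then show ?thesis using 1 by simp
  next
    case 3
    have "((\<lambda>s::real. s ^ Suc (Suc n)) has_real_derivative real (Suc (Suc n)) * s ^ Suc n) (at s)"
      by (rule DERIV_cong[OF DERIV_pow]) simp
    then have "((\<lambda>s::real. max 0 s ^ Suc (Suc n)) has_real_derivative real (Suc (Suc n)) * s ^ Suc n) (at s)"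
      by (rule has_field_derivative_transform_within_open[where S = "{0<..}"]) (use 3 in auto)
    then show ?thesis using 3 by simp
  next
    case 2
    have "((\<lambda>h::real. max 0 h ^ Suc (Suc n) / h) \<longlongrightarrow> 0) (at 0)"
    proof (rule Lim_null_comparison)
      show "\<forall>\<^sub>F h in at 0. norm (max 0 h ^ Suc (Suc n) / h) \<le> \<bar>h\<bar> ^ Suc n"
        by (rule always_eventually) (auto simp: max_def mult_nonpos_nonneg)
      have "((\<lambda>h::real. \<bar>h\<bar> ^ Suc n) \<longlongrightarrow> \<bar>0\<bar> ^ Suc n) (at 0)" by (intro tendsto_intros)
      then show "((\<lambda>h::real. \<bar>h\<bar> ^ Suc n) \<longlongrightarrow> 0) (at 0)" by simp
    qed
    then show ?thesis using 2 by (simp add: DERIV_def)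
  qed
qed

section \<open>An explicit compactly supported kernel of class \<open>C\<^sup>2\<close>\<close>

definition cutoff :: "real \<Rightarrow> real^'n \<Rightarrow> real" where
  "cutoff \<delta> z = max 0 (\<delta>\<^sup>2 - z \<bullet> z)"

text \<open>The cube is the smallest integer power of the cutoff whose second derivatives are
  continuous across the sphere of radius \<open>\<delta>\<close>. Test functions need no more
  regularity than that.\<close>

definition bump :: "real \<Rightarrow> real^'n \<Rightarrow> real" where
  "bump \<delta> z = cutoff \<delta> z ^ 3"

definition bump_grad :: "real \<Rightarrow> real^'n \<Rightarrow> real^'n" where
  "bump_grad \<delta> z = (- 6 * (cutoff \<delta> z)\<^sup>2) *\<^sub>R z"

definition outer :: "real^'n \<Rightarrow> real^'n^'n" where
  "outer z = (\<chi> i j. z$i * z$j)"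

definition bump_hess :: "real \<Rightarrow> real^'n \<Rightarrow> real^'n^'n" where
  "bump_hess \<delta> z = (24 * cutoff \<delta> z) *\<^sub>R outer z + (- 6 * (cutoff \<delta> z)\<^sup>2) *\<^sub>R mat 1"

lemma outer_mult: "outer z *v k = (z \<bullet> k) *\<^sub>R z"
  by (simp add: outer_def matrix_vector_mult_def vec_eq_iff inner_vec_def sum_distrib_left mult_ac)

lemma outer_Sym: "outer z \<in> Sym"
  by (simp add: outer_def Sym_def transpose_def vec_eq_iff mult.commute)

lemma cutoff_eq_0: "\<bar>\<delta>\<bar> < norm z \<Longrightarrow> cutoff \<delta> z = 0"
  using power_strict_mono[of "\<bar>\<delta>\<bar>" "norm z" 2] by (simp add: cutoff_def dot_square_norm)

lemma continuous_cutoff [continuous_intros]: "continuous_on S (cutoff \<delta>)"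
  unfolding cutoff_def[abs_def] by (intro continuous_intros)

lemma continuous_outer [continuous_intros]: "continuous_on S outer"
  unfolding outer_def[abs_def] by (intro continuous_intros)

lemma continuous_bump: "continuous_on UNIV (bump \<delta>)"
  and continuous_bump_grad: "continuous_on UNIV (bump_grad \<delta>)"
  and continuous_bump_hess: "continuous_on UNIV (bump_hess \<delta>)"
  unfolding bump_def[abs_def] bump_grad_def[abs_def] bump_hess_def[abs_def]
  by (intro continuous_intros)+

lemma bounded_support_bump: "bounded_support (bump \<delta>)"
  and bounded_support_bump_grad: "bounded_support (bump_grad \<delta>)"
  and bounded_support_bump_hess: "bounded_support (bump_hess \<delta>)"
  unfolding bounded_support_def bump_def bump_grad_def bump_hess_def
  by (auto simp: cutoff_eq_0 intro!: exI[of _ "\<bar>\<delta>\<bar>"])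

lemma bump_nonneg: "0 \<le> bump \<delta> z"
  by (simp add: bump_def cutoff_def)

lemma bump_eq_0: "0 < \<delta> \<Longrightarrow> \<delta> < norm z \<Longrightarrow> bump \<delta> z = 0"
  by (simp add: bump_def cutoff_eq_0)

lemma has_derivative_bump: "(bump \<delta> has_derivative (\<lambda>k. bump_grad \<delta> z \<bullet> k)) (at z)"
proof -
  have "((\<lambda>z. \<delta>\<^sup>2 - z \<bullet> z) has_derivative (\<lambda>k. - 2 * (z \<bullet> k))) (at z)"
    by (auto intro!: derivative_eq_intros simp: inner_commute)
  from DERIV_compose_FDERIV[OF has_real_derivative_max0_power[of 1] this]
  show ?thesis
    by (simp add: bump_def[abs_def] bump_grad_def cutoff_def[abs_def] numeral_3_eq_3 numeral_2_eq_2 mult_ac)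
qed

lemma has_derivative_bump_grad: "(bump_grad \<delta> has_derivative (\<lambda>k. bump_hess \<delta> z *v k)) (at z)"
proof -
  have "((\<lambda>z. \<delta>\<^sup>2 - z \<bullet> z) has_derivative (\<lambda>k. - 2 * (z \<bullet> k))) (at z)"
    by (auto intro!: derivative_eq_intros simp: inner_commute)
  from DERIV_compose_FDERIV[OF has_real_derivative_max0_power[of 0] this]
  have "((\<lambda>z. (cutoff \<delta> z)\<^sup>2) has_derivative (\<lambda>k. - 4 * cutoff \<delta> z * (z \<bullet> k))) (at z)"
    by (simp add: cutoff_def[abs_def] numeral_2_eq_2 mult_ac)
  from has_derivative_scaleR[OF has_derivative_mult_right[OF this, of "- 6"] has_derivative_ident]
  have "((\<lambda>z. (- 6 * (cutoff \<delta> z)\<^sup>2) *\<^sub>R z) has_derivative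
      (\<lambda>k. (- 6 * (cutoff \<delta> z)\<^sup>2) *\<^sub>R k + (24 * cutoff \<delta> z * (z \<bullet> k)) *\<^sub>R z)) (at z)"
    by (simp add: mult.assoc)
  moreover have "bump_hess \<delta> z *v k = (- 6 * (cutoff \<delta> z)\<^sup>2) *\<^sub>R k + (24 * cutoff \<delta> z * (z \<bullet> k)) *\<^sub>R z" for k
    unfolding bump_hess_def matrix_vector_mult_add_rdistrib scaleR_matrix_vector_assoc[symmetric] outer_mult
    by simp
  ultimately show ?thesis by (simp add: bump_grad_def[abs_def])
qed

lemma integral_bump_pos:
  assumes "0 < \<delta>" shows "0 < integral\<^sup>L lborel (bump \<delta> :: real^'n \<Rightarrow> real)"
proof -
  let ?c = "(\<delta>\<^sup>2 * 3 / 4) ^ 3"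
  let ?B = "ball 0 (\<delta>/2) :: (real^'n) set"
  have "0 < ?c * measure lborel ?B"
    using assms content_ball_pos[of "\<delta>/2" "0::real^'n"] by simp
  also have "\<dots> = (\<integral>z. ?c * indicator ?B z \<partial>lborel)" by simp
  also have "\<dots> \<le> integral\<^sup>L lborel (bump \<delta> :: real^'n \<Rightarrow> real)"
  proof (rule Bochner_Integration.integral_mono)
    show "integrable lborel (\<lambda>z. ?c * indicator ?B z)"
      by (intro integrable_mult_right integrable_real_indicator emeasure_bounded_finite) auto
    show "integrable lborel (bump \<delta> :: real^'n \<Rightarrow> real)"
      by (rule bounded_support_integrable[OF continuous_bump bounded_support_bump])
    show "?c * indicator ?B z \<le> bump \<delta> z" for z :: "real^'n"
    proof (cases "z \<in> ?B")
      case True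
      then have "(norm z)\<^sup>2 \<le> (\<delta>/2)\<^sup>2" by (intro power_mono) auto
      then have "\<delta>\<^sup>2 * 3 / 4 \<le> \<delta>\<^sup>2 - z \<bullet> z"
        by (simp add: dot_square_norm power_divide)
      then have "\<delta>\<^sup>2 * 3 / 4 \<le> cutoff \<delta> z"
        unfolding cutoff_def by (rule max.coboundedI2)
      then have "?c \<le> cutoff \<delta> z ^ 3" by (intro power_mono) auto
      then show ?thesis using True by (simp add: bump_def)
    qed (simp add: bump_nonneg)
  qed
  finally show ?thesis .
qed

text \<open>The shift is on \<open>\<kappa>\<close> here, which suits order and the walk, both of
  which concern translates of \<open>\<kappa>\<close>; for derivatives the form with the shift on
  the kernel is recovered by reflecting the integral. Division by the mass of the kernel makes
  constants invariant.\<close>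

definition mollify :: "real \<Rightarrow> (real^'n \<Rightarrow> real) \<Rightarrow> real^'n \<Rightarrow> real" where
  "mollify \<delta> \<kappa> x = (\<integral>z. \<kappa> (x - z) * bump \<delta> z \<partial>lborel) / integral\<^sup>L lborel (bump \<delta> :: real^'n \<Rightarrow> real)"

lemma mollify_integrable:
  assumes "continuous_on UNIV \<kappa>" shows "integrable lborel (\<lambda>z. \<kappa> (x - z) * bump \<delta> z)"
proof (rule bounded_support_integrable)
  show "continuous_on UNIV (\<lambda>z. \<kappa> (x - z) * bump \<delta> z)"
    by (intro continuous_on_mult continuous_bump continuous_on_compose2[OF assms] continuous_intros) auto
  show "bounded_support (\<lambda>z. \<kappa> (x - z) * bump \<delta> z)"
    using bounded_support_bump[of \<delta>] unfolding bounded_support_def by (metis mult_zero_right)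
qed

lemma mollify_conv:
  fixes \<kappa> :: "real^'n \<Rightarrow> real"
  assumes "continuous_on UNIV \<kappa>"
  shows "mollify \<delta> \<kappa> x = conv \<kappa> (bump \<delta>) x / integral\<^sup>L lborel (bump \<delta> :: real^'n \<Rightarrow> real)"
proof -
  have "continuous_on UNIV (\<lambda>y. \<kappa> y * bump \<delta> (x - y))"
    by (intro continuous_on_mult assms continuous_on_compose2[OF continuous_bump] continuous_intros) auto
  from integral_reflect_translate[OF this, of x] show ?thesis
    by (simp add: mollify_def conv_def)
qed

lemma mollify_const: "0 < \<delta> \<Longrightarrow> mollify \<delta> (\<lambda>_. c) x = c" for x :: "real^'n"
  using integral_bump_pos[of \<delta>, where 'n = 'n] by (simp add: mollify_def)

lemma mollify_add:
  assumes "continuous_on UNIV \<kappa>" "continuous_on UNIV \<kappa>'"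
  shows "mollify \<delta> (\<lambda>y. \<kappa> y + \<kappa>' y) x = mollify \<delta> \<kappa> x + mollify \<delta> \<kappa>' x"
  by (simp add: mollify_def distrib_right mollify_integrable[OF assms(1)] mollify_integrable[OF assms(2)]
      add_divide_distrib)

lemma mollify_mono:
  fixes x :: "real^'n"
  assumes "continuous_on UNIV \<kappa>" "continuous_on UNIV \<kappa>'" "\<And>z. norm z \<le> \<delta> \<Longrightarrow> \<kappa> (x - z) \<le> \<kappa>' (x - z)"
    and "0 < \<delta>"
  shows "mollify \<delta> \<kappa> x \<le> mollify \<delta> \<kappa>' x"
  unfolding mollify_def
proof (intro divide_right_mono Bochner_Integration.integral_mono mollify_integrable assms)
  show "\<kappa> (x - z) * bump \<delta> z \<le> \<kappa>' (x - z) * bump \<delta> z" for z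
    using assms(3)[of z] bump_eq_0[OF assms(4), of z] bump_nonneg[of \<delta> z]
    by (cases "norm z \<le> \<delta>") (auto intro: mult_right_mono)
  show "0 \<le> integral\<^sup>L lborel (bump \<delta> :: real^'n \<Rightarrow> real)" by (simp add: bump_nonneg)
qed

lemma mollify_close:
  assumes \<kappa>: "continuous_on UNIV \<kappa>" and \<delta>: "0 < \<delta>"
    and osc: "\<And>z. norm z \<le> \<delta> \<Longrightarrow> \<bar>\<kappa> (x - z) - \<kappa> x\<bar> \<le> e"
  shows "\<bar>mollify \<delta> \<kappa> x - \<kappa> x\<bar> \<le> e"
proof -
  have "mollify \<delta> \<kappa> x \<le> mollify \<delta> (\<lambda>_. \<kappa> x + e) x"
    using osc by (intro mollify_mono \<kappa> \<delta> continuous_intros) (auto simp: abs_le_iff algebra_simps)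
  moreover have "mollify \<delta> (\<lambda>_. \<kappa> x - e) x \<le> mollify \<delta> \<kappa> x"
    using osc by (intro mollify_mono \<kappa> \<delta> continuous_intros) (auto simp: abs_le_iff algebra_simps)
  ultimately show ?thesis by (simp add: mollify_const[OF \<delta>] abs_le_iff)
qed

lemma continuous_walk:
  fixes \<kappa> :: "real^'n \<Rightarrow> real"
  assumes "continuous_on UNIV \<kappa>" shows "continuous_on UNIV (walk T s \<kappa>)"
proof -
  have "continuous_on UNIV (\<lambda>x. \<kappa> (x + a))" "continuous_on UNIV (\<lambda>x. \<kappa> (x - a))" for a
    by (intro continuous_on_compose2[OF assms] continuous_intros; simp)+
  then show ?thesis
    unfolding walk_def[abs_def] by (intro continuous_on_scaleR continuous_on_const continuous_on_sum continuous_on_add)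
qed

text \<open>Both operations average translates of \<open>\<kappa>\<close>. The walk is a finite
  average, so linearity of the integral is enough to interchange them.\<close>

lemma mollify_walk:
  fixes \<kappa> :: "real^'n \<Rightarrow> real"
  assumes "continuous_on UNIV \<kappa>"
  shows "mollify \<delta> (walk T s \<kappa>) x = walk T s (mollify \<delta> \<kappa>) x"
proof -
  have e: "\<kappa> (x - z + a) = \<kappa> ((x + a) - z)" "\<kappa> (x - z - a) = \<kappa> ((x - a) - z)" for z a
    by (simp_all add: algebra_simps)
  have "(\<integral>z. walk T s \<kappa> (x - z) * bump \<delta> z \<partial>lborel)
      = (\<integral>z. (1 / (2 * CARD('n))) * (\<Sum>i\<in>UNIV. \<kappa> ((x + s *\<^sub>R column i T) - z) * bump \<delta> z
          + \<kappa> ((x - s *\<^sub>R column i T) - z) * bump \<delta> z) \<partial>lborel)"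
    unfolding walk_def e real_scaleR_def mult.assoc sum_distrib_right distrib_right ..
  also have "\<dots> = (1 / (2 * CARD('n))) * (\<Sum>i\<in>UNIV. (\<integral>z. \<kappa> ((x + s *\<^sub>R column i T) - z) * bump \<delta> z \<partial>lborel)
          + (\<integral>z. \<kappa> ((x - s *\<^sub>R column i T) - z) * bump \<delta> z \<partial>lborel))"
    using mollify_integrable[OF assms]
    by (subst integral_mult_right_zero)
      (simp add: Bochner_Integration.integral_sum Bochner_Integration.integral_add)
  finally have X: "(\<integral>z. walk T s \<kappa> (x - z) * bump \<delta> z \<partial>lborel)
      = (1 / (2 * CARD('n))) * (\<Sum>i\<in>UNIV. (\<integral>z. \<kappa> ((x + s *\<^sub>R column i T) - z) * bump \<delta> z \<partial>lborel)
          + (\<integral>z. \<kappa> ((x - s *\<^sub>R column i T) - z) * bump \<delta> z \<partial>lborel))" .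
  show ?thesis
    unfolding mollify_def X
    unfolding walk_def real_scaleR_def add_divide_distrib[symmetric] sum_divide_distrib[symmetric]
      times_divide_eq_right ..
qed

lemma mollify_walk_iter:
  assumes "continuous_on UNIV \<kappa>"
  shows "continuous_on UNIV ((walk T s ^^ n) \<kappa>)" "mollify \<delta> ((walk T s ^^ n) \<kappa>) = (walk T s ^^ n) (mollify \<delta> \<kappa>)"
proof -
  have c: "continuous_on UNIV ((walk T s ^^ n) \<kappa>)" for n
    by (induction n) (simp_all add: assms continuous_walk)
  show "continuous_on UNIV ((walk T s ^^ n) \<kappa>)" by (rule c)
  show "mollify \<delta> ((walk T s ^^ n) \<kappa>) = (walk T s ^^ n) (mollify \<delta> \<kappa>)"
  proof (induction n)
    case (Suc n)
    have "mollify \<delta> (walk T s ((walk T s ^^ n) \<kappa>)) = walk T s (mollify \<delta> ((walk T s ^^ n) \<kappa>))"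
      using mollify_walk[OF c[of n]] by (rule ext)
    then show ?case using Suc by simp
  qed simp
qed

text \<open>All derivatives are put on the kernel. Symmetry of the Hessian is inherited from the
  kernel as well, since transposition is linear and commutes with the integral.\<close>

lemma mollify_C2:
  fixes \<kappa> :: "real^'n \<Rightarrow> real"
  assumes \<kappa>: "continuous_on UNIV \<kappa>" "bounded_support \<kappa>"
  obtains D H where "is_C2 (mollify \<delta> \<kappa>) D H UNIV" "\<And>x. H x \<in> Sym" "bounded_support H"
    "bounded_support (mollify \<delta> \<kappa>)"
proof -
  define c where "c = integral\<^sup>L lborel (bump \<delta> :: real^'n \<Rightarrow> real)"
  have mol: "mollify \<delta> \<kappa> = (\<lambda>x. (1 / c) *\<^sub>R conv \<kappa> (bump \<delta>) x)"
    using mollify_conv[OF \<kappa>(1), of \<delta>] by (simp add: fun_eq_iff c_def)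
  have uD: "uniformly_continuous_on UNIV (bump_grad \<delta> :: real^'n \<Rightarrow> real^'n)"
    by (intro bounded_support_uniformly_continuous continuous_bump_grad bounded_support_bump_grad)
  have uH: "uniformly_continuous_on UNIV (bump_hess \<delta> :: real^'n \<Rightarrow> real^'n^'n)"
    by (intro bounded_support_uniformly_continuous continuous_bump_hess bounded_support_bump_hess)
  have blm: "bounded_linear (\<lambda>A :: real^'n^'n. A *v k)" for k :: "real^'n"
    by (rule linear_conv_bounded_linear[THEN iffD1], rule linearI)
      (simp_all add: matrix_vector_mult_add_rdistrib scaleR_matrix_vector_assoc)
  have d1: "(conv \<kappa> (bump \<delta>) has_derivative (\<lambda>k. conv \<kappa> (bump_grad \<delta>) x \<bullet> k)) (at x)" for x
  proof -
    have "(conv \<kappa> (bump \<delta>) has_derivative (\<lambda>k. conv \<kappa> (\<lambda>y. bump_grad \<delta> y \<bullet> k) x)) (at x)"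
    proof (rule conv_has_derivative[OF \<kappa> continuous_bump has_derivative_bump])
      show "continuous_on UNIV (\<lambda>y. bump_grad \<delta> y \<bullet> k)" for k :: "real^'n"
        by (intro continuous_intros continuous_bump_grad)
      fix e :: real assume "0 < e"
      then obtain d where d: "0 < d" "\<And>y z. dist z y < d \<Longrightarrow> dist (bump_grad \<delta> z) (bump_grad \<delta> y :: real^'n) < e"
        using uD unfolding uniformly_continuous_on_def by (metis UNIV_I)
      have "onorm (\<lambda>k. bump_grad \<delta> z \<bullet> k - bump_grad \<delta> y \<bullet> k) \<le> e" if "norm (z - y) < d" for y z :: "real^'n"
      proof (rule onorm_le)
        fix k
        have "norm (bump_grad \<delta> z \<bullet> k - bump_grad \<delta> y \<bullet> k) \<le> norm (bump_grad \<delta> z - bump_grad \<delta> y) * norm k"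
          unfolding inner_diff_left[symmetric] by (simp add: Cauchy_Schwarz_ineq2)
        also have "\<dots> \<le> e * norm k"
          using d(2)[of z y] that by (intro mult_right_mono) (auto simp: dist_norm)
        finally show "norm (bump_grad \<delta> z \<bullet> k - bump_grad \<delta> y \<bullet> k) \<le> e * norm k" .
      qed
      then show "\<exists>d>0. \<forall>y z :: real^'n. norm (z - y) < d \<longrightarrow> onorm (\<lambda>k. bump_grad \<delta> z \<bullet> k - bump_grad \<delta> y \<bullet> k) \<le> e"
        using d(1) by blast
    qed
    moreover have "conv \<kappa> (\<lambda>y. bump_grad \<delta> y \<bullet> k) x = conv \<kappa> (bump_grad \<delta>) x \<bullet> k" for k
      by (rule conv_bounded_linear[OF \<kappa> continuous_bump_grad bounded_linear_inner_left])
    ultimately show ?thesis by simp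
  qed
  have d2: "(conv \<kappa> (bump_grad \<delta>) has_derivative (\<lambda>k. conv \<kappa> (bump_hess \<delta>) x *v k)) (at x)" for x
  proof -
    have "(conv \<kappa> (bump_grad \<delta>) has_derivative (\<lambda>k. conv \<kappa> (\<lambda>y. bump_hess \<delta> y *v k) x)) (at x)"
    proof (rule conv_has_derivative[OF \<kappa> continuous_bump_grad has_derivative_bump_grad])
      show "continuous_on UNIV (\<lambda>y. bump_hess \<delta> y *v k)" for k :: "real^'n"
        by (rule bounded_linear.continuous_on[OF blm continuous_bump_hess])
      fix e :: real assume "0 < e"
      then obtain d where d: "0 < d" "\<And>y z. dist z y < d \<Longrightarrow> dist (bump_hess \<delta> z) (bump_hess \<delta> y :: real^'n^'n) < e"
        using uH unfolding uniformly_continuous_on_def by (metis UNIV_I)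
      have "onorm (\<lambda>k. bump_hess \<delta> z *v k - bump_hess \<delta> y *v k) \<le> e" if "norm (z - y) < d" for y z :: "real^'n"
      proof (rule onorm_le)
        fix k
        have "norm (bump_hess \<delta> z *v k - bump_hess \<delta> y *v k) \<le> norm (bump_hess \<delta> z - bump_hess \<delta> y) * norm k"
          unfolding matrix_vector_mult_diff_rdistrib[symmetric] by (rule norm_matrix_vector_le)
        also have "\<dots> \<le> e * norm k"
          using d(2)[of z y] that by (intro mult_right_mono) (auto simp: dist_norm)
        finally show "norm (bump_hess \<delta> z *v k - bump_hess \<delta> y *v k) \<le> e * norm k" .
      qed
      then show "\<exists>d>0. \<forall>y z :: real^'n. norm (z - y) < d \<longrightarrow> onorm (\<lambda>k. bump_hess \<delta> z *v k - bump_hess \<delta> y *v k) \<le> e"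
        using d(1) by blast
    qed
    moreover have "conv \<kappa> (\<lambda>y. bump_hess \<delta> y *v k) x = conv \<kappa> (bump_hess \<delta>) x *v k" for k
      by (rule conv_bounded_linear[OF \<kappa> continuous_bump_hess blm])
    ultimately show ?thesis by simp
  qed
  let ?D = "\<lambda>x. (1 / c) *\<^sub>R conv \<kappa> (bump_grad \<delta>) x"
  let ?H = "\<lambda>x. (1 / c) *\<^sub>R conv \<kappa> (bump_hess \<delta>) x"
  show thesis
  proof (rule that[of ?D ?H])
    have "continuous_on UNIV ?H"
      by (intro continuous_on_scaleR continuous_on_const conv_continuous \<kappa> uH)
    moreover have "(mollify \<delta> \<kappa> has_derivative (\<lambda>k. ?D x \<bullet> k)) (at x)" for x
      unfolding mol inner_scaleR_left real_scaleR_def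
      by (rule has_derivative_mult_right[OF d1])
    moreover have "(?D has_derivative (\<lambda>k. ?H x *v k)) (at x)" for x
      unfolding scaleR_matrix_vector_assoc[symmetric]
      by (rule has_derivative_scaleR_right[OF d2])
    ultimately show "is_C2 (mollify \<delta> \<kappa>) ?D ?H UNIV"
      by (simp add: is_C2_def)
    show "bounded_support ?H"
      using conv_bounded_support[OF \<kappa>(2) bounded_support_bump_hess[of \<delta>]]
      by (auto simp: bounded_support_def)
    show "bounded_support (mollify \<delta> \<kappa>)"
      unfolding mol using conv_bounded_support[OF \<kappa>(2) bounded_support_bump[of \<delta>]]
      by (auto simp: bounded_support_def)
    have blt: "bounded_linear (transpose :: real^'n^'n \<Rightarrow> real^'n^'n)"
      by (rule linear_conv_bounded_linear[THEN iffD1], rule linearI)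
        (simp_all add: transpose_def vec_eq_iff)
    have "bump_hess \<delta> z \<in> Sym" for z :: "real^'n"
      unfolding bump_hess_def by (intro Sym_add Sym_scaleR outer_Sym Sym_mat)
    then have "(\<lambda>y. transpose (bump_hess \<delta> y)) = (bump_hess \<delta> :: real^'n \<Rightarrow> real^'n^'n)"
      by (auto simp: Sym_def)
    then have "transpose (conv \<kappa> (bump_hess \<delta>) x) = conv \<kappa> (bump_hess \<delta>) x" for x
      using conv_bounded_linear[OF \<kappa> continuous_bump_hess[of \<delta>] blt, of x] by simp
    then show "?H x \<in> Sym" for x
      by (intro Sym_scaleR) (simp add: Sym_def)
  qed
qed

text \<open>Mollification acts in two places: radius \<open>\<delta>\<close> gives the function
  whose Hessian is tested, and a second radius depending on \<open>\<epsilon>\<close> gives smooth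
  initial data near \<open>\<kappa>\<close>. The discrete inequality is transferred because
  averaging preserves order and constants and commutes with the walk.\<close>

lemma mollify_qtr_ge:
  fixes \<kappa> :: "real^'n \<Rightarrow> real"
  assumes \<kappa>: "continuous_on UNIV \<kappa>" "bounded_support \<kappa>" and \<delta>: "0 < \<delta>"
    and jets: "\<And>x r A. (r, A) \<in> Jplus UNIV \<kappa> x \<Longrightarrow> b \<le> qtr T A"
    and C2: "is_C2 (mollify \<delta> \<kappa>) D H UNIV" and H: "bounded_support H"
  shows "b \<le> qtr T (H x)"
proof -
  have cH: "continuous_on UNIV H" using C2 by (simp add: is_C2_def)
  obtain K where K: "\<And>y. norm (H y) \<le> K" using bounded_support_bounded[OF cH H] by blast
  show ?thesis
  proof (rule qtr_ge_of_jets[OF \<kappa> _ _ C2 bounded_support_uniformly_continuous[OF cH H] K])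
    fix \<epsilon> :: real assume \<epsilon>: "0 < \<epsilon>"
    obtain d where d: "0 < d" "\<And>y z. dist z y < d \<Longrightarrow> dist (\<kappa> z) (\<kappa> y) < \<epsilon>"
      using bounded_support_uniformly_continuous[OF \<kappa>] \<epsilon> unfolding uniformly_continuous_on_def
      by (metis UNIV_I)
    obtain D' H' where f: "is_C2 (mollify (d/2) \<kappa>) D' H' UNIV" "bounded_support H'"
      "bounded_support (mollify (d/2) \<kappa>)"
      using mollify_C2[OF \<kappa>] by metis
    have "\<bar>mollify (d/2) \<kappa> x - \<kappa> x\<bar> \<le> \<epsilon>" for x
    proof (rule mollify_close[OF \<kappa>(1)])
      show "\<bar>\<kappa> (x - z) - \<kappa> x\<bar> \<le> \<epsilon>" if "norm z \<le> d/2" for z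
        using d(2)[of "x - z" x] that d(1) by (simp add: dist_norm)
    qed (use d in simp)
    moreover have "uniformly_continuous_on UNIV H'"
      using f by (intro bounded_support_uniformly_continuous) (simp_all add: is_C2_def)
    ultimately show "\<exists>f D H. is_C2 f D H UNIV \<and> bounded_support f \<and>
        uniformly_continuous_on UNIV H \<and> (\<forall>x. \<bar>f x - \<kappa> x\<bar> \<le> \<epsilon>)"
      using f by blast
  next
    fix s c and n :: nat
    assume "\<And>x. \<kappa> x \<le> (walk T s ^^ n) \<kappa> x + c"
    then have "mollify \<delta> \<kappa> x \<le> mollify \<delta> (\<lambda>y. (walk T s ^^ n) \<kappa> y + c) x"
      by (intro mollify_mono \<kappa> \<delta> continuous_intros mollify_walk_iter)
    then show "mollify \<delta> \<kappa> x \<le> (walk T s ^^ n) (mollify \<delta> \<kappa>) x + c"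
      by (simp add: mollify_add mollify_walk_iter[OF \<kappa>(1)] mollify_const[OF \<delta>])
  qed (rule jets)
qed

section \<open>Test functions and semicontinuity\<close>

lemma is_C2_add:
  "is_C2 f D H U \<Longrightarrow> is_C2 f' D' H' U' \<Longrightarrow> is_C2 (\<lambda>y. f y + f' y) (\<lambda>y. D y + D' y) (\<lambda>y. H y + H' y) (U \<inter> U')"
  unfolding is_C2_def inner_add_left matrix_vector_mult_add_rdistrib
  by (auto intro!: has_derivative_add continuous_on_add intro: continuous_on_subset)

lemma is_C2_mult: "is_C2 f D H U \<Longrightarrow> is_C2 (\<lambda>y. c * f y) (\<lambda>y. c *\<^sub>R D y) (\<lambda>y. c *\<^sub>R H y) U"
  unfolding is_C2_def inner_scaleR_left scaleR_matrix_vector_assoc[symmetric]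
  by (auto intro!: has_derivative_mult_right has_derivative_scaleR_right continuous_on_scaleR continuous_on_const)

lemma is_C2_const: "is_C2 (\<lambda>_. c) (\<lambda>_. 0) (\<lambda>_. 0) UNIV"
  by (simp add: is_C2_def)

lemma is_C2_inner: "is_C2 (\<lambda>y. e \<bullet> (y - a)) (\<lambda>_. e) (\<lambda>_. 0) UNIV"
  by (auto simp: is_C2_def intro!: derivative_eq_intros)

lemma is_C2_sqdist: "is_C2 (\<lambda>y. (y - a) \<bullet> (y - a)) (\<lambda>y. 2 *\<^sub>R (y - a)) (\<lambda>_. mat 2) UNIV"
  by (auto simp: is_C2_def inner_commute intro!: derivative_eq_intros)

lemma is_C2_inner_sq: "is_C2 (\<lambda>y. (e \<bullet> (y - a))\<^sup>2) (\<lambda>y. (2 * (e \<bullet> (y - a))) *\<^sub>R e) (\<lambda>_. 2 *\<^sub>R outer e) UNIV"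
  by (auto simp: is_C2_def outer_mult scaleR_matrix_vector_assoc[symmetric]
      intro!: derivative_eq_intros)

lemma is_C2_subset: "is_C2 f D H U \<Longrightarrow> open V \<Longrightarrow> V \<subseteq> U \<Longrightarrow> is_C2 f D H V"
  by (auto simp: is_C2_def intro: continuous_on_subset)

lemma is_C2_continuous: "is_C2 f D H U \<Longrightarrow> continuous_on U f"
  by (rule has_derivative_continuous_on[where f' = "\<lambda>y k. D y \<bullet> k"])
    (auto simp: is_C2_def intro: has_derivative_at_withinI)

text \<open>Touching up to an additive constant suffices, because a constant changes neither
  gradient nor Hessian; a maximum of \<open>u - \<phi>\<close> on an open set thus yields a jet
  directly.\<close>

lemma JplusI:
  assumes C2: "is_C2 \<phi> D H U" and "x \<in> U" "U \<subseteq> \<Omega>" and le: "\<And>y. y \<in> U \<Longrightarrow> u y - \<phi> y \<le> u x - \<phi> x"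
  shows "(u x, H x) \<in> Jplus \<Omega> u x"
proof -
  have "is_C2 (\<lambda>y. \<phi> y + (u x - \<phi> x)) D H U"
    using is_C2_add[OF C2 is_C2_const[of "u x - \<phi> x"]] by simp
  then have "C2_hess (\<lambda>y. \<phi> y + (u x - \<phi> x)) U H" by (auto simp: C2_hess_iff)
  then show ?thesis
    using assms unfolding Jplus_def
    by (auto intro!: exI[of _ "\<lambda>y. \<phi> y + (u x - \<phi> x)"] exI[of _ U] exI[of _ H] simp: algebra_simps)
qed

lemma JminusI:
  assumes C2: "is_C2 \<phi> D H U" and "x \<in> U" "U \<subseteq> \<Omega>" and ge: "\<And>y. y \<in> U \<Longrightarrow> \<phi> y - v y \<le> \<phi> x - v x"
  shows "(v x, H x) \<in> Jminus \<Omega> v x"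
proof -
  have "is_C2 (\<lambda>y. \<phi> y + (v x - \<phi> x)) D H U"
    using is_C2_add[OF C2 is_C2_const[of "v x - \<phi> x"]] by simp
  then have "C2_hess (\<lambda>y. \<phi> y + (v x - \<phi> x)) U H" by (auto simp: C2_hess_iff)
  then show ?thesis
    using assms unfolding Jminus_def
    by (auto intro!: exI[of _ "\<lambda>y. \<phi> y + (v x - \<phi> x)"] exI[of _ U] exI[of _ H] simp: algebra_simps)
qed

lemma second_derivative_test:
  assumes C2: "is_C2 \<phi> D H U" and x: "x \<in> U" and mn: "\<And>y. y \<in> U \<Longrightarrow> \<phi> x \<le> \<phi> y"
  shows "0 \<le> t \<bullet> (H x *v t)"
proof (rule ccontr)
  define q where "q = t \<bullet> (H x *v t)"
  assume "\<not> 0 \<le> t \<bullet> (H x *v t)"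
  then have q: "q < 0" by (simp add: q_def)
  have opU: "open U" and cH: "continuous_on U H" using C2 by (auto simp: is_C2_def)
  have "continuous_on U (\<lambda>y. t \<bullet> (H y *v t))"
    by (intro continuous_intros bounded_linear.continuous_on[OF _ cH]
        linear_conv_bounded_linear[THEN iffD1] linearI)
      (simp_all add: matrix_vector_mult_add_rdistrib scaleR_matrix_vector_assoc)
  then obtain d1 where d1: "0 < d1" "\<And>y. y \<in> U \<Longrightarrow> dist y x < d1 \<Longrightarrow> dist (t \<bullet> (H y *v t)) q < - q / 2"
    using x q unfolding continuous_on_iff q_def by (metis neg_0_less_iff_less half_gt_zero)
  obtain d2 where d2: "0 < d2" "ball x d2 \<subseteq> U" using opU x open_contains_ball by blast
  define s where "s = min d1 d2 / 2 / (norm t + 1)"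
  have s: "0 < s" using d1 d2 by (simp add: s_def add_nonneg_pos)
  have small: "norm (r *\<^sub>R t) < d1" "norm (r *\<^sub>R t) < d2" if "\<bar>r\<bar> \<le> s" for r
  proof -
    have "norm (r *\<^sub>R t) \<le> s * (norm t + 1)" using that s by (auto intro!: mult_mono)
    also have "\<dots> = min d1 d2 / 2"
    proof -
      have "norm t + 1 \<noteq> 0" using norm_ge_zero[of t] by linarith
      then show ?thesis using s_def by (metis nonzero_eq_divide_eq)
    qed
    also have "\<dots> < min d1 d2" using d1 d2 by (simp add: min_def)
    finally show "norm (r *\<^sub>R t) < d1" "norm (r *\<^sub>R t) < d2" by auto
  qed
  have inU: "x + r *\<^sub>R t \<in> U" if "\<bar>r\<bar> \<le> s" for r
    using small(2)[OF that] d2 by (intro subsetD[OF d2(2)]) (simp add: dist_norm)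
  have "\<bar>\<phi> (x + s *\<^sub>R t) + \<phi> (x - s *\<^sub>R t) - 2 * \<phi> x - s\<^sup>2 * (t \<bullet> (H x *v t))\<bar> \<le> s\<^sup>2 * (- q / 2)"
  proof (rule second_difference_bound[OF C2 s inU])
    fix r :: real assume r: "\<bar>r\<bar> \<le> s"
    show "\<bar>t \<bullet> (H (x + r *\<^sub>R t) *v t) - t \<bullet> (H x *v t)\<bar> \<le> - q / 2"
      using d1(2)[OF inU[OF r]] small(1)[OF r] by (simp add: dist_norm q_def)
  qed
  then have "\<phi> (x + s *\<^sub>R t) + \<phi> (x - s *\<^sub>R t) - 2 * \<phi> x \<le> s\<^sup>2 * (q / 2)"
    by (simp add: q_def[symmetric] abs_le_iff algebra_simps)
  moreover have "0 \<le> \<phi> (x + s *\<^sub>R t) + \<phi> (x - s *\<^sub>R t) - 2 * \<phi> x"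
    using mn[OF inU[of s]] mn[OF inU[of "-s"]] s by simp
  moreover have "s\<^sup>2 * (q / 2) < 0" using s q by (intro mult_pos_neg) auto
  ultimately show False by linarith
qed

section \<open>Semicontinuous functions on compact sets\<close>

lemma usc_on_subset: "usc_on S u \<Longrightarrow> S' \<subseteq> S \<Longrightarrow> usc_on S' u"
  unfolding usc_on_def by (meson subsetD)

lemma usc_on_add:
  assumes "usc_on S u" "usc_on S w" shows "usc_on S (\<lambda>x. u x + w x)"
  unfolding usc_on_def
proof (intro ballI allI impI)
  fix x t assume x: "x \<in> S" and t: "u x + w x < t"
  define e where "e = (t - u x - w x) / 2"
  have e: "0 < e" using t by (simp add: e_def)
  obtain d1 where d1: "0 < d1" "\<And>y. y \<in> S \<Longrightarrow> dist y x < d1 \<Longrightarrow> u y < u x + e"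
    using assms(1) x e unfolding usc_on_def by (meson less_add_same_cancel1)
  obtain d2 where d2: "0 < d2" "\<And>y. y \<in> S \<Longrightarrow> dist y x < d2 \<Longrightarrow> w y < w x + e"
    using assms(2) x e unfolding usc_on_def by (meson less_add_same_cancel1)
  have sum: "u x + e + (w x + e) = t" by (simp add: e_def field_simps)
  have "u y + w y < t" if "y \<in> S" "dist y x < min d1 d2" for y
    using d1(2)[of y] d2(2)[of y] that sum by simp
  then show "\<exists>e>0. \<forall>y\<in>S. dist y x < e \<longrightarrow> u y + w y < t"
    using d1(1) d2(1) by (intro exI[of _ "min d1 d2"]) auto
qed

lemma continuous_imp_usc: assumes "continuous_on S f" shows "usc_on S f"
  unfolding usc_on_def
proof (intro ballI allI impI)
  fix x t assume x: "x \<in> S" and t: "f x < t"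
  then obtain d where d: "0 < d" "\<And>y. y \<in> S \<Longrightarrow> dist y x < d \<Longrightarrow> dist (f y) (f x) < t - f x"
    using assms unfolding continuous_on_iff by (meson diff_gt_0_iff_gt)
  have "f y < t" if "y \<in> S" "dist y x < d" for y
    using d(2)[OF that] by (simp add: dist_real_def)
  then show "\<exists>e>0. \<forall>y\<in>S. dist y x < e \<longrightarrow> f y < t" using d(1) by blast
qed

lemma lsc_imp_usc_uminus: assumes "lsc_on S v" shows "usc_on S (\<lambda>x. - v x)"
  unfolding usc_on_def
proof (intro ballI allI impI)
  fix x t assume "x \<in> S" "- v x < t"
  then have "- t < v x" by simp
  then obtain e where "0 < e" "\<And>y. y \<in> S \<Longrightarrow> dist y x < e \<Longrightarrow> - t < v y"
    using assms \<open>x \<in> S\<close> unfolding lsc_on_def by meson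
  then show "\<exists>e>0. \<forall>y\<in>S. dist y x < e \<longrightarrow> - v y < t" by (intro exI[of _ e]) force
qed

text \<open>If every \<open>x\<close> were beaten by some \<open>f x\<close>, it would be beaten
  together with a neighbourhood. By compactness finitely many values \<open>u (f x)\<close> beat all
  of \<open>S\<close>, yet the largest of them is itself attained in \<open>S\<close>.\<close>

lemma usc_attains_sup:
  assumes S: "compact S" "S \<noteq> {}" and u: "usc_on S u"
  shows "\<exists>x\<in>S. \<forall>y\<in>S. u y \<le> u x"
proof (rule ccontr)
  assume "\<not> ?thesis"
  then have "\<forall>x\<in>S. \<exists>y\<in>S. u x < u y" by (meson not_le)
  then obtain f where f: "\<And>x. x \<in> S \<Longrightarrow> f x \<in> S" "\<And>x. x \<in> S \<Longrightarrow> u x < u (f x)" by metis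
  then have "\<forall>x\<in>S. \<exists>e>0. \<forall>y\<in>S. dist y x < e \<longrightarrow> u y < u (f x)"
    using u unfolding usc_on_def by blast
  then obtain e where e: "\<And>x. x \<in> S \<Longrightarrow> 0 < e x"
    "\<And>x y. x \<in> S \<Longrightarrow> y \<in> S \<Longrightarrow> dist y x < e x \<Longrightarrow> u y < u (f x)" by metis
  have "S \<subseteq> (\<Union>x\<in>S. ball x (e x))" using e(1) by force
  then obtain F where F: "F \<subseteq> S" "finite F" "S \<subseteq> (\<Union>x\<in>F. ball x (e x))"
    using compactE_image[OF S(1), of S "\<lambda>x. ball x (e x)"] by auto
  have "F \<noteq> {}" using F S(2) by auto
  define m where "m = Max ((\<lambda>x. u (f x)) ` F)"
  have "m \<in> (\<lambda>x. u (f x)) ` F" unfolding m_def using F \<open>F \<noteq> {}\<close> by (intro Max_in) auto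
  then obtain x where x: "x \<in> F" "m = u (f x)" by blast
  then have "f x \<in> S" using f F by blast
  then obtain y where y: "y \<in> F" "f x \<in> ball y (e y)" using F by blast
  then have "u (f x) < u (f y)" using e(2)[of y "f x"] F \<open>f x \<in> S\<close> by (auto simp: dist_commute)
  moreover have "u (f y) \<le> m" unfolding m_def using F y by (intro Max_ge) auto
  ultimately show False using x by simp
qed

text \<open>If convexity fails along \<open>[a, b]\<close>, a paraboloid that is very steep across the segment touches \<open>u\<close> from
  above inside a thin tube around it and has a too negative second derivative in the direction \<open>b - a\<close>.\<close>

lemma viscosity_semiconvex:
  fixes u :: "real^'n \<Rightarrow> real"
  assumes sub: "ball x0 \<rho> \<subseteq> \<Omega>" and usc: "usc_on (ball x0 \<rho>) u"
    and jets: "\<And>y r A e. y \<in> ball x0 \<rho> \<Longrightarrow> (r, A) \<in> Jplus \<Omega> u y \<Longrightarrow> - C * (e \<bullet> e) \<le> e \<bullet> (A *v e)"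
  shows "convex_on (ball x0 \<rho>) (\<lambda>y. u y + (C + 1) / 2 * (y \<bullet> y))"
proof (rule convex_onI)
  fix t :: real and a b assume t: "0 < t" "t < 1" and ab: "a \<in> ball x0 \<rho>" "b \<in> ball x0 \<rho>"
  define w where "w y = u y + (C + 1) / 2 * (y \<bullet> y)" for y
  define c where "c = (1 - t) *\<^sub>R a + t *\<^sub>R b"
  show "u ((1 - t) *\<^sub>R a + t *\<^sub>R b) + (C + 1) / 2 * (((1 - t) *\<^sub>R a + t *\<^sub>R b) \<bullet> ((1 - t) *\<^sub>R a + t *\<^sub>R b))
      \<le> (1 - t) * (u a + (C + 1) / 2 * (a \<bullet> a)) + t * (u b + (C + 1) / 2 * (b \<bullet> b))"
    unfolding w_def[symmetric] c_def[symmetric]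
  proof (rule ccontr)
    assume "\<not> w c \<le> (1 - t) * w a + t * w b"
    then have gt: "(1 - t) * w a + t * w b < w c" by simp
    define e where "e = b - a"
    have "a \<noteq> b"
    proof
      assume "a = b"
      then have "c = a" by (simp add: c_def algebra_simps)
      then show False using gt \<open>a = b\<close> by (simp add: algebra_simps)
    qed
    then have ee: "0 < e \<bullet> e" by (simp add: e_def)
    have c: "c - a = t *\<^sub>R e" by (simp add: c_def e_def algebra_simps)
    \<comment> \<open>The affine interpolation of \<open>w\<close> between \<open>a\<close> and
      \<open>b\<close>, constant across the segment; subtracting it reduces the failure of convexity
      to a positive value of \<open>W\<close> at \<open>c\<close> with zeros at both ends.\<close>
    define l where "l y = w a + (w b - w a) / (e \<bullet> e) * (e \<bullet> (y - a))" for y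
    \<comment> \<open>The squared distance from \<open>y\<close> to the line through
      \<open>a\<close> and \<open>b\<close>. As a penalty it leaves second derivatives in the
      direction \<open>e\<close> untouched.\<close>
    define p where "p y = (y - a) \<bullet> (y - a) + - (1 / (e \<bullet> e)) * (e \<bullet> (y - a))\<^sup>2" for y
    define W where "W y = w y - l y" for y
    have Wa: "W a = 0" and Wb: "W b = 0"
      using ee by (simp_all add: W_def l_def e_def[symmetric])
    define \<gamma> where "\<gamma> = W c"
    have "l c = w a + (w b - w a) * t" using ee by (simp add: l_def c)
    then have \<gamma>: "0 < \<gamma>" using gt by (simp add: \<gamma>_def W_def algebra_simps)
    have pc: "p c = 0" using ee by (simp add: p_def c power2_eq_square)
    have p_eq: "p y = (norm (y - (a + ((e \<bullet> (y - a)) / (e \<bullet> e)) *\<^sub>R e)))\<^sup>2" for y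
    proof -
      define k where "k = (e \<bullet> (y - a)) / (e \<bullet> e)"
      have k: "e \<bullet> (y - a) = k * (e \<bullet> e)" using ee by (simp add: k_def)
      have "(norm (v - k *\<^sub>R e))\<^sup>2 = v \<bullet> v - 2 * k * (e \<bullet> v) + k\<^sup>2 * (e \<bullet> e)" for v
        unfolding power2_norm_eq_inner
        by (simp add: inner_diff_left inner_diff_right inner_commute[of v e] power2_eq_square algebra_simps)
      from this[of "y - a"]
      have "(norm (y - a - k *\<^sub>R e))\<^sup>2 = (y - a) \<bullet> (y - a) - k * k * (e \<bullet> e)"
        unfolding k by (simp add: power2_eq_square)
      also have "\<dots> = p y"
        unfolding p_def k using ee by (simp add: power2_eq_square)
      finally show ?thesis by (simp add: k_def algebra_simps)
    qed
    have p_nonneg: "0 \<le> p y" for y by (simp add: p_eq)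
    have cont_p: "continuous_on UNIV p" unfolding p_def by (intro continuous_intros)
    have cont_e: "continuous_on UNIV (\<lambda>y. e \<bullet> (y - a))" by (intro continuous_intros)
    have uscW: "usc_on (ball x0 \<rho>) W"
    proof -
      have "usc_on (ball x0 \<rho>) (\<lambda>y. u y + ((C + 1) / 2 * (y \<bullet> y) - l y))"
        using ee by (intro usc_on_add usc continuous_imp_usc) (auto simp: l_def intro!: continuous_intros)
      moreover have "(\<lambda>y. u y + ((C + 1) / 2 * (y \<bullet> y) - l y)) = W"
        by (simp add: W_def w_def fun_eq_iff)
      ultimately show ?thesis by simp
    qed
    obtain da where da: "0 < da" "\<And>y. y \<in> ball x0 \<rho> \<Longrightarrow> dist y a < da \<Longrightarrow> W y < \<gamma>"
      using uscW ab Wa \<gamma> unfolding usc_on_def by metis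
    obtain db where db: "0 < db" "\<And>y. y \<in> ball x0 \<rho> \<Longrightarrow> dist y b < db \<Longrightarrow> W y < \<gamma>"
      using uscW ab Wb \<gamma> unfolding usc_on_def by metis
    define R where "R = max (dist x0 a) (dist x0 b)"
    have R: "R < \<rho>" using ab by (simp add: R_def)
    \<comment> \<open>The tube of this radius stays inside the ball, and on its two end caps upper
      semicontinuity at \<open>a\<close> and \<open>b\<close> keeps \<open>W\<close> below
      \<open>\<gamma>\<close>.\<close>
    define d where "d = min (\<rho> - R) (min da db) / 2"
    have d: "0 < d" "d < \<rho> - R" "d < da" "d < db" using da db R by (auto simp: d_def min_def)
    define Tube where "Tube = {y. 0 \<le> e \<bullet> (y - a) \<and> e \<bullet> (y - a) \<le> e \<bullet> e \<and> p y \<le> d\<^sup>2}"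
    have Tube_ball: "y \<in> ball x0 \<rho>" if "y \<in> Tube" for y
    proof -
      define k where "k = (e \<bullet> (y - a)) / (e \<bullet> e)"
      have k: "0 \<le> k" "k \<le> 1" using that ee by (auto simp: k_def Tube_def)
      have "(norm (y - (a + k *\<^sub>R e)))\<^sup>2 \<le> d\<^sup>2" using that p_eq[of y] by (simp add: Tube_def k_def)
      then have "norm (y - (a + k *\<^sub>R e)) \<le> d" by (rule power2_le_imp_le[OF _ less_imp_le[OF d(1)]])
      then have 1: "dist (a + k *\<^sub>R e) y \<le> d" by (simp only: dist_norm norm_minus_commute)
      have "a + k *\<^sub>R e = (1 - k) *\<^sub>R a + k *\<^sub>R b" by (simp add: e_def algebra_simps)
      moreover have "(1 - k) *\<^sub>R a + k *\<^sub>R b \<in> cball x0 R"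
        using k by (intro convexD_alt[OF convex_cball]) (auto simp: R_def)
      ultimately have "dist x0 (a + k *\<^sub>R e) \<le> R" by simp
      then have "dist x0 y < \<rho>" using 1 d(2) dist_triangle[of x0 y "a + k *\<^sub>R e"] by linarith
      then show ?thesis by simp
    qed
    have "closed Tube"
      unfolding Tube_def by (intro closed_Collect_conj closed_Collect_le continuous_on_const cont_p cont_e)
    moreover have "bounded Tube" using Tube_ball bounded_subset[OF bounded_ball[of x0 \<rho>]] by blast
    ultimately have compT: "compact Tube" by (simp add: compact_eq_bounded_closed)
    have cT: "c \<in> Tube" using t ee by (simp add: Tube_def c pc mult_left_le_one_le)
    then have neT: "Tube \<noteq> {}" by blast
    have uscT: "usc_on Tube W" using uscW Tube_ball by (intro usc_on_subset[OF uscW]) auto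
    obtain z0 where z0: "\<And>y. y \<in> Tube \<Longrightarrow> W y \<le> W z0" using usc_attains_sup[OF compT neT uscT] by blast
    \<comment> \<open>On the lateral boundary the penalty then cancels the largest value of
      \<open>W\<close> on the tube, so the maximum point cannot lie there.\<close>
    define K where "K = \<bar>W z0\<bar> / d\<^sup>2"
    have K: "0 \<le> K" "K * d\<^sup>2 = \<bar>W z0\<bar>" using d(1) by (simp_all add: K_def)
    have "usc_on Tube (\<lambda>y. W y + (- K * p y))"
      by (intro usc_on_add uscT continuous_imp_usc continuous_intros continuous_on_subset[OF cont_p]) auto
    from usc_attains_sup[OF compT neT this]
    obtain z where z: "z \<in> Tube" and zmax: "\<And>y. y \<in> Tube \<Longrightarrow> W y - K * p y \<le> W z - K * p z" by auto
    have Kp: "0 \<le> K * p z" using K p_nonneg by simp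
    have \<gamma>z: "\<gamma> \<le> W z - K * p z" using zmax[OF cT] by (simp add: pc \<gamma>_def)
    have 1: "p z < d\<^sup>2"
    proof (rule ccontr)
      assume "\<not> p z < d\<^sup>2"
      then have "p z = d\<^sup>2" using z by (simp add: Tube_def)
      then have "W z - K * p z \<le> 0" using z0[OF z] K(2) by simp
      then show False using \<gamma>z \<gamma> by simp
    qed
    have dist_small: "dist z q < r" if "(norm (z - q))\<^sup>2 \<le> p z" "d < r" for q r
    proof -
      have "(norm (z - q))\<^sup>2 \<le> d\<^sup>2" using that 1 by linarith
      then have "norm (z - q) \<le> d" by (rule power2_le_imp_le[OF _ less_imp_le[OF d(1)]])
      then show ?thesis using that by (simp add: dist_norm)
    qed
    have 2: "0 < e \<bullet> (z - a)"
    proof (rule ccontr)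
      assume "\<not> 0 < e \<bullet> (z - a)"
      then have "e \<bullet> (z - a) = 0" using z by (simp add: Tube_def)
      then have "p z = (norm (z - a))\<^sup>2" by (simp add: p_eq)
      then have "W z < \<gamma>" using da(2)[OF Tube_ball[OF z]] dist_small[of a da] d by simp
      then show False using \<gamma>z Kp by linarith
    qed
    have 3: "e \<bullet> (z - a) < e \<bullet> e"
    proof (rule ccontr)
      assume "\<not> e \<bullet> (z - a) < e \<bullet> e"
      then have "e \<bullet> (z - a) = e \<bullet> e" using z by (simp add: Tube_def)
      then have "p z = (norm (z - b))\<^sup>2" using ee by (simp add: p_eq) (simp add: e_def)
      then have "W z < \<gamma>" using db(2)[OF Tube_ball[OF z]] dist_small[of b db] d by simp
      then show False using \<gamma>z Kp by linarith
    qed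
    define U where "U = {y. 0 < e \<bullet> (y - a) \<and> e \<bullet> (y - a) < e \<bullet> e \<and> p y < d\<^sup>2}"
    have opU: "open U"
      unfolding U_def by (intro open_Collect_conj open_Collect_less continuous_on_const cont_p cont_e)
    have UT: "y \<in> Tube" if "y \<in> U" for y using that by (auto simp: U_def Tube_def)
    have zU: "z \<in> U" using 1 2 3 by (simp add: U_def)
    define \<phi> where "\<phi> y = (w a + (w b - w a) / (e \<bullet> e) * (e \<bullet> (y - a))) + (- (C + 1) / 2 * ((y - 0) \<bullet> (y - 0)) + K * p y)" for y
    have "\<exists>D. is_C2 \<phi> D (\<lambda>_. (- (C + 1) / 2) *\<^sub>R mat 2 + K *\<^sub>R (mat 2 + (- (1 / (e \<bullet> e))) *\<^sub>R (2 *\<^sub>R outer e))) UNIV"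
      unfolding \<phi>_def p_def
      by (rule exI, rule is_C2_add[OF is_C2_add[OF is_C2_const is_C2_mult[OF is_C2_inner]]
          is_C2_add[OF is_C2_mult[OF is_C2_sqdist] is_C2_mult[OF is_C2_add[OF is_C2_sqdist is_C2_mult[OF is_C2_inner_sq]]]],
          unfolded scaleR_zero_right add_0_left Int_absorb])
    then obtain D where D: "is_C2 \<phi> D (\<lambda>_. (- (C + 1) / 2) *\<^sub>R mat 2 + K *\<^sub>R (mat 2 + (- (1 / (e \<bullet> e))) *\<^sub>R (2 *\<^sub>R outer e))) UNIV"
      by blast
    let ?H = "(- (C + 1) / 2) *\<^sub>R mat 2 + K *\<^sub>R (mat 2 + (- (1 / (e \<bullet> e))) *\<^sub>R (2 *\<^sub>R outer e)) :: real^'n^'n"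
    have u\<phi>: "u y - \<phi> y = W y - K * p y" for y
      by (simp add: \<phi>_def W_def w_def l_def field_simps)
    have "(u z, ?H) \<in> Jplus \<Omega> u z"
    proof (rule JplusI[OF is_C2_subset[OF D opU subset_UNIV] zU])
      show "U \<subseteq> \<Omega>" using UT Tube_ball sub by blast
      show "u y - \<phi> y \<le> u z - \<phi> z" if "y \<in> U" for y
        unfolding u\<phi> by (rule zmax[OF UT[OF that]])
    qed
    from jets[OF Tube_ball[OF z] this, of e] have "- C * (e \<bullet> e) \<le> e \<bullet> (?H *v e)" .
    \<comment> \<open>The contribution of the penalty annihilates \<open>e\<close>, however large
      \<open>K\<close> is. The extra 1 in \<open>C + 1\<close> makes the conflict with the lower
      bound \<open>- C\<close> strict.\<close>
    also have "?H *v e = - (C + 1) *\<^sub>R e"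
      using ee by (simp add: matrix_vector_mult_add_rdistrib scaleR_matrix_vector_assoc[symmetric] outer_mult
          matrix_vector_mult_diff_rdistrib)
    also have "e \<bullet> (- (C + 1) *\<^sub>R e) = - (C + 1) * (e \<bullet> e)" by simp
    finally show False using ee by (simp add: algebra_simps)
  qed
qed (rule convex_ball)

lemma Jplus_value: "(r, A) \<in> Jplus \<Omega> u y \<Longrightarrow> r = u y"
  by (auto simp: Jplus_def)

text \<open>A paraboloid that rises by the full oscillation \<open>\<eta>\<close> up to the sphere
  of radius \<open>\<rho>/2\<close> forces an interior maximum of the difference. Such a point is
  needed because the constraint \<open>m x - r \<ge> r0\<close> is known only where \<open>u\<close>
  has jets.\<close>

lemma jet_exists_in_ball:
  fixes u :: "real^'n \<Rightarrow> real"
  assumes \<rho>: "0 < \<rho>" "ball x0 \<rho> \<subseteq> \<Omega>" and cont: "continuous_on (ball x0 \<rho>) u"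
    and osc: "\<And>y. y \<in> ball x0 \<rho> \<Longrightarrow> \<bar>u y - u x0\<bar> < \<eta>"
  obtains y r A where "y \<in> ball x0 \<rho>" "(r, A) \<in> Jplus \<Omega> u y"
proof -
  let ?B = "cball x0 (\<rho>/2)"
  have B: "?B \<subseteq> ball x0 \<rho>" using \<rho> by auto
  have \<eta>: "0 < \<eta>" using osc[of x0] \<rho> by simp
  define K where "K = \<eta> / (\<rho>/2)\<^sup>2"
  have K: "K * (\<rho>/2)\<^sup>2 = \<eta>" using \<rho> by (simp add: K_def)
  define k where "k y = K * ((y - x0) \<bullet> (y - x0))" for y
  have "\<exists>x\<in>?B. \<forall>y\<in>?B. u y - k y \<le> u x - k x"
    unfolding k_def using \<rho>
    by (intro continuous_attains_sup continuous_intros continuous_on_subset[OF cont B]) auto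
  then obtain z where z: "z \<in> ?B" and zmax: "\<And>y. y \<in> ?B \<Longrightarrow> u y - k y \<le> u z - k z" by blast
  have "dist x0 z \<noteq> \<rho>/2"
  proof
    assume "dist x0 z = \<rho>/2"
    then have "norm (z - x0) = \<rho>/2" by (simp only: dist_norm norm_minus_commute)
    then have "k z = \<eta>" using K by (simp only: k_def dot_square_norm)
    moreover have "u x0 - k x0 \<le> u z - k z" using \<rho> by (intro zmax) simp
    moreover have "k x0 = 0" by (simp add: k_def)
    moreover have "\<bar>u z - u x0\<bar> < \<eta>" using z B by (intro osc) blast
    ultimately show False by linarith
  qed
  then have zb: "z \<in> ball x0 (\<rho>/2)" using z by simp
  have bb: "ball x0 (\<rho>/2) \<subseteq> ball x0 \<rho>" using \<rho> by (intro subset_ball) simp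
  have C2: "is_C2 k (\<lambda>y. K *\<^sub>R (2 *\<^sub>R (y - x0))) (\<lambda>_. K *\<^sub>R mat 2) (ball x0 (\<rho>/2))"
    unfolding k_def by (rule is_C2_subset[OF is_C2_mult[OF is_C2_sqdist]]) auto
  have "(u z, K *\<^sub>R mat 2) \<in> Jplus \<Omega> u z"
  proof (rule JplusI[OF C2 zb])
    show "ball x0 (\<rho>/2) \<subseteq> \<Omega>" using bb \<rho>(2) by (rule order_trans)
    show "u y - k y \<le> u z - k z" if "y \<in> ball x0 (\<rho>/2)" for y
      using that by (intro zmax) simp
  qed
  then show thesis using z B that by blast
qed

section \<open>Comparison principle\<close>

context monge_ampere begin

lemma subsolution_jet_\<Theta>:
  assumes "visc_sub \<Omega> (Fop g m M h) \<Phi> u" "y \<in> \<Omega>" "(r, A) \<in> Jplus \<Omega> u y"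
  shows "(r, A) \<in> \<Theta> y"
  using assms by (auto simp: visc_sub_def Fop_def \<Theta>_def)

text \<open>Upper semicontinuity controls \<open>u\<close> near \<open>x0\<close> only from above.
  The missing lower bound comes from the cone condition: frozen at \<open>x0\<close> it bounds the
  matrices of all jets from below, so \<open>u\<close> is semiconvex on a ball, and a convex
  function on an open ball is continuous.\<close>

lemma subsolution_locally_continuous:
  assumes x0: "x0 \<in> \<Omega>" and sub: "visc_sub \<Omega> (Fop g m M h) \<Phi> u" and \<eta>: "0 < \<eta>"
  obtains \<rho> where "0 < \<rho>" "ball x0 \<rho> \<subseteq> \<Omega>" "continuous_on (ball x0 \<rho>) u"
    "\<And>y. y \<in> ball x0 \<rho> \<Longrightarrow> \<bar>u y - u x0\<bar> < \<eta>"
    "\<And>y r A. y \<in> ball x0 \<rho> \<Longrightarrow> (r, A) \<in> Jplus \<Omega> u y \<Longrightarrow> (u y - \<eta>, A + mat \<eta>) \<in> \<Theta> x0"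
    "\<And>y r A. y \<in> ball x0 \<rho> \<Longrightarrow> (r, A) \<in> \<Theta> x0 \<Longrightarrow> (r - \<eta>, A + mat \<eta>) \<in> \<Theta> y"
proof -
  obtain \<delta> where \<delta>: "0 < \<delta>"
    and to: "\<And>y r A. y \<in> \<Omega> \<Longrightarrow> dist x0 y < \<delta> \<Longrightarrow> (r, A) \<in> \<Theta> x0 \<Longrightarrow> (r - \<eta>, A + mat \<eta>) \<in> \<Theta> y"
    and from': "\<And>y r A. y \<in> \<Omega> \<Longrightarrow> dist x0 y < \<delta> \<Longrightarrow> (r, A) \<in> \<Theta> y \<Longrightarrow> (r - \<eta>, A + mat \<eta>) \<in> \<Theta> x0"
    using \<Theta>_shift[OF x0 \<eta>] by metis
  obtain \<rho>0 where \<rho>0: "0 < \<rho>0" "ball x0 \<rho>0 \<subseteq> \<Omega>" using open_domain x0 open_contains_ball by blast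
  define \<rho> where "\<rho> = min \<delta> \<rho>0"
  have \<rho>: "0 < \<rho>" "ball x0 \<rho> \<subseteq> \<Omega>" using \<rho>0 \<delta> by (auto simp: \<rho>_def)
  have jet: "(u y - \<eta>, A + mat \<eta>) \<in> \<Theta> x0" if y: "y \<in> ball x0 \<rho>" and j: "(r, A) \<in> Jplus \<Omega> u y" for y r A
  proof -
    have "y \<in> \<Omega>" "dist x0 y < \<delta>" using y \<rho>(2) by (auto simp: \<rho>_def)
    then show ?thesis
      using from' subsolution_jet_\<Theta>[OF sub _ j] Jplus_value[OF j] by metis
  qed
  \<comment> \<open>Jets satisfy \<open>A \<ge> - (\<eta> I + M x0)\<close>, and this norm bounds
    the quadratic form of the right-hand side.\<close>
  define C where "C = norm (mat \<eta> + M x0)"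
  have low: "- C * (e \<bullet> e) \<le> e \<bullet> (A *v e)" if "y \<in> ball x0 \<rho>" "(r, A) \<in> Jplus \<Omega> u y" for y r A e
  proof -
    have "psd (A + mat \<eta> + M x0)" using jet[OF that] by (simp add: \<Theta>_iff)
    then have "0 \<le> e \<bullet> ((A + mat \<eta> + M x0) *v e)" by (simp add: psd_def)
    also have "\<dots> = e \<bullet> (A *v e) + e \<bullet> ((mat \<eta> + M x0) *v e)"
      by (simp only: matrix_vector_mult_add_rdistrib inner_add_right add.assoc)
    finally show ?thesis
      using abs_quadratic_form_le[of e "mat \<eta> + M x0"] by (simp add: C_def abs_le_iff)
  qed
  have "usc_on \<Omega> u" using sub unfolding visc_sub_def by (rule conjunct1)
  then have usc: "usc_on (ball x0 \<rho>) u" using \<rho>(2) by (rule usc_on_subset)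
  have "convex_on (ball x0 \<rho>) (\<lambda>y. u y + (C + 1) / 2 * (y \<bullet> y))"
    by (rule viscosity_semiconvex[OF \<rho>(2) usc]) (rule low)
  then have "continuous_on (ball x0 \<rho>) (\<lambda>y. u y + (C + 1) / 2 * (y \<bullet> y))"
    by (intro convex_on_continuous) auto
  then have "continuous_on (ball x0 \<rho>) (\<lambda>y. (u y + (C + 1) / 2 * (y \<bullet> y)) - (C + 1) / 2 * (y \<bullet> y))"
    by (rule continuous_on_diff) (intro continuous_intros)
  then have cont: "continuous_on (ball x0 \<rho>) u" by simp
  then obtain d where d: "0 < d" "\<And>y. y \<in> ball x0 \<rho> \<Longrightarrow> dist y x0 < d \<Longrightarrow> dist (u y) (u x0) < \<eta>"
    using \<rho>(1) \<eta> unfolding continuous_on_iff by (metis centre_in_ball)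
  have sub_ball: "ball x0 (min d \<rho>) \<subseteq> ball x0 \<rho>" by (intro subset_ball) simp
  show thesis
  proof (rule that[of "min d \<rho>"])
    show "0 < min d \<rho>" "ball x0 (min d \<rho>) \<subseteq> \<Omega>" using d(1) \<rho> sub_ball by auto
    show "continuous_on (ball x0 (min d \<rho>)) u" by (rule continuous_on_subset[OF cont sub_ball])
    fix y assume y: "y \<in> ball x0 (min d \<rho>)"
    show "\<bar>u y - u x0\<bar> < \<eta>" using d(2)[of y] y by (simp add: dist_commute dist_real_def)
    show "(u y - \<eta>, A + mat \<eta>) \<in> \<Theta> x0" if "(r, A) \<in> Jplus \<Omega> u y" for r A
      using jet[OF _ that] y by simp
    show "(r - \<eta>, A + mat \<eta>) \<in> \<Theta> y" if "(r, A) \<in> \<Theta> x0" for r A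
      using to[OF _ _ that] y \<rho>(2) by (auto simp: \<rho>_def)
  qed
qed

text \<open>The mollification takes place after replacing \<open>u\<close> by \<open>max u \<psi>\<close> with a paraboloid \<open>\<psi>\<close> that lies below \<open>u\<close>
  near \<open>x0\<close> and above it further out; \<open>\<kappa> = max u \<psi> - \<psi>\<close> then has compact support.\<close>

lemma smooth_subsolution:
  assumes x0: "x0 \<in> \<Omega>" and sub: "visc_sub \<Omega> (Fop g m M h) \<Phi> u" and \<eta>: "0 < \<eta>"
  obtains \<rho> where "0 < \<rho>" "cball x0 \<rho> \<subseteq> \<Omega>" "\<And>y. y \<in> cball x0 \<rho> \<Longrightarrow> \<bar>u y - u x0\<bar> < \<eta>"
    "\<And>\<tau>. 0 < \<tau> \<Longrightarrow> \<exists>f D H. is_C2 f D H UNIV \<and>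
        (\<forall>y\<in>cball x0 \<rho>. \<bar>f y - u y\<bar> \<le> \<tau> \<and> (u x0 - 4 * \<eta>, H y + mat (2 * \<eta>)) \<in> \<Theta> y)"
proof -
  obtain \<rho> where \<rho>: "0 < \<rho>" "ball x0 \<rho> \<subseteq> \<Omega>" and cont: "continuous_on (ball x0 \<rho>) u"
    and osc: "\<And>y. y \<in> ball x0 \<rho> \<Longrightarrow> \<bar>u y - u x0\<bar> < \<eta>"
    and jet: "\<And>y r A. y \<in> ball x0 \<rho> \<Longrightarrow> (r, A) \<in> Jplus \<Omega> u y \<Longrightarrow> (u y - \<eta>, A + mat \<eta>) \<in> \<Theta> x0"
    and to: "\<And>y r A. y \<in> ball x0 \<rho> \<Longrightarrow> (r, A) \<in> \<Theta> x0 \<Longrightarrow> (r - \<eta>, A + mat \<eta>) \<in> \<Theta> y"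
    using subsolution_locally_continuous[OF x0 sub \<eta>] by metis
  define M0 where "M0 = mat \<eta> + M x0"
  have M0: "M0 \<in> Sym" unfolding M0_def by (intro Sym_add Sym_mat M_Sym x0)
  define s0 where "s0 = m x0 - (u x0 - 3 * \<eta>)"
  have s0: "r0 < s0"
  proof -
    obtain y r A where y: "y \<in> ball x0 \<rho>" "(r, A) \<in> Jplus \<Omega> u y"
      using jet_exists_in_ball[OF \<rho> cont osc] by metis
    have "r0 \<le> m x0 - (u y - \<eta>)" using jet[OF y] by (simp add: \<Theta>_iff)
    then show ?thesis using osc[OF y(1)] \<eta> unfolding s0_def by linarith
  qed
  have gs0: "0 < g s0" by (rule g_pos[OF s0])
  define c where "c = h x0 / g s0"
  have c: "0 \<le> c" using h_nonneg[OF x0] gs0 by (simp add: c_def)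
  have jet_det: "psd (A + M0) \<and> c \<le> det (A + M0)" if "y \<in> ball x0 \<rho>" "(r, A) \<in> Jplus \<Omega> u y" for y r A
  proof -
    have *: "psd (A + M0)" "h x0 \<le> g (m x0 - (u y - \<eta>)) * det (A + M0)"
      using jet[OF that] by (simp_all add: \<Theta>_iff M0_def add.assoc)
    have "g (m x0 - (u y - \<eta>)) \<le> g s0"
      using osc[OF that(1)] \<eta> by (intro monoD[OF mono_g]) (simp add: s0_def abs_less_iff)
    then have "g (m x0 - (u y - \<eta>)) * det (A + M0) \<le> g s0 * det (A + M0)"
      using psd_det_nonneg[OF *(1)] by (intro mult_right_mono)
    then have "h x0 \<le> g s0 * det (A + M0)" using *(2) by linarith
    then show ?thesis using *(1) gs0 by (simp add: c_def pos_divide_le_eq mult.commute)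
  qed
  define K where "K = (norm M0 + 1 + c) / 2 + 16 * \<eta> / \<rho>\<^sup>2"
  have K\<eta>: "16 * \<eta> / \<rho>\<^sup>2 \<le> K" and Kc: "norm M0 + 1 + c \<le> 2 * K" and K0: "0 < K"
  proof -
    define k where "k = 16 * \<eta> / \<rho>\<^sup>2"
    define n where "n = norm M0 + 1 + c"
    have n: "0 < n" using c by (simp add: n_def add_nonneg_pos add_pos_nonneg)
    have K: "K = n / 2 + k" by (simp only: K_def k_def n_def)
    have k: "0 < k" using \<eta> \<rho> by (simp add: k_def)
    show "16 * \<eta> / \<rho>\<^sup>2 \<le> K" unfolding k_def[symmetric] K using n by simp
    show "norm M0 + 1 + c \<le> 2 * K" unfolding n_def[symmetric] K using k by simp
    show "0 < K" unfolding K using k n by simp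
  qed
  have matK: "psd (mat (2 * K) + M0)" "c \<le> det (mat (2 * K) + M0)"
  proof -
    \<comment> \<open>The part of \<open>2 K I\<close> left after making \<open>M0\<close>
      nonnegative; being at least 1 and at least \<open>c\<close>, its power
      \<open>\<theta> ^ CARD('n)\<close> is at least \<open>c\<close>.\<close>
    define \<theta> where "\<theta> = 2 * K - norm M0"
    have \<theta>: "1 \<le> \<theta>" "c \<le> \<theta>" using Kc c by (auto simp: \<theta>_def)
    have "mat (2 * K) = mat (norm M0) + (mat \<theta> :: real^'n^'n)" by (simp add: \<theta>_def mat_def vec_eq_iff)
    then have eq: "mat (2 * K) + M0 = (M0 + mat (norm M0)) + mat \<theta>" by simp
    have psd: "psd (M0 + mat (norm M0))" using M0 by (intro psd_add_mat_norm) auto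
    show "psd (mat (2 * K) + M0)" unfolding eq using \<theta> by (intro psd_add[OF psd] psd_mat) simp
    have "c \<le> \<theta> ^ CARD('n)" using \<theta> self_le_power[OF \<theta>(1), of "CARD('n)"] by (simp add: zero_less_card_finite)
    also have "\<dots> \<le> det (M0 + mat (norm M0)) + \<theta> ^ CARD('n)" using psd_det_nonneg[OF psd] by simp
    also have "\<dots> \<le> det (mat (2 * K) + M0)" unfolding eq using psd \<theta> by (intro det_add_mat_ge) auto
    finally show "c \<le> det (mat (2 * K) + M0)" .
  qed
  define \<psi> where "\<psi> y = u x0 - 2 * \<eta> + K * ((y - x0) \<bullet> (y - x0))" for y
  have C2\<psi>: "is_C2 \<psi> (\<lambda>y. K *\<^sub>R (2 *\<^sub>R (y - x0))) (\<lambda>_. mat (2 * K)) UNIV"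
  proof -
    have "K *\<^sub>R mat 2 = (mat (2 * K) :: real^'n^'n)" by (simp add: mat_def vec_eq_iff)
    then show ?thesis
      using is_C2_add[OF is_C2_const[of "u x0 - 2 * \<eta>"] is_C2_mult[OF is_C2_sqdist[of x0], of K]]
      by (simp add: \<psi>_def[abs_def])
  qed
  have cont\<psi>: "continuous_on S \<psi>" for S
    using is_C2_continuous[OF C2\<psi>] by (rule continuous_on_subset) simp
  define \<kappa> where "\<kappa> y = (if y \<in> ball x0 \<rho> then max 0 (u y - \<psi> y) else 0)" for y
  have \<kappa>0: "0 \<le> \<kappa> y" for y by (simp add: \<kappa>_def)
  have far: "\<kappa> y = 0" if "\<rho>/2 < dist y x0" for y
  proof (cases "y \<in> ball x0 \<rho>")
    case True
    have "16 * \<eta> / \<rho>\<^sup>2 * (\<rho>/2)\<^sup>2 \<le> K * (dist y x0)\<^sup>2"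
      using that \<rho> K\<eta> K0 by (intro mult_mono power_mono) auto
    moreover have "16 * \<eta> / \<rho>\<^sup>2 * (\<rho>/2)\<^sup>2 = 4 * \<eta>" using \<rho> by (simp add: power_divide)
    ultimately have "u x0 + 2 * \<eta> \<le> \<psi> y" by (simp add: \<psi>_def dot_square_norm dist_norm)
    then have "u y - \<psi> y \<le> 0" using osc[OF True] \<eta> by linarith
    then show ?thesis by (simp add: \<kappa>_def)
  qed (simp add: \<kappa>_def)
  have cont\<kappa>: "continuous_on UNIV \<kappa>"
  proof -
    have "continuous_on (ball x0 \<rho>) (\<lambda>y. max 0 (u y - \<psi> y))" by (intro continuous_intros cont cont\<psi>)
    then have "continuous_on (ball x0 \<rho>) \<kappa>" by (simp add: \<kappa>_def cong: continuous_on_cong_simp)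
    moreover have "continuous_on {y. \<rho>/2 < dist y x0} \<kappa>"
      using far by (simp cong: continuous_on_cong_simp)
    moreover have "open {y. \<rho>/2 < dist y x0}" by (intro open_Collect_less continuous_intros)
    moreover have "ball x0 \<rho> \<union> {y. \<rho>/2 < dist y x0} = UNIV" using \<rho> by (auto simp: dist_commute)
    ultimately show ?thesis using continuous_on_open_Un[of "ball x0 \<rho>" "{y. \<rho>/2 < dist y x0}" \<kappa>] by simp
  qed
  have supp\<kappa>: "bounded_support \<kappa>"
  proof -
    have "\<kappa> y = 0" if "norm y > norm x0 + \<rho>" for y
      using that norm_triangle_ineq2[of y x0] \<rho> by (intro far) (simp add: dist_norm)
    then show ?thesis by (auto simp: bounded_support_def)
  qed
  \<comment> \<open>The half-space bound for the matrix \<open>A + 2 K I + M0\<close>, rewritten as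
    a bound on \<open>qtr T A\<close> for jets of \<open>\<kappa>\<close>.\<close>
  define b where "b T = CARD('n) * ((det T)\<^sup>2 * c) powr (1 / CARD('n)) - qtr T M0 - qtr T (mat (2 * K))" for T :: "real^'n^'n"
  have jets\<kappa>: "b T \<le> qtr T A" if j: "(r, A) \<in> Jplus UNIV \<kappa> y" for y r A T
  proof -
    obtain \<phi> U H D where C2: "is_C2 \<phi> D H U" and yU: "y \<in> U" and le: "\<And>z. z \<in> U \<Longrightarrow> \<kappa> z \<le> \<phi> z"
      and eq: "\<kappa> y = \<phi> y" and A: "A = H y"
      using j by (auto simp: Jplus_def C2_hess_iff)
    \<comment> \<open>A maximum of two subsolutions is a subsolution. Where \<open>\<kappa>\<close>
      vanishes, its lower bound 0 gives \<open>A \<ge> 0\<close> and the inequality for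
      \<open>\<psi>\<close> is enough; where it is positive, \<open>\<phi> + \<psi>\<close> touches
      \<open>u\<close> from above.\<close>
    show ?thesis
    proof (cases "\<kappa> y = 0")
      case True
      have "0 \<le> t \<bullet> (A *v t)" for t
        unfolding A using le eq True \<kappa>0 by (intro second_derivative_test[OF C2 yU]) (metis order_trans)
      then have "0 \<le> qtr T A" by (simp add: qtr_def sum_nonneg)
      moreover have "b T \<le> 0" using qtr_ge_det[OF matK(1) c matK(2), of T] by (simp add: b_def qtr_add)
      ultimately show ?thesis by linarith
    next
      case False
      then have yB: "y \<in> ball x0 \<rho>" and \<kappa>y: "\<kappa> y = u y - \<psi> y" by (auto simp: \<kappa>_def max_def split: if_splits)
      have "is_C2 (\<lambda>y. \<phi> y + \<psi> y) (\<lambda>y. D y + K *\<^sub>R (2 *\<^sub>R (y - x0))) (\<lambda>y. H y + mat (2 * K)) (U \<inter> ball x0 \<rho>)"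
        using is_C2_subset[OF is_C2_add[OF C2 C2\<psi>], of "U \<inter> ball x0 \<rho>"] C2 by (auto simp: is_C2_def)
      then have "(u y, (\<lambda>y. H y + mat (2 * K)) y) \<in> Jplus \<Omega> u y"
      proof (rule JplusI)
        show "y \<in> U \<inter> ball x0 \<rho>" using yU yB by simp
        show "U \<inter> ball x0 \<rho> \<subseteq> \<Omega>" using \<rho>(2) by blast
        fix z assume z: "z \<in> U \<inter> ball x0 \<rho>"
        then have "u z - \<psi> z \<le> \<kappa> z" by (simp add: \<kappa>_def)
        also have "\<dots> \<le> \<phi> z" using le z by blast
        finally show "u z - (\<phi> z + \<psi> z) \<le> u y - (\<phi> y + \<psi> y)" using eq \<kappa>y by simp
      qed
      then have "psd (A + mat (2 * K) + M0)" "c \<le> det (A + mat (2 * K) + M0)"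
        using jet_det[OF yB] A by auto
      from qtr_ge_det[OF this(1) c this(2), of T] show ?thesis by (simp add: b_def qtr_add)
    qed
  qed
  \<comment> \<open>Up to this radius \<open>\<psi>\<close> rises by at most \<open>\<eta>\<close>,
    so it stays below \<open>u x0 - \<eta>\<close> and hence below \<open>u\<close>; there
    \<open>\<kappa> + \<psi>\<close> is \<open>u\<close> itself.\<close>
  define \<rho>' where "\<rho>' = min (\<rho>/2) (sqrt (\<eta> / K))"
  have \<rho>': "0 < \<rho>'" "\<rho>' \<le> \<rho>/2" "K * \<rho>'\<^sup>2 \<le> \<eta>"
  proof -
    show "0 < \<rho>'" "\<rho>' \<le> \<rho>/2" using \<rho> \<eta> K0 by (auto simp: \<rho>'_def)
    have "\<rho>'\<^sup>2 \<le> (sqrt (\<eta> / K))\<^sup>2" using \<open>0 < \<rho>'\<close> by (intro power_mono) (auto simp: \<rho>'_def)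
    also have "\<dots> = \<eta> / K" using \<eta> K0 by simp
    finally show "K * \<rho>'\<^sup>2 \<le> \<eta>" using K0 by (simp add: pos_le_divide_eq mult.commute)
  qed
  have cb: "cball x0 \<rho>' \<subseteq> ball x0 \<rho>" using \<rho> \<rho>' by auto
  have near: "\<kappa> y = u y - \<psi> y" if "y \<in> cball x0 \<rho>'" for y
  proof -
    have yB: "y \<in> ball x0 \<rho>" using that cb by blast
    have "K * (dist y x0)\<^sup>2 \<le> K * \<rho>'\<^sup>2"
      using that K0 by (intro mult_left_mono power_mono) (auto simp: dist_commute)
    then have "\<psi> y \<le> u x0 - \<eta>" using \<rho>'(3) by (simp add: \<psi>_def dot_square_norm dist_norm)
    then have "0 \<le> u y - \<psi> y" using osc[OF yB] by linarith
    then show ?thesis using yB by (simp add: \<kappa>_def)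
  qed
  show thesis
  proof (rule that[of \<rho>'])
    show "0 < \<rho>'" by (rule \<rho>')
    show "cball x0 \<rho>' \<subseteq> \<Omega>" using cb \<rho>(2) by blast
    show "\<bar>u y - u x0\<bar> < \<eta>" if "y \<in> cball x0 \<rho>'" for y using that cb by (intro osc) blast
    fix \<tau> :: real assume \<tau>: "0 < \<tau>"
    obtain d where d: "0 < d" "\<And>y z. dist z y < d \<Longrightarrow> dist (\<kappa> z) (\<kappa> y) < \<tau>"
      using bounded_support_uniformly_continuous[OF cont\<kappa> supp\<kappa>] \<tau> unfolding uniformly_continuous_on_def
      by (metis UNIV_I)
    define \<delta> where "\<delta> = d / 2"
    have \<delta>: "0 < \<delta>" using d by (simp add: \<delta>_def)
    have close: "\<bar>mollify \<delta> \<kappa> y - \<kappa> y\<bar> \<le> \<tau>" for y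
    proof (rule mollify_close[OF cont\<kappa> \<delta>])
      show "\<bar>\<kappa> (y - z) - \<kappa> y\<bar> \<le> \<tau>" if "norm z \<le> \<delta>" for z
        using d(2)[of "y - z" y] that d(1) by (simp add: dist_norm \<delta>_def)
    qed
    obtain D H where C2: "is_C2 (mollify \<delta> \<kappa>) D H UNIV" and HSym: "\<And>x. H x \<in> Sym" and Hsupp: "bounded_support H"
      using mollify_C2[OF cont\<kappa> supp\<kappa>, of \<delta>] by metis
    let ?f = "\<lambda>y. mollify \<delta> \<kappa> y + \<psi> y"
    let ?H = "\<lambda>y. H y + mat (2 * K)"
    have C2f: "is_C2 ?f (\<lambda>y. D y + K *\<^sub>R (2 *\<^sub>R (y - x0))) ?H UNIV"
      using is_C2_add[OF C2 C2\<psi>] by simp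
    have "\<bar>?f y - u y\<bar> \<le> \<tau>" if "y \<in> cball x0 \<rho>'" for y
      using close[of y] near[OF that] by simp
    moreover have "(u x0 - 4 * \<eta>, ?H y + mat (2 * \<eta>)) \<in> \<Theta> y" if "y \<in> cball x0 \<rho>'" for y
    proof -
      have qtr: "b T \<le> qtr T (H y)" for T
        by (rule mollify_qtr_ge[OF cont\<kappa> supp\<kappa> \<delta> _ C2 Hsupp]) (rule jets\<kappa>)
      have Sym: "?H y + M0 \<in> Sym" by (intro Sym_add HSym Sym_mat M0)
      have "CARD('n) * ((det T)\<^sup>2 * c) powr (1 / CARD('n)) \<le> qtr T (?H y + M0)" for T
        using qtr[of T] by (simp add: b_def qtr_add)
      then have psd: "psd (?H y + M0)" and det: "c \<le> det (?H y + M0)"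
        using psd_det_geI[OF Sym c] by blast+
      have "h x0 \<le> g s0 * det (?H y + M0)"
        using det gs0 by (simp add: c_def pos_divide_le_eq mult.commute)
      \<comment> \<open>Unfreezing costs one more \<open>\<eta>\<close> in each component, which
        explains the \<open>4 * \<eta>\<close> and \<open>2 * \<eta>\<close> of the
        conclusion.\<close>
      then have "(u x0 - 3 * \<eta>, ?H y + mat \<eta>) \<in> \<Theta> x0"
        using psd s0 HSym by (simp add: \<Theta>_iff s0_def M0_def add.assoc Sym_add Sym_mat)
      from to[OF _ this] have "(u x0 - 3 * \<eta> - \<eta>, ?H y + mat \<eta> + mat \<eta>) \<in> \<Theta> y" using that cb by blast
      moreover have "mat \<eta> + mat \<eta> = (mat (2 * \<eta>) :: real^'n^'n)" by (simp add: mat_def vec_eq_iff)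
      ultimately show ?thesis by (simp add: add.assoc)
    qed
    ultimately show "\<exists>f D H. is_C2 f D H UNIV \<and>
        (\<forall>y\<in>cball x0 \<rho>'. \<bar>f y - u y\<bar> \<le> \<tau> \<and> (u x0 - 4 * \<eta>, H y + mat (2 * \<eta>)) \<in> \<Theta> y)"
      using C2f by blast
  qed
qed

lemma comparison:
  assumes u: "usc_on (closure \<Omega>) u" and v: "lsc_on (closure \<Omega>) v"
    and sub: "visc_sub \<Omega> (Fop g m M h) \<Phi> u" and super: "visc_super \<Omega> (Fop g m M h) \<Phi> v"
    and bdry: "\<And>x. x \<in> frontier \<Omega> \<Longrightarrow> u x \<le> v x" and x: "x \<in> \<Omega>"
  shows "u x \<le> v x"
proof (rule ccontr)
  assume "\<not> u x \<le> v x"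
  then have gap: "0 < u x - v x" by simp
  have bc: "bounded (closure \<Omega>)" using bounded_domain by (rule bounded_closure)
  then obtain R where R: "0 < R" "\<And>y. y \<in> closure \<Omega> \<Longrightarrow> norm y \<le> R" using bounded_pos by metis
  \<comment> \<open>Over the whole domain the added paraboloid then varies by at most half of the
    gap at \<open>x\<close>.\<close>
  define \<epsilon> where "\<epsilon> = (u x - v x) / (2 * R\<^sup>2)"
  have \<epsilon>: "0 < \<epsilon>" using gap R by (simp add: \<epsilon>_def)
  have \<epsilon>R: "\<epsilon> * R\<^sup>2 < u x - v x" using gap R by (simp add: \<epsilon>_def)
  \<comment> \<open>Normalized to be nonpositive on the closure, so a positive maximum of
    \<open>u + k - v\<close> still means \<open>u > v\<close> and cannot sit on the
    boundary.\<close>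
  define k where "k y = \<epsilon> * (y \<bullet> y) - \<epsilon> * R\<^sup>2" for y :: "real^'n"
  have k_nonpos: "k y \<le> 0" if "y \<in> closure \<Omega>" for y
  proof -
    have "(norm y)\<^sup>2 \<le> R\<^sup>2" using R(2)[OF that] by (intro power_mono) auto
    then show ?thesis using \<epsilon> by (simp add: k_def dot_square_norm)
  qed
  have "usc_on (closure \<Omega>) (\<lambda>y. (u y + k y) + - v y)"
    unfolding k_def by (intro usc_on_add u lsc_imp_usc_uminus v continuous_imp_usc continuous_intros)
  moreover have "compact (closure \<Omega>)" using bc by (simp add: compact_eq_bounded_closed)
  moreover have xc: "x \<in> closure \<Omega>" using x closure_subset by blast
  ultimately have "\<exists>z\<in>closure \<Omega>. \<forall>y\<in>closure \<Omega>. (u y + k y) + - v y \<le> (u z + k z) + - v z"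
    by (intro usc_attains_sup) auto
  then obtain x0 where x0c: "x0 \<in> closure \<Omega>"
    and max0: "\<And>y. y \<in> closure \<Omega> \<Longrightarrow> u y + k y - v y \<le> u x0 + k x0 - v x0" by auto
  have "0 < u x0 + k x0 - v x0"
  proof -
    have "- (\<epsilon> * R\<^sup>2) \<le> k x" using \<epsilon> by (simp add: k_def)
    then show ?thesis using max0[OF xc] \<epsilon>R by linarith
  qed
  then have gap0: "0 < u x0 - v x0" using k_nonpos[OF x0c] by linarith
  have "x0 \<notin> frontier \<Omega>" using bdry[of x0] gap0 by auto
  then have x0: "x0 \<in> \<Omega>" using x0c open_domain by (simp add: frontier_def interior_open)
  define \<eta> where "\<eta> = min (\<epsilon> / 4) ((u x0 - v x0) / 8)"
  have \<eta>: "0 < \<eta>" "4 * \<eta> \<le> \<epsilon>" "8 * \<eta> \<le> u x0 - v x0" using \<epsilon> gap0 by (auto simp: \<eta>_def min_def)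
  obtain \<rho>1 where \<rho>1: "0 < \<rho>1" "cball x0 \<rho>1 \<subseteq> \<Omega>" and osc: "\<And>y. y \<in> cball x0 \<rho>1 \<Longrightarrow> \<bar>u y - u x0\<bar> < \<eta>"
    and smooth: "\<And>\<tau>. 0 < \<tau> \<Longrightarrow> \<exists>f D H. is_C2 f D H UNIV \<and>
        (\<forall>y\<in>cball x0 \<rho>1. \<bar>f y - u y\<bar> \<le> \<tau> \<and> (u x0 - 4 * \<eta>, H y + mat (2 * \<eta>)) \<in> \<Theta> y)"
    using smooth_subsolution[OF x0 sub \<eta>(1)] by blast
  \<comment> \<open>Half of the paraboloid is given up to make \<open>x0\<close> a strict maximum,
    which survives a uniformly small perturbation of \<open>u\<close>; the Hessian left over is
    \<open>2 \<epsilon> I - \<epsilon> I = \<epsilon> I\<close>.\<close>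
  define q where "q y = \<epsilon> * (y \<bullet> y) - \<epsilon> / 2 * ((y - x0) \<bullet> (y - x0))" for y
  have C2q: "is_C2 q (\<lambda>y. \<epsilon> *\<^sub>R (2 *\<^sub>R (y - 0)) + (- (\<epsilon> / 2)) *\<^sub>R (2 *\<^sub>R (y - x0))) (\<lambda>_. mat \<epsilon>) UNIV"
  proof -
    have "\<epsilon> *\<^sub>R mat 2 + (- (\<epsilon> / 2)) *\<^sub>R mat 2 = (mat \<epsilon> :: real^'n^'n)" by (simp add: mat_def vec_eq_iff)
    then show ?thesis
      using is_C2_add[OF is_C2_mult[OF is_C2_sqdist[of 0], of \<epsilon>] is_C2_mult[OF is_C2_sqdist[of x0], of "- (\<epsilon>/2)"]]
      unfolding q_def[abs_def] by simp
  qed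
  have "continuous_on UNIV q" by (rule is_C2_continuous[OF C2q])
  then obtain d where d: "0 < d" "\<And>y. dist y x0 < d \<Longrightarrow> dist (q y) (q x0) < \<eta>"
    using \<eta>(1) unfolding continuous_on_iff by (metis UNIV_I)
  define \<rho> where "\<rho> = min \<rho>1 (d / 2)"
  have \<rho>: "0 < \<rho>" "\<rho> < d" "cball x0 \<rho> \<subseteq> cball x0 \<rho>1" using \<rho>1 d by (auto simp: \<rho>_def)
  \<comment> \<open>Replacing \<open>u\<close> by \<open>f\<close> costs \<open>2 * \<tau>\<close>,
    which must stay below the drop \<open>\<epsilon> * \<rho>\<^sup>2 / 2\<close> on the sphere of
    radius \<open>\<rho>\<close>.\<close>
  define \<tau> where "\<tau> = min (\<eta> / 2) (\<epsilon> * \<rho>\<^sup>2 / 8)"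
  have \<tau>: "0 < \<tau>" "2 * \<tau> \<le> \<eta>" "8 * \<tau> \<le> \<epsilon> * \<rho>\<^sup>2" using \<eta> \<epsilon> \<rho> by (auto simp: \<tau>_def min_def)
  obtain f D H where C2f: "is_C2 f D H UNIV" and fu: "\<And>y. y \<in> cball x0 \<rho>1 \<Longrightarrow> \<bar>f y - u y\<bar> \<le> \<tau>"
    and fH: "\<And>y. y \<in> cball x0 \<rho>1 \<Longrightarrow> (u x0 - 4 * \<eta>, H y + mat (2 * \<eta>)) \<in> \<Theta> y"
    using smooth[OF \<tau>(1)] by blast
  have strict: "u y + q y - v y \<le> u x0 + q x0 - v x0 - \<epsilon> / 2 * (dist y x0)\<^sup>2" if "y \<in> \<Omega>" for y
    using max0[of y] that closure_subset[of \<Omega>]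
    by (auto simp: q_def k_def dist_norm power2_norm_eq_inner)
  have cbc: "cball x0 \<rho> \<subseteq> closure \<Omega>" using \<rho>(3) \<rho>1(2) closure_subset[of \<Omega>] by blast
  have "continuous_on UNIV f" by (rule is_C2_continuous[OF C2f])
  then have "continuous_on (cball x0 \<rho>) f" "continuous_on (cball x0 \<rho>) q"
    using \<open>continuous_on UNIV q\<close> by (auto intro: continuous_on_subset)
  then have "usc_on (cball x0 \<rho>) (\<lambda>y. (f y + q y) + - v y)"
    by (intro usc_on_add[OF _ usc_on_subset[OF lsc_imp_usc_uminus[OF v] cbc]] continuous_imp_usc continuous_on_add)
  then have "\<exists>z\<in>cball x0 \<rho>. \<forall>y\<in>cball x0 \<rho>. (f y + q y) + - v y \<le> (f z + q z) + - v z"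
    using \<rho>(1) by (intro usc_attains_sup) auto
  then obtain z where z: "z \<in> cball x0 \<rho>" and zmax: "\<And>y. y \<in> cball x0 \<rho> \<Longrightarrow> f y + q y - v y \<le> f z + q z - v z"
    by auto
  have z1: "z \<in> cball x0 \<rho>1" and x01: "x0 \<in> cball x0 \<rho>1" using z \<rho> \<rho>1 by auto
  have z\<Omega>: "z \<in> \<Omega>" using z1 \<rho>1 by blast
  have z0: "f x0 + q x0 - v x0 \<le> f z + q z - v z" using \<rho>(1) by (intro zmax) simp
  have "dist z x0 \<noteq> \<rho>"
  proof
    assume "dist z x0 = \<rho>"
    then have "u z + q z - v z \<le> u x0 + q x0 - v x0 - \<epsilon> * \<rho>\<^sup>2 / 2" using strict[OF z\<Omega>] by simp
    moreover have "0 < \<epsilon> * \<rho>\<^sup>2" using \<epsilon> \<rho> by simp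
    ultimately show False using fu[OF z1] fu[OF x01] z0 \<tau>(3) unfolding abs_le_iff by linarith
  qed
  then have zb: "z \<in> ball x0 \<rho>" using z by (simp add: dist_commute)
  \<comment> \<open>From the gap of \<open>8 * \<eta>\<close> at \<open>x0\<close>, one
    \<open>\<eta>\<close> each is lost to the variation of \<open>q\<close>, to the approximation
    error \<open>2 * \<tau>\<close> and to the variation of \<open>u\<close>.\<close>
  have vz: "v z \<le> u x0 - 5 * \<eta>"
  proof -
    have "\<bar>q z - q x0\<bar> < \<eta>" using d(2)[of z] z \<rho>(2) by (simp add: dist_commute dist_real_def)
    then show ?thesis
      using fu[OF z1] fu[OF x01] z0 \<tau>(2) osc[OF z1] \<eta>(3) unfolding abs_le_iff abs_less_iff by linarith
  qed
  have "is_C2 (\<lambda>y. f y + q y) (\<lambda>y. D y + (\<epsilon> *\<^sub>R (2 *\<^sub>R (y - 0)) + (- (\<epsilon> / 2)) *\<^sub>R (2 *\<^sub>R (y - x0)))) (\<lambda>y. H y + mat \<epsilon>) (ball x0 \<rho>)"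
    by (rule is_C2_subset[OF is_C2_add[OF C2f C2q]]) auto
  then have "(v z, (\<lambda>y. H y + mat \<epsilon>) z) \<in> Jminus \<Omega> v z"
  proof (rule JminusI)
    show "z \<in> ball x0 \<rho>" by (rule zb)
    show "ball x0 \<rho> \<subseteq> \<Omega>" using \<rho>(3) \<rho>1(2) ball_subset_cball[of x0 \<rho>] by blast
    show "f y + q y - v y \<le> f z + q z - v z" if "y \<in> ball x0 \<rho>" for y
      using that ball_subset_cball by (intro zmax) blast
  qed
  then have jet: "(v z, H z + mat \<epsilon>) \<in> Jminus \<Omega> v z" by simp
  \<comment> \<open>The margins exceed the requirements \<open>4 * \<eta>\<close> and
    \<open>2 * \<eta>\<close> of the smooth subsolution by at least \<open>\<eta>\<close> in each
    component. This surplus makes the jet of \<open>v\<close> interior and the inequality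
    strict.\<close>
  have "(v z + \<eta>, H z + mat \<epsilon> - mat \<eta>) \<in> \<Theta> z"
  proof -
    have "mat \<epsilon> = mat (2 * \<eta>) + mat (\<epsilon> - 3 * \<eta>) + (mat \<eta> :: real^'n^'n)" by (simp add: mat_def vec_eq_iff)
    then have "H z + mat \<epsilon> - mat \<eta> = H z + mat (2 * \<eta>) + mat (\<epsilon> - 3 * \<eta>)" by simp
    moreover have "v z + \<eta> = (u x0 - 4 * \<eta>) + (v z + \<eta> - (u x0 - 4 * \<eta>))" by simp
    moreover have "((u x0 - 4 * \<eta>) + (v z + \<eta> - (u x0 - 4 * \<eta>)), H z + mat (2 * \<eta>) + mat (\<epsilon> - 3 * \<eta>)) \<in> \<Theta> z"
      using vz \<eta> by (intro \<Theta>_add fH z1 psd_mat) auto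
    ultimately show ?thesis by (simp only:)
  qed
  note \<Theta>_gain[OF \<eta>(1) this] \<Theta>_interior[OF \<eta>(1) this]
  moreover have "symtop interior_of \<Theta> z \<subseteq> symtop interior_of \<Phi> z"
    by (rule interior_of_mono) (auto simp: \<Theta>_def)
  moreover have "Fop g m M h z (v z) (H z + mat \<epsilon>) \<le> 0 \<or> (v z, H z + mat \<epsilon>) \<notin> symtop interior_of \<Phi> z"
    using super z\<Omega> jet by (simp add: visc_super_def)
  ultimately show False by (auto simp: Fop_def)
qed

end

theorem theorem6p16:
  fixes \<Omega> :: "(real^'n) set"
    and h m :: "real^'n \<Rightarrow> real"
    and M :: "real^'n \<Rightarrow> real^'n^'n"
    and g :: "real \<Rightarrow> real"
    and r0 :: real
    and \<Phi> \<Theta> :: "real^'n \<Rightarrow> (real \<times> (real^'n^'n)) set"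
  assumes "bounded \<Omega>" and "open \<Omega>" and "connected \<Omega>"
    and "continuous_on \<Omega> h" and "\<forall>x\<in>\<Omega>. h x \<ge> 0"
    and "continuous_on \<Omega> m"
    and "continuous_on \<Omega> M" and "\<forall>x\<in>\<Omega>. M x \<in> Sym"
    and "continuous_on UNIV g" and "mono g" and "g r0 = 0" and "\<forall>r>r0. g r > 0"
    and \<Phi>_def: "\<And>x. \<Phi> x = {(r, A). A \<in> Sym \<and> m x - r \<ge> r0 \<and> psd (A + M x)}"
    and \<Theta>_def: "\<And>x. \<Theta> x = {(r, A). (r, A) \<in> \<Phi> x \<and> g (m x - r) * det (A + M x) \<ge> h x}"
  shows "hausdorff_continuous \<Omega> \<Theta> \<and> proper_elliptic_map \<Omega> \<Theta>
     \<and> (\<forall>x\<in>\<Omega>. symtop frontier_of (\<Theta> x) \<subseteq> {(r, A). g (m x - r) * det (A + M x) = h x})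
     \<and> (\<forall>u v. usc_on (closure \<Omega>) u \<and> lsc_on (closure \<Omega>) v
           \<and> visc_sub \<Omega> (Fop g m M h) \<Phi> u \<and> visc_super \<Omega> (Fop g m M h) \<Phi> v
           \<and> (\<forall>x\<in>frontier \<Omega>. u x \<le> v x)
           \<longrightarrow> (\<forall>x\<in>\<Omega>. u x \<le> v x))"
proof -
  interpret monge_ampere \<Omega> h m M g r0 \<Phi> \<Theta>
    using assms by unfold_locales auto
  show ?thesis
    using hausdorff_continuous_\<Theta> proper_elliptic_\<Theta> frontier_\<Theta> comparison by blast
qed

end
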